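(* Let $d\ge 2$. The $d$-Weddle locus, with its $d$-Weddle scheme structure, for a general set of $\binom{d+2}{2}+1$ points in $\mathbb{P}^3$ (over $\mathbb{C}$) is an arithmetically Cohen–Macaulay curve of degree $$\binom{\binom{d+2}{3}}{2}=\frac{1}{72}d^6+\frac{1}{12}d^5+\frac{13}{72}d^4+\frac{1}{12}d^3-\frac{7}{36}d^2-\frac16 d .$$
   Context: "General" set of points means: for all sets corresponding to a nonempty Zariski open subset of the parameter space. For a finite set $Z=\{P_1,\dots,P_r\}\subset\mathbb{P}^3$ and $P\in\mathbb{P}^3\setminus Z$, let $\delta(P)=\dim_{\mathbb{C}}[I(Z)\cap I(P)^d]_d$, the dimension of the space of degree $d$ cones with vertex $P$ containing $Z$ (equivalently, of degree $d$ plane curves containing the projection of $Z$ from $P$). The $d$-Weddle locus of $Z$ is the Zariski closure of the set of $P\in\mathbb{P}^3\setminus Z$ at which $\delta(P)$ exceeds its minimal (generic) value. Scheme structure: let $R=\mathbb{C}[x_0,\dots,x_3]$, let $M_j$ run over the monomials of degree $d$ and $m_i$ over those of degree $d-1$. The interpolation matrix $\Lambda(Z+dQ,d)$, with $Q=[x_0:\dots:x_3]$, has columns indexed by the $M_j$; its first $r$ rows have entries $M_j(P_i)$ (for fixed coordinate representatives), and its remaining rows, indexed by the $m_i$, have entries $\partial_{m_i}M_j$, where $\partial_m$ is the iterated partial derivative with exponents given by $m$. Let $\rho$ be its rank for general $Q$. The $d$-Weddle scheme of $Z$ is the subscheme of $\mathbb{P}^3$ defined by the saturation of the ideal generated by the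 $\rho\times\rho$ minors of $\Lambda(Z+dQ,d)$. *)

theory Defs
  imports
    Complex_Main
    "HOL-Library.Poly_Mapping"
    "HOL-Library.Numeral_Type"
    "HOL-Library.Extended_Nat"
    "HOL-Computational_Algebra.Polynomial"
    "HOL-Algebra.QuotRing"
    "HOL-Algebra.Ideal_Product"
    "HOL-Algebra.Ring_Divisibility"
    "HOL-Algebra.Algebraic_Closure_Type"
    "Jordan_Normal_Form.Determinant"
    "Jordan_Normal_Form.DL_Rank"
    "Jordan_Normal_Form.DL_Submatrix"
begin

section \<open>Polynomials\<close>

text \<open>
  Complex polynomials in variables indexed by a type \<open>'x\<close> are finitely supported maps from
  exponent vectors to coefficients; their product is the convolution product of
  \<^theory>\<open>HOL-Library.Poly_Mapping\<close>.  Over the four-element index type \<open>4 = {0,1,2,3}\<close> this gives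
  the homogeneous coordinate ring of three-dimensional projective space.
\<close>

type_synonym 'x monomial = "'x \<Rightarrow>\<^sub>0 nat"
type_synonym 'x mpoly = "'x monomial \<Rightarrow>\<^sub>0 complex"
type_synonym mon4 = "4 monomial"
type_synonym poly4 = "4 mpoly"

abbreviation PR :: "poly4 ring" where
  "PR \<equiv> ring_of_type_algebra"

definition mdeg :: "'x monomial \<Rightarrow> nat" where
  "mdeg m = (\<Sum>i\<in>Poly_Mapping.keys m. Poly_Mapping.lookup m i)"

definition monomial_val :: "('x \<Rightarrow> complex) \<Rightarrow> 'x monomial \<Rightarrow> complex" where
  "monomial_val v m = (\<Prod>i\<in>Poly_Mapping.keys m. v i ^ Poly_Mapping.lookup m i)"

definition peval :: "('x \<Rightarrow> complex) \<Rightarrow> 'x mpoly \<Rightarrow> complex" where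
  "peval v f = (\<Sum>m\<in>Poly_Mapping.keys f. Poly_Mapping.lookup f m * monomial_val v m)"

definition const :: "complex \<Rightarrow> 'x mpoly" where
  "const c = Poly_Mapping.single 0 c"

definition forms :: "nat \<Rightarrow> poly4 set" where
  "forms t = {f. \<forall>m\<in>Poly_Mapping.keys f. mdeg m = t}"

definition homogeneous :: "poly4 \<Rightarrow> bool" where
  "homogeneous f \<longleftrightarrow> (\<exists>t. f \<in> forms t)"

text \<open>
  If \<open>i\<close> does not occur in \<open>m\<close>, the subtraction truncates, but the coefficient is then 0.
\<close>

definition partial_deriv :: "4 \<Rightarrow> poly4 \<Rightarrow> poly4" where
  "partial_deriv i f = (\<Sum>m\<in>Poly_Mapping.keys f.
     Poly_Mapping.single (m - Poly_Mapping.single i 1) (of_nat (Poly_Mapping.lookup m i) * Poly_Mapping.lookup f m))"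

definition iterated_deriv :: "mon4 \<Rightarrow> poly4 \<Rightarrow> poly4" where
  "iterated_deriv m f =
     (partial_deriv 0 ^^ Poly_Mapping.lookup m 0) ((partial_deriv 1 ^^ Poly_Mapping.lookup m 1)
       ((partial_deriv 2 ^^ Poly_Mapping.lookup m 2) ((partial_deriv 3 ^^ Poly_Mapping.lookup m 3) f)))"

interpretation poly_vs: vector_space "\<lambda>(c::complex) (f::poly4). const c * f"
proof
  fix a b :: complex and x y :: poly4
  show "const a * (x + y) = const a * x + const a * y"
    by (rule distrib_left)
  show "const (a + b) * x = const a * x + const b * x"
    by (simp add: const_def single_add distrib_right)
  show "const a * (const b * x) = const (a * b) * x"
    by (simp add: const_def mult_single flip: mult.assoc)
  show "const 1 * x = x"
    by (simp add: const_def)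
qed

section \<open>Three-dimensional projective space and its Zariski topology\<close>

definition proportional :: "(4 \<Rightarrow> complex) \<Rightarrow> (4 \<Rightarrow> complex) \<Rightarrow> bool" where
  "proportional v w \<longleftrightarrow> v \<noteq> (\<lambda>_. 0) \<and> w \<noteq> (\<lambda>_. 0) \<and> (\<exists>c. w = (\<lambda>i. c * v i))"

text \<open>\<open>rep_proj3 P\<close> is the fixed (arbitrarily chosen) coordinate representative of \<open>P\<close>.\<close>

quotient_type proj3 = "4 \<Rightarrow> complex" / partial: proportional
proof (rule part_equivpI)
  show "\<exists>v. proportional v v"
  proof
    have "\<exists>c::complex. (\<lambda>_::4. 1) = (\<lambda>i. c * 1)" by (rule exI[of _ 1]) simp
    then show "proportional (\<lambda>_. 1) (\<lambda>_. 1)"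
      by (auto simp: proportional_def fun_eq_iff)
  qed
  show "symp proportional"
  proof (rule sympI)
    fix v w assume vw: "proportional v w"
    then obtain c where c: "w = (\<lambda>i. c * v i)" by (auto simp: proportional_def)
    then have "c \<noteq> 0" using vw by (auto simp: proportional_def)
    then have "v = (\<lambda>i. inverse c * w i)" using c by (simp add: fun_eq_iff)
    then show "proportional w v" using vw unfolding proportional_def by blast
  qed
  show "transp proportional"
  proof (rule transpI)
    fix u v w assume uv: "proportional u v" and vw: "proportional v w"
    then obtain a b where "v = (\<lambda>i. a * u i)" "w = (\<lambda>i. b * v i)"
      by (auto simp: proportional_def)
    then have "w = (\<lambda>i. (b * a) * u i)" by (simp add: fun_eq_iff)
    then show "proportional u w" using uv vw unfolding proportional_def by blast
  qed
qed

text \<open>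
  For sets of homogeneous polynomials, and for homogeneous ideals, vanishing does not depend on
  the chosen representatives.
\<close>

definition zero_locus :: "poly4 set \<Rightarrow> proj3 set" where
  "zero_locus F = {P. \<forall>f\<in>F. peval (rep_proj3 P) f = 0}"

definition zariski_closed :: "proj3 set \<Rightarrow> bool" where
  "zariski_closed A \<longleftrightarrow> (\<exists>F. (\<forall>f\<in>F. homogeneous f) \<and> A = zero_locus F)"

definition zariski_open :: "proj3 set \<Rightarrow> bool" where
  "zariski_open U \<longleftrightarrow> zariski_closed (- U)"

definition zariski_closure :: "proj3 set \<Rightarrow> proj3 set" where
  "zariski_closure A = \<Inter> {C. zariski_closed C \<and> A \<subseteq> C}"

text \<open>
  Polynomials on the \<open>r\<close>-fold product of projective 3-space: the variable \<open>(i, j)\<close> is the \<open>j\<close>-th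
  homogeneous coordinate of the \<open>i\<close>-th point, and \<open>e\<close> is the multidegree.
\<close>

definition multihomogeneous :: "nat \<Rightarrow> (nat \<times> 4) mpoly \<Rightarrow> bool" where
  "multihomogeneous r f \<longleftrightarrow> (\<exists>e. \<forall>m\<in>Poly_Mapping.keys f.
     fst ` Poly_Mapping.keys m \<subseteq> {..<r} \<and> (\<forall>i<r. (\<Sum>j\<in>UNIV. Poly_Mapping.lookup m (i, j)) = e i))"

text \<open>Zariski open subsets of the \<open>r\<close>-fold product, whose elements are lists of length \<open>r\<close>.\<close>

definition zariski_open_tuples :: "nat \<Rightarrow> proj3 list set \<Rightarrow> bool" where
  "zariski_open_tuples r U \<longleftrightarrow> (\<exists>F. (\<forall>f\<in>F. multihomogeneous r f) \<and>
     U = {Ps. length Ps = r \<and> (\<exists>f\<in>F. peval (\<lambda>(i, j). rep_proj3 (Ps ! i) j) f \<noteq> 0)})"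

text \<open>
  The parameter space of sets of \<open>r\<close> points is the space of \<open>r\<close>-tuples of distinct points, modulo
  reordering; \<open>\<Phi>\<close> has to hold on a nonempty Zariski open subset of it.
\<close>

definition for_general_points :: "nat \<Rightarrow> (proj3 list \<Rightarrow> bool) \<Rightarrow> bool" where
  "for_general_points r \<Phi> \<longleftrightarrow> (\<exists>U. zariski_open_tuples r U \<and> U \<noteq> {} \<and>
     (\<forall>Ps\<in>U. distinct Ps \<and> \<Phi> Ps))"

section \<open>Dimension and the Cohen-Macaulay property\<close>

definition prime_chain :: "('a, 'b) ring_scheme \<Rightarrow> (nat \<Rightarrow> 'a set) \<Rightarrow> nat \<Rightarrow> bool" where
  "prime_chain A p n \<longleftrightarrow> (\<forall>i\<le>n. primeideal (p i) A) \<and> (\<forall>i<n. p i \<subset> p (Suc i))"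

definition height :: "('a, 'b) ring_scheme \<Rightarrow> 'a set \<Rightarrow> enat" where
  "height A P = Sup {enat n | n p. prime_chain A p n \<and> p n = P}"

definition krull_dim :: "('a, 'b) ring_scheme \<Rightarrow> enat" where
  "krull_dim A = Sup {enat n | n p. prime_chain A p n}"

definition regular_sequence :: "('a, 'b) ring_scheme \<Rightarrow> 'a list \<Rightarrow> bool" where
  "regular_sequence A xs \<longleftrightarrow> set xs \<subseteq> carrier A \<and> Idl\<^bsub>A\<^esub> (set xs) \<noteq> carrier A \<and>
     (\<forall>i<length xs. \<forall>a\<in>carrier A.
        a \<otimes>\<^bsub>A\<^esub> (xs ! i) \<in> Idl\<^bsub>A\<^esub> (set (take i xs)) \<longrightarrow> a \<in> Idl\<^bsub>A\<^esub> (set (take i xs)))"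

definition depth :: "('a, 'b) ring_scheme \<Rightarrow> 'a set \<Rightarrow> enat" where
  "depth A P = Sup {enat (length xs) | xs. regular_sequence A xs \<and> set xs \<subseteq> P}"

text \<open>
  The definition of a Cohen-Macaulay ring in Eisenbud, Commutative Algebra, Section 18.2, where
  the codimension of a prime ideal is its height.
\<close>

definition cohen_macaulay :: "('a, 'b) ring_scheme \<Rightarrow> bool" where
  "cohen_macaulay A \<longleftrightarrow> cring A \<and> noetherian_ring A \<and>
     (\<forall>P. maximalideal P A \<longrightarrow> depth A P = height A P)"

section \<open>Closed subschemes of projective space\<close>

text \<open>
  A closed subscheme is given by its saturated homogeneous ideal.
\<close>

definition irrelevant_ideal :: "poly4 set" where
  "irrelevant_ideal = Idl\<^bsub>PR\<^esub> {Poly_Mapping.single (Poly_Mapping.single i 1) 1 | i. True}"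

definition ideal_power :: "poly4 set \<Rightarrow> nat \<Rightarrow> poly4 set" where
  "ideal_power I k = I [^]\<^bsub>ideals_set PR\<^esub> k"

definition saturation :: "poly4 set \<Rightarrow> poly4 set" where
  "saturation I = {f. \<exists>k. \<forall>g\<in>ideal_power irrelevant_ideal k. g * f \<in> I}"

abbreviation coordinate_ring :: "poly4 set \<Rightarrow> poly4 set ring" where
  "coordinate_ring I \<equiv> PR Quot I"

definition arithmetically_CM :: "poly4 set \<Rightarrow> bool" where
  "arithmetically_CM I \<longleftrightarrow> cohen_macaulay (coordinate_ring I)"

text \<open>
  The dimension of a projective scheme is one less than that of its homogeneous coordinate ring.
\<close>

definition is_curve :: "poly4 set \<Rightarrow> bool" where
  "is_curve I \<longleftrightarrow> krull_dim (coordinate_ring I) = 2"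

definition hilbert_function :: "poly4 set \<Rightarrow> nat \<Rightarrow> nat" where
  "hilbert_function I t = poly_vs.dim (forms t) - poly_vs.dim (I \<inter> forms t)"

definition hilbert_polynomial :: "poly4 set \<Rightarrow> real poly" where
  "hilbert_polynomial I =
     (THE p. \<forall>\<^sub>F t in sequentially. real (hilbert_function I t) = poly p (real t))"

definition scheme_degree :: "poly4 set \<Rightarrow> real" where
  "scheme_degree I = (let p = hilbert_polynomial I
     in fact (Polynomial.degree p) * Polynomial.coeff p (Polynomial.degree p))"

section \<open>Weddle loci and Weddle schemes\<close>

definition vanishing_ideal :: "proj3 set \<Rightarrow> poly4 set" where
  "vanishing_ideal Z = Idl\<^bsub>PR\<^esub> {f. homogeneous f \<and> (\<forall>P\<in>Z. peval (rep_proj3 P) f = 0)}"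

definition cone_dim :: "nat \<Rightarrow> proj3 set \<Rightarrow> proj3 \<Rightarrow> nat" where
  "cone_dim d Z P =
     poly_vs.dim (vanishing_ideal Z \<inter> ideal_power (vanishing_ideal {P}) d \<inter> forms d)"

definition weddle_locus :: "nat \<Rightarrow> proj3 set \<Rightarrow> proj3 set" where
  "weddle_locus d Z = zariski_closure {P. P \<notin> Z \<and> cone_dim d Z P > (INF Q\<in>-Z. cone_dim d Z Q)}"

definition monomials :: "nat \<Rightarrow> mon4 list" where
  "monomials k = sorted_list_of_set {m. mdeg m = k}"

definition interpolation_matrix :: "nat \<Rightarrow> proj3 list \<Rightarrow> poly4 mat" where
  "interpolation_matrix d Ps =
     (let M = monomials d; m = monomials (d - 1); r = length Ps
      in mat (r + length m) (length M)
        (\<lambda>(i, j). if i < r then const (monomial_val (rep_proj3 (Ps ! i)) (M ! j))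
                  else iterated_deriv (m ! (i - r)) (Poly_Mapping.single (M ! j) 1)))"

definition rank_at :: "poly4 mat \<Rightarrow> proj3 \<Rightarrow> nat" where
  "rank_at A Q = vec_space.rank (dim_row A) (map_mat (peval (rep_proj3 Q)) A)"

definition generic_rank :: "poly4 mat \<Rightarrow> nat" where
  "generic_rank A = (THE \<rho>. \<exists>U. zariski_open U \<and> U \<noteq> {} \<and> (\<forall>Q\<in>U. rank_at A Q = \<rho>))"

definition minors :: "nat \<Rightarrow> poly4 mat \<Rightarrow> poly4 set" where
  "minors k A = {det (submatrix A I J) | I J.
     I \<subseteq> {..<dim_row A} \<and> J \<subseteq> {..<dim_col A} \<and> card I = k \<and> card J = k}"

definition weddle_scheme :: "nat \<Rightarrow> proj3 list \<Rightarrow> poly4 set" where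
  "weddle_scheme d Ps = (let \<Lambda> = interpolation_matrix d Ps
     in saturation (Idl\<^bsub>PR\<^esub> (minors (generic_rank \<Lambda>) \<Lambda>)))"

end

theory Submission
  imports Defs "HOL-Library.Function_Algebras" "HOL-Analysis.Continuum_Not_Denumerable"
    "Jordan_Normal_Form.DL_Rank_Submatrix"
begin

text \<open>
  Write \<open>N = (d+3 choose 3)\<close>, \<open>n = (d+2 choose 3)\<close> and \<open>r = (d+2 choose 2) + 1\<close>, so that
  \<open>r + n = N + 1\<close>. Once the points are fixed, the interpolation matrix \<open>\<Lambda>\<close> has \<open>N + 1\<close> rows and
  \<open>N\<close> columns: \<open>r\<close> constant rows, one for each point, and \<open>n\<close> rows of linear forms. Let \<open>J\<close> be
  the ideal of its maximal minors. The minors that omit a linear row have degree \<open>n - 1\<close>, the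
  other ones degree \<open>n\<close>.

  A set of points counts as general if (a) the \<open>n\<close> minors that omit a linear row are linearly
  independent on the line \<open>L: x\<^sub>0 = x\<^sub>1 = 0\<close>, (b) the minor that omits the row of a point does
  not vanish at this point, and (c) the points are distinct. These are open conditions, given by
  one multihomogeneous polynomial \<open>cert\<close>.

  The ideal. By (a) the minors span all binary forms of degree \<open>n - 1\<close> on \<open>L\<close>. Replacing binary
  monomials of this degree, one writes every polynomial modulo \<open>J\<close> as a combination of monomials
  \<open>x\<^sub>2\<^sup>a x\<^sub>3\<^sup>b\<close> with \<open>a + b < n - 1\<close> over \<open>C[x\<^sub>0, x\<^sub>1]\<close> (\<open>reduction\<close>). The columns of \<open>\<Lambda>\<close> are
  syzygies of the signed minors and bound the dimension of \<open>J\<close> in each degree from above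
  (\<open>dim_J_le\<close>). The two bounds add up to the dimension of the space of all forms, so the reduced
  representation is unique (\<open>J_reduced_0\<close>), and the quotient by \<open>J\<close> is free over \<open>C[x\<^sub>0, x\<^sub>1]\<close>
  of rank \<open>n choose 2\<close>. This gives the Hilbert polynomial and the degree, it shows that \<open>J\<close> is
  saturated, and it makes \<open>x\<^sub>0 - a\<close>, \<open>x\<^sub>1 - b\<close> a regular sequence modulo \<open>J\<close> for all \<open>a\<close> and \<open>b\<close>
  (\<open>regular_0\<close>, \<open>regular_1\<close>).

  Cohen-Macaulayness. By a weak Nullstellensatz every maximal ideal of the quotient contains the
  classes of some \<open>x\<^sub>0 - a\<close> and \<open>x\<^sub>1 - b\<close>, so its depth is at least 2. Depth is bounded by
  height (\<open>depth_le_height\<close>), and height by 2, because the quotient grows only quadratically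
  (\<open>prime_chain_le_2\<close>). All three numbers are therefore equal.

  The locus. The kernel of \<open>\<Lambda>\<close> at \<open>q\<close> consists of the cones of degree \<open>d\<close> with vertex \<open>q\<close>
  through the points (\<open>kernel_iff_cone\<close>), and the cones with vertex \<open>q\<close> are the forms of degree
  \<open>d\<close> in the \<open>d\<close>-th power of the ideal of \<open>q\<close> (\<open>ideal_power_forms\<close>). So the zero locus of \<open>J\<close> is
  the set of vertices of such cones; by (b) it contains no point of the given set, and it equals
  the Weddle locus (\<open>zero_locus_weddle\<close>).

  Existence. The open set has to be nonempty. For (b) it suffices to find \<open>r - 1\<close> points on no
  common cone with a given vertex. For (a), choose \<open>r\<close> points on no common cone with vertex on
  \<open>L\<close> (\<open>points_without_cones_on_line\<close>). Then \<open>\<Lambda>\<close> restricted to \<open>L\<close> is a pencil of matrices that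
  is injective at every point of \<open>L\<close>, infinity included, and this forces the minors to be
  independent there (\<open>line_minors_independent\<close>).
\<close>

abbreviation lk :: "('a \<Rightarrow>\<^sub>0 'b::zero) \<Rightarrow> 'a \<Rightarrow> 'b" where "lk \<equiv> Poly_Mapping.lookup"
abbreviation ks :: "('a \<Rightarrow>\<^sub>0 'b::zero) \<Rightarrow> 'a set" where "ks \<equiv> Poly_Mapping.keys"
abbreviation sg :: "'a \<Rightarrow> 'b \<Rightarrow> ('a \<Rightarrow>\<^sub>0 'b::zero)" where "sg \<equiv> Poly_Mapping.single"

section \<open>Evaluation of polynomials\<close>

lemma lk_const_mult [simp]: "lk (const c * f) m = c * lk f m"
proof -
  have "const c * f = Poly_Mapping.map ((*) c) f"
    unfolding const_def by (simp add: mult_map_scale_conv_mult)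
  then show ?thesis by (simp add: Poly_Mapping.map.rep_eq when_def)
qed

lemma const_0 [simp]: "const 0 = 0" and const_1 [simp]: "const 1 = 1"
  by (simp_all add: const_def)

lemma const_add: "const (a + b) = const a + const b"
  and const_mult: "const (a * b) = const a * const b"
  by (simp_all add: const_def single_add mult_single)

lemma sum_singles: "f = (\<Sum>m\<in>ks f. sg m (lk f m))"
proof (rule poly_mapping_eqI)
  fix k
  show "lk f k = lk (\<Sum>m\<in>ks f. sg m (lk f m)) k"
    by (simp add: lookup_sum lookup_single when_def in_keys_iff)
qed

lemma monomial_val_superset:
  assumes "finite A" "ks m \<subseteq> A"
  shows "monomial_val v m = (\<Prod>i\<in>A. v i ^ lk m i)"
  unfolding monomial_val_def using assms
  by (intro prod.mono_neutral_left) (auto simp: in_keys_iff)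

lemma monomial_val_0 [simp]: "monomial_val v 0 = 1"
  by (simp add: monomial_val_def)

lemma monomial_val_add: "monomial_val v (m + m') = monomial_val v m * monomial_val v m'"
proof -
  let ?A = "ks m \<union> ks m'"
  have "monomial_val v (m + m') = (\<Prod>i\<in>?A. v i ^ lk (m + m') i)"
    using Poly_Mapping.keys_add[of m m'] by (intro monomial_val_superset) auto
  also have "\<dots> = monomial_val v m * monomial_val v m'"
    by (simp add: monomial_val_superset[of ?A m] monomial_val_superset[of ?A m'] lookup_add
        power_add prod.distrib)
  finally show ?thesis .
qed

lemma monomial_val_single [simp]: "monomial_val v (sg i k) = v i ^ k"
  by (simp add: monomial_val_def)

lemma peval_superset:
  assumes "finite A" "ks f \<subseteq> A"
  shows "peval v f = (\<Sum>m\<in>A. lk f m * monomial_val v m)"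
  unfolding peval_def using assms
  by (intro sum.mono_neutral_left) (auto simp: in_keys_iff)

lemma peval_0 [simp]: "peval v 0 = 0"
  by (simp add: peval_def)

lemma peval_add: "peval v (f + g) = peval v f + peval v g"
proof -
  let ?A = "ks f \<union> ks g"
  have "peval v (f + g) = (\<Sum>m\<in>?A. lk (f + g) m * monomial_val v m)"
    using Poly_Mapping.keys_add[of f g] by (intro peval_superset) auto
  also have "\<dots> = peval v f + peval v g"
    by (simp add: peval_superset[of ?A f] peval_superset[of ?A g] lookup_add
        distrib_right sum.distrib)
  finally show ?thesis .
qed

lemma peval_single [simp]: "peval v (sg m c) = c * monomial_val v m"
  by (cases "c = 0") (simp_all add: peval_def)

lemma peval_const [simp]: "peval v (const c) = c"
  by (simp add: const_def)

lemma peval_1 [simp]: "peval v 1 = 1"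
  using peval_const[of v 1] by simp

lemma peval_sum: "peval v (sum f A) = (\<Sum>x\<in>A. peval v (f x))"
  by (induction A rule: infinite_finite_induct) (simp_all add: peval_add)

lemma peval_mult: "peval v (f * g) = peval v f * peval v g"
proof -
  have "f * g = (\<Sum>m\<in>ks f. \<Sum>m'\<in>ks g. sg (m + m') (lk f m * lk g m'))"
    by (subst sum_singles[of f], subst sum_singles[of g]) (simp add: sum_product mult_single)
  then show ?thesis
    by (simp add: peval_sum monomial_val_add peval_def[of v f] peval_def[of v g] sum_product ac_simps)
qed

interpretation peval: comm_ring_hom "peval v"
  by unfold_locales (simp_all add: peval_add peval_mult)

lemma peval_diff: "peval v (f - g) = peval v f - peval v g"
  by (rule peval.hom_minus)

lemma peval_det: "det (map_mat (peval v) A) = peval v (det A)"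
  by (rule peval.hom_det)

section \<open>Homogeneity\<close>

definition additive :: "('x monomial \<Rightarrow> nat) \<Rightarrow> bool" where
  "additive w \<longleftrightarrow> w 0 = 0 \<and> (\<forall>m m'. w (m + m') = w m + w m')"

text \<open>
  The weight is arbitrary because two gradings occur: the degree of polynomials in four
  variables, and the degrees in the coordinates of each single point of a configuration.
\<close>

definition homog :: "('x monomial \<Rightarrow> nat) \<Rightarrow> nat \<Rightarrow> 'x mpoly \<Rightarrow> bool" where
  "homog w t f \<longleftrightarrow> (\<forall>m\<in>ks f. w m = t)"

lemma homog_0 [simp]: "homog w t 0"
  by (simp add: homog_def)

lemma homog_add: "homog w t f \<Longrightarrow> homog w t g \<Longrightarrow> homog w t (f + g)"
  using Poly_Mapping.keys_add[of f g] by (auto simp: homog_def)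

lemma homog_uminus: "homog w t (f :: 'x mpoly) \<Longrightarrow> homog w t (- f)"
  by (auto simp: homog_def in_keys_iff)

lemma homog_diff: "homog w t f \<Longrightarrow> homog w t g \<Longrightarrow> homog w t (f - g)"
  using homog_add[of w t f "- g"] homog_uminus[of w t g] by simp

lemma homog_sum: "(\<And>x. x \<in> A \<Longrightarrow> homog w t (f x)) \<Longrightarrow> homog w t (sum f A)"
  by (induction A rule: infinite_finite_induct) (auto intro: homog_add)

lemma homog_single: "w m = t \<Longrightarrow> homog w t (sg m c)"
  by (auto simp: homog_def)

lemma homog_const: "additive w \<Longrightarrow> homog w 0 (const c)"
  by (simp add: const_def additive_def homog_single)

lemma homog_mult:
  assumes "additive w" "homog w s f" "homog w t g"
  shows "homog w (s + t) (f * g)"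
  using Poly_Mapping.keys_mult[of f g] assms by (fastforce simp: homog_def additive_def)

lemma homog_1: "additive w \<Longrightarrow> homog w 0 1"
  using homog_const[of w 1] by simp

lemma homog_prod:
  assumes "additive w" "\<And>x. x \<in> A \<Longrightarrow> homog w (e x) (f x)"
  shows "homog w (sum e A) (prod f A)"
  using assms(2)
  by (induction A rule: infinite_finite_induct) (auto intro: homog_mult homog_1 assms(1))

lemma permutes_less_nat: "p permutes {0..<n} \<Longrightarrow> i < n \<Longrightarrow> p i < (n::nat)"
  by (metis atLeastLessThan_iff permutes_in_image zero_le)

text \<open>
  The degree of an entry depends only on its row, as for the interpolation matrix; so every term
  of the Leibniz formula has the same degree.
\<close>

lemma homog_det:
  assumes w: "additive w" and A: "A \<in> carrier_mat n n"
    and h: "\<And>i j. i < n \<Longrightarrow> j < n \<Longrightarrow> homog w (e i) (A $$ (i, j))"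
  shows "homog w (\<Sum>i<n. e i) (det A)"
  unfolding det_def'[OF A]
proof (rule homog_sum)
  fix p assume "p \<in> {p. p permutes {0..<n}}"
  then have p: "p permutes {0..<n}" by simp
  have "homog w (\<Sum>i\<in>{0..<n}. e i) (\<Prod>i = 0..<n. A $$ (i, p i))"
    using p by (intro homog_prod[OF w] h) (auto simp: permutes_less_nat)
  then have P: "homog w (\<Sum>i<n. e i) (\<Prod>i = 0..<n. A $$ (i, p i))"
    by (simp add: atLeast0LessThan)
  have "signof p = (1::'a mpoly) \<or> signof p = (-1::'a mpoly)"
    by (simp add: sign_def)
  then show "homog w (\<Sum>i<n. e i) (signof p * (\<Prod>i = 0..<n. A $$ (i, p i)))"
    using P homog_uminus[OF P] by auto
qed

lemma mdeg_superset:
  assumes "finite A" "ks m \<subseteq> A"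
  shows "mdeg m = (\<Sum>i\<in>A. lk m i)"
  unfolding mdeg_def using assms
  by (intro sum.mono_neutral_left) (auto simp: in_keys_iff)

lemma additive_mdeg: "additive (mdeg :: 'x monomial \<Rightarrow> nat)"
  unfolding additive_def
proof (intro conjI allI)
  fix m m' :: "'x monomial"
  let ?A = "ks m \<union> ks m'"
  have "mdeg (m + m') = (\<Sum>i\<in>?A. lk (m + m') i)"
    using Poly_Mapping.keys_add[of m m'] by (intro mdeg_superset) auto
  also have "\<dots> = mdeg m + mdeg m'"
    by (simp add: mdeg_superset[of ?A m] mdeg_superset[of ?A m'] lookup_add sum.distrib)
  finally show "mdeg (m + m') = mdeg m + mdeg m'" .
qed (simp add: mdeg_def)

lemma mdeg_add: "mdeg (m + m') = mdeg m + mdeg m'"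
  and mdeg_0 [simp]: "mdeg 0 = 0"
  using additive_mdeg unfolding additive_def by auto

lemma mdeg_single [simp]: "mdeg (sg i k) = k"
  by (simp add: mdeg_def)

lemma forms_homog: "f \<in> forms t \<longleftrightarrow> homog mdeg t f"
  by (simp add: forms_def homog_def)

lemma monomial_val_scale: "monomial_val (\<lambda>i. c * v i) m = c ^ mdeg m * monomial_val v m"
  by (simp add: monomial_val_def mdeg_def power_mult_distrib prod.distrib power_sum)

lemma peval_forms_scale:
  assumes "f \<in> forms t"
  shows "peval (\<lambda>i. c * v i) f = c ^ t * peval v f"
  using assms unfolding forms_def peval_def
  by (simp add: monomial_val_scale sum_distrib_left ac_simps)

section \<open>Functions that are polynomial along lines\<close>

text \<open>
  Irreducibility of affine space enters in the form that finitely many nonzero polynomials have a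
  common nonzero.  On the line that joins a nonzero of one function to a nonzero of another, this
  says that a product of nonzero univariate polynomials has a nonroot.  The functions include
  determinants whose entries are given only as functions of a point.
\<close>

definition line_poly :: "(('x \<Rightarrow> complex) \<Rightarrow> complex) \<Rightarrow> bool" where
  "line_poly f \<longleftrightarrow> (\<forall>a b. \<exists>P. \<forall>s. f (\<lambda>i. a i + s * b i) = poly P s)"

lemma line_poly_const: "line_poly (\<lambda>v. c)"
  unfolding line_poly_def by (intro allI exI[of _ "[:c:]"]) simp

lemma line_poly_coord: "line_poly (\<lambda>v. v i)"
  unfolding line_poly_def
proof (intro allI)
  fix a b show "\<exists>P. \<forall>s. a i + s * b i = poly P s"
    by (intro exI[of _ "[:a i, b i:]"]) simp
qed

lemma line_poly_add: "line_poly f \<Longrightarrow> line_poly g \<Longrightarrow> line_poly (\<lambda>v. f v + g v)"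
  unfolding line_poly_def by (metis poly_add)

lemma line_poly_mult: "line_poly f \<Longrightarrow> line_poly g \<Longrightarrow> line_poly (\<lambda>v. f v * g v)"
  unfolding line_poly_def by (metis poly_mult)

lemma line_poly_diff: "line_poly f \<Longrightarrow> line_poly g \<Longrightarrow> line_poly (\<lambda>v. f v - g v)"
  unfolding line_poly_def by (metis poly_diff)

lemma line_poly_sum: "(\<And>x. x \<in> A \<Longrightarrow> line_poly (f x)) \<Longrightarrow> line_poly (\<lambda>v. \<Sum>x\<in>A. f x v)"
  by (induction A rule: infinite_finite_induct) (auto intro: line_poly_const line_poly_add)

lemma line_poly_prod: "(\<And>x. x \<in> A \<Longrightarrow> line_poly (f x)) \<Longrightarrow> line_poly (\<lambda>v. \<Prod>x\<in>A. f x v)"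
  by (induction A rule: infinite_finite_induct) (auto intro: line_poly_const line_poly_mult)

lemma line_poly_power: "line_poly f \<Longrightarrow> line_poly (\<lambda>v. f v ^ k)"
  by (induction k) (auto intro: line_poly_const line_poly_mult)

lemma line_poly_det:
  assumes "\<And>i j. i < n \<Longrightarrow> j < n \<Longrightarrow> line_poly (\<lambda>v. A v i j)"
  shows "line_poly (\<lambda>v. det (mat n n (\<lambda>(i, j). A v i j)))"
proof -
  have eq: "det (mat n n (\<lambda>(i, j). A v i j)) =
     (\<Sum>p\<in>{p. p permutes {0..<n}}. signof p * (\<Prod>i = 0..<n. A v i (p i)))" for v
    by (subst det_def'[of _ n]) (auto intro!: sum.cong prod.cong simp: permutes_less_nat)
  show ?thesis
    unfolding eq
    by (intro line_poly_sum line_poly_mult line_poly_const line_poly_prod assms)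
       (auto simp: permutes_less_nat)
qed

lemma line_poly_peval: "line_poly (\<lambda>v. peval v f)"
  unfolding peval_def monomial_val_def
  by (intro line_poly_sum line_poly_mult line_poly_const line_poly_prod line_poly_power line_poly_coord)

lemma common_nonzero:
  assumes "finite F" "\<And>f. f \<in> F \<Longrightarrow> line_poly f" "\<And>f. f \<in> F \<Longrightarrow> \<exists>v. f v \<noteq> 0"
  shows "\<exists>v. \<forall>f\<in>F. f v \<noteq> 0"
proof -
  have "\<exists>v. (\<Prod>f\<in>F. f v) \<noteq> 0"
    using assms
  proof (induction F)
    case empty
    then show ?case by simp
  next
    case (insert g F)
    obtain a where a: "(\<Prod>f\<in>F. f a) \<noteq> 0" using insert by auto
    obtain b where b: "g b \<noteq> 0" using insert.prems(2)[of g] by auto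
    define c where "c = (\<lambda>i. b i - a i)"
    have "line_poly (\<lambda>v. \<Prod>f\<in>F. f v)" using insert by (intro line_poly_prod) auto
    then obtain P where P: "\<And>s. (\<Prod>f\<in>F. f (\<lambda>i. a i + s * c i)) = poly P s"
      unfolding line_poly_def by metis
    have "line_poly g" using insert by auto
    then obtain Q where Q: "\<And>s. g (\<lambda>i. a i + s * c i) = poly Q s"
      unfolding line_poly_def by metis
    have "poly P 0 \<noteq> 0" using P[of 0] a by simp
    moreover have "poly Q 1 \<noteq> 0" using Q[of 1] b by (simp add: c_def)
    ultimately have "P * Q \<noteq> 0" by auto
    then have "finite {s. poly (P * Q) s = 0}" by (rule poly_roots_finite)
    then obtain s where "poly (P * Q) s \<noteq> 0"
      using infinite_UNIV_char_0[where 'a = complex] ex_new_if_finite by blast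
    then have "g (\<lambda>i. a i + s * c i) * (\<Prod>f\<in>F. f (\<lambda>i. a i + s * c i)) \<noteq> 0"
      by (simp add: P Q)
    then show ?case using insert by auto
  qed
  then show ?thesis using assms(1) by auto
qed

section \<open>Polynomials in four variables\<close>

lemma UNIV_4: "(UNIV :: 4 set) = {0, 1, 2, 3}"
proof (rule sym, rule card_subset_eq)
  show "card {0, 1, 2, 3 :: 4} = card (UNIV :: 4 set)" by simp
qed auto

lemma forall_4: "(\<forall>i::4. P i) \<longleftrightarrow> P 0 \<and> P 1 \<and> P 2 \<and> P 3"
  using UNIV_4 by (metis UNIV_I insertE singletonD)

lemma sum_4: "(\<Sum>i\<in>UNIV. f (i::4)) = f 0 + f 1 + f 2 + (f 3 :: 'a::comm_monoid_add)"
  unfolding UNIV_4 by (simp add: add.assoc)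

lemma prod_4: "(\<Prod>i\<in>UNIV. f (i::4)) = f 0 * f 1 * f 2 * (f 3 :: 'a::comm_monoid_mult)"
  unfolding UNIV_4 by (simp add: mult.assoc)

lemma mdeg_4: "mdeg m = lk m 0 + lk m 1 + lk m 2 + lk m (3::4)"
  by (subst mdeg_superset[of UNIV]) (simp_all add: sum_4)

lemma monomial_val_4:
  "monomial_val v m = v 0 ^ lk m 0 * v 1 ^ lk m 1 * v 2 ^ lk m 2 * v 3 ^ lk m (3::4)"
  by (subst monomial_val_superset[of UNIV]) (simp_all add: prod_4)

definition mon :: "nat \<Rightarrow> nat \<Rightarrow> nat \<Rightarrow> nat \<Rightarrow> mon4" where
  "mon a b c e = sg 0 a + sg 1 b + sg 2 c + sg 3 e"

lemma lk_mon [simp]: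
  "lk (mon a b c e) 0 = a" "lk (mon a b c e) 1 = b" "lk (mon a b c e) 2 = c" "lk (mon a b c e) 3 = e"
  by (simp_all add: mon_def lookup_add lookup_single)

lemma mon_eqI:
  assumes "lk m 0 = lk m' 0" "lk m 1 = lk m' 1" "lk m 2 = lk m' 2" "lk m 3 = lk m' (3::4)"
  shows "m = m'"
  by (rule poly_mapping_eqI) (use assms forall_4[of "\<lambda>i. lk m i = lk m' i"] in auto)

lemma mon_lk: "mon (lk m 0) (lk m 1) (lk m 2) (lk m 3) = m"
  by (rule mon_eqI) simp_all

lemma mdeg_mon [simp]: "mdeg (mon a b c e) = a + b + c + e"
  by (simp add: mdeg_4)

lemma bij_mon_list: "bij_betw (\<lambda>m. [lk m 0, lk m 1, lk m 2, lk m (3::4)])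
   {m. mdeg m = t} {l. length l = 4 \<and> sum_list l = t}"
  by (rule bij_betw_byWitness[where f' = "\<lambda>l. mon (l ! 0) (l ! 1) (l ! 2) (l ! 3)"])
     (auto simp: mon_lk mdeg_4 numeral_eq_Suc length_Suc_conv)

lemma card_mdeg: "card {m :: mon4. mdeg m = t} = (t + 3) choose 3"
proof -
  have "card {m :: mon4. mdeg m = t} = (t + 4 - 1) choose t"
    using bij_betw_same_card[OF bij_mon_list, of t] card_length_sum_list[of 4 t] by simp
  then show ?thesis using binomial_symmetric[of t "t + 3"] by (simp add: add.commute)
qed

lemma finite_mdeg: "finite {m :: mon4. mdeg m = t}"
  by (rule card_ge_0_finite) (simp add: card_mdeg)

lemma digits_unique:
  fixes a b a' b' D :: nat
  assumes "a + D * b = a' + D * b'" "a < D" "a' < D"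
  shows "a = a' \<and> b = b'"
proof -
  have "(a + D * b) mod D = a" "(a' + D * b') mod D = a'" using assms(2,3) by auto
  then have "a = a'" using assms(1) by metis
  then show ?thesis using assms by auto
qed

text \<open>
  Kronecker substitution: putting the variables equal to powers of one variable with rapidly
  growing exponents keeps the monomials of a given polynomial apart.
\<close>

lemma peval_eq_0_imp:
  fixes f :: poly4
  assumes z: "\<And>v. peval v f = 0"
  shows "f = 0"
proof (rule ccontr)
  assume "f \<noteq> 0"
  then obtain m0 where m0: "m0 \<in> ks f" by (metis ex_in_conv keys_eq_empty)
  define D where "D = Suc (Max (mdeg ` ks f))"
  define w where "w m = lk m 0 + D * (lk m 1 + D * (lk m 2 + D * lk m (3::4)))" for m
  have small: "mdeg m < D" if "m \<in> ks f" for m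
    using that by (auto simp: D_def less_Suc_eq_le)
  have inj: "m = m'" if "m \<in> ks f" "m' \<in> ks f" "w m = w m'" for m m'
  proof -
    have l: "lk m i < D" "lk m' i < D" for i :: 4
      using small[OF that(1)] small[OF that(2)] unfolding mdeg_4
      using forall_4[of "\<lambda>i. lk m i < D"] forall_4[of "\<lambda>i. lk m' i < D"] by auto
    show ?thesis using that(3) unfolding w_def
      by (metis (no_types, lifting) digits_unique l mon_eqI)
  qed
  define P where "P = (\<Sum>m\<in>ks f. Polynomial.monom (lk f m) (w m))"
  have "poly P s = peval (\<lambda>i. if i = 0 then s else if i = 1 then s ^ D else if i = 2 then s ^ (D * D)
      else s ^ (D * D * D)) f" for s
    unfolding P_def peval_def
    by (simp add: poly_sum poly_monom monomial_val_4 w_def algebra_simps power_add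
        flip: power_mult)
  then have "poly P s = 0" for s using z by simp
  then have "P = 0" using poly_all_0_iff_0 by blast
  moreover have "coeff P (w m0) = lk f m0"
  proof -
    have "coeff P (w m0) = (\<Sum>m\<in>ks f. if m = m0 then lk f m else 0)"
      unfolding P_def coeff_sum coeff_monom using inj m0 by (intro sum.cong) auto
    then show ?thesis using m0 by (simp add: sum.delta)
  qed
  ultimately show False using m0 by (simp add: in_keys_iff)
qed

section \<open>Ideals of a commutative ring type\<close>

text \<open>
  A form of the ideal axioms without carriers, equivalent to \<open>ideal\<close> in the ring of the type.
\<close>

definition isideal :: "'a::comm_ring_1 set \<Rightarrow> bool" where
  "isideal I \<longleftrightarrow> 0 \<in> I \<and> (\<forall>a\<in>I. \<forall>b\<in>I. a + b \<in> I) \<and> (\<forall>a\<in>I. \<forall>x. x * a \<in> I)"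

lemma PR_simps [simp]:
  "carrier ring_of_type_algebra = UNIV"
  "x \<otimes>\<^bsub>ring_of_type_algebra\<^esub> y = x * y" "x \<oplus>\<^bsub>ring_of_type_algebra\<^esub> y = x + y"
  "\<zero>\<^bsub>ring_of_type_algebra\<^esub> = 0" "\<one>\<^bsub>ring_of_type_algebra\<^esub> = 1"
  by (simp_all add: ring_of_type_algebra_def)

lemma isidealD:
  assumes "isideal I"
  shows "0 \<in> I" "a \<in> I \<Longrightarrow> b \<in> I \<Longrightarrow> a + b \<in> I" "a \<in> I \<Longrightarrow> x * a \<in> I" "a \<in> I \<Longrightarrow> a * x \<in> I"
    "a \<in> I \<Longrightarrow> - a \<in> I" "a \<in> I \<Longrightarrow> b \<in> I \<Longrightarrow> a - b \<in> I"
proof -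
  show z: "0 \<in> I" and a: "\<And>a b. a \<in> I \<Longrightarrow> b \<in> I \<Longrightarrow> a + b \<in> I" and m: "\<And>a x. a \<in> I \<Longrightarrow> x * a \<in> I"
    using assms by (auto simp: isideal_def)
  show "a \<in> I \<Longrightarrow> a * x \<in> I" using m[of a x] by (simp add: mult.commute)
  show n: "\<And>a. a \<in> I \<Longrightarrow> - a \<in> I" using m[of _ "-1"] by simp
  show "a \<in> I \<Longrightarrow> b \<in> I \<Longrightarrow> a - b \<in> I" using a[of a "- b"] n[of b] by simp
qed

lemma isideal_sum: "isideal I \<Longrightarrow> (\<And>x. x \<in> A \<Longrightarrow> f x \<in> I) \<Longrightarrow> sum f A \<in> I"
  by (induction A rule: infinite_finite_induct) (auto simp: isidealD)

lemma PR_a_inv: "\<ominus>\<^bsub>ring_of_type_algebra\<^esub> (x::'a::comm_ring_1) = - x"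
proof -
  interpret R: ring "ring_of_type_algebra :: 'a ring" by (rule ring_from_type_algebra)
  show ?thesis by (rule R.minus_equality) simp_all
qed

lemma ideal_isideal: "ideal I (ring_of_type_algebra :: 'a::comm_ring_1 ring) \<longleftrightarrow> isideal I"
proof
  assume "ideal I (ring_of_type_algebra :: 'a ring)"
  then interpret ideal I "ring_of_type_algebra :: 'a ring" .
  show "isideal I"
    unfolding isideal_def using additive_subgroup.zero_closed[OF additive_subgroup_axioms]
      additive_subgroup.a_closed[OF additive_subgroup_axioms] I_l_closed by auto
next
  assume I: "isideal I"
  show "ideal I (ring_of_type_algebra :: 'a ring)"
  proof (rule idealI)
    show "ring (ring_of_type_algebra :: 'a ring)" by (rule ring_from_type_algebra)
    then interpret R: ring "ring_of_type_algebra :: 'a ring" .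
    show "subgroup I (add_monoid (ring_of_type_algebra :: 'a ring))"
    proof (rule R.add.subgroupI)
      fix a assume "a \<in> I"
      then show "\<ominus>\<^bsub>ring_of_type_algebra\<^esub> a \<in> I"
        using isidealD[OF I] PR_a_inv[of a] by simp
    qed (use isidealD[OF I] in auto)
  qed (use isidealD[OF I] in auto)
qed

lemma Idl_eq:
  fixes g :: "'i \<Rightarrow> 'a::comm_ring_1"
  assumes "finite S"
  shows "genideal ring_of_type_algebra (g ` S) = {y. \<exists>h. y = (\<Sum>i\<in>S. h i * g i)}" (is "?L = ?R")
proof
  interpret R: ring "ring_of_type_algebra :: 'a ring" by (rule ring_from_type_algebra)
  have "isideal ?R"
    unfolding isideal_def
  proof (intro conjI ballI allI)
    have "0 = (\<Sum>i\<in>S. 0 * g i)" by simp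
    then show "0 \<in> ?R" by (intro CollectI exI[of _ "\<lambda>_. 0"])
  next
    fix a b assume "a \<in> ?R" "b \<in> ?R"
    then obtain h k where hk: "a = (\<Sum>i\<in>S. h i * g i)" "b = (\<Sum>i\<in>S. k i * g i)" by auto
    have "a + b = (\<Sum>i\<in>S. (h i + k i) * g i)" unfolding hk by (simp add: sum.distrib distrib_right)
    then show "a + b \<in> ?R" by (intro CollectI exI[of _ "\<lambda>i. h i + k i"]) simp
  next
    fix a x assume "a \<in> ?R"
    then obtain h where h: "a = (\<Sum>i\<in>S. h i * g i)" by auto
    have "x * a = (\<Sum>i\<in>S. (x * h i) * g i)" unfolding h by (simp add: sum_distrib_left mult.assoc)
    then show "x * a \<in> ?R" by (intro CollectI exI[of _ "\<lambda>i. x * h i"]) simp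
  qed
  moreover have "g ` S \<subseteq> ?R"
  proof
    fix y assume "y \<in> g ` S"
    then obtain i where i: "i \<in> S" "y = g i" by auto
    have "y = (\<Sum>j\<in>S. (if j = i then 1 else 0) * g j)"
    proof -
      have "(\<Sum>j\<in>S. (if j = i then 1 else 0) * g j) = (\<Sum>j\<in>S. if j = i then g j else 0)"
        by (intro sum.cong) auto
      then show ?thesis using i assms by (simp add: sum.delta)
    qed
    then show "y \<in> ?R" by (intro CollectI exI[of _ "\<lambda>j. if j = i then 1 else 0"]) simp
  qed
  ultimately show "?L \<subseteq> ?R" by (intro R.genideal_minimal) (simp_all add: ideal_isideal)
  show "?R \<subseteq> ?L"
  proof clarify
    fix h
    have L: "isideal ?L" using R.genideal_ideal[of "g ` S"] by (simp add: ideal_isideal)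
    show "(\<Sum>i\<in>S. h i * g i) \<in> ?L"
      using R.genideal_self[of "g ` S"] by (intro isideal_sum[OF L] isidealD(3)[OF L]) auto
  qed
qed

section \<open>Matrices with one more row than columns\<close>

definition row_del :: "'a mat \<Rightarrow> nat \<Rightarrow> 'a mat" where
  "row_del A i = mat (dim_col A) (dim_col A) (\<lambda>(a, b). A $$ (insert_index i a, b))"

text \<open>
  The added column comes first, so that Laplace expansion along it gives the signs \<open>(-1)\<^sup>i\<close>.
\<close>

definition adjoin_col :: "(nat \<Rightarrow> 'a) \<Rightarrow> 'a mat \<Rightarrow> 'a mat" where
  "adjoin_col v A = mat (Suc (dim_col A)) (Suc (dim_col A))
     (\<lambda>(i, j). if j = 0 then v i else A $$ (i, j - 1))"

lemma insert_index_lt: "a < N \<Longrightarrow> insert_index i a < Suc N"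
  by (auto simp: insert_index_def)

lemma det_adjoin_col:
  fixes A :: "'a::comm_ring_1 mat"
  assumes A: "A \<in> carrier_mat (Suc N) N"
  shows "det (adjoin_col v A) = (\<Sum>i<Suc N. v i * ((-1) ^ i * det (row_del A i)))"
proof -
  have B: "adjoin_col v A \<in> carrier_mat (Suc N) (Suc N)" using A by (auto simp: adjoin_col_def)
  have "mat_delete (adjoin_col v A) i 0 = row_del A i" if "i < Suc N" for i
    by (rule eq_matI) (use A that in \<open>auto simp: mat_delete_def adjoin_col_def row_del_def insert_index_def\<close>)
  then show ?thesis
    using A unfolding laplace_expansion_column[OF B zero_less_Suc] cofactor_def
    by (intro sum.cong) (auto simp: adjoin_col_def)
qed

text \<open>
  Each column is a relation between the signed maximal minors: expand a determinant with a repeated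
  column.
\<close>

lemma signed_minors_syzygy:
  fixes A :: "'a::comm_ring_1 mat"
  assumes A: "A \<in> carrier_mat (Suc N) N" and b: "b < N"
  shows "(\<Sum>i<Suc N. A $$ (i, b) * ((-1) ^ i * det (row_del A i))) = 0"
proof -
  have "det (adjoin_col (\<lambda>i. A $$ (i, b)) A) = 0"
    by (rule det_identical_columns[of _ "Suc N" 0 "Suc b"])
       (use A b in \<open>auto simp: adjoin_col_def intro!: eq_vecI\<close>)
  then show ?thesis using det_adjoin_col[OF A] by simp
qed

lemma inj_row_del:
  fixes A :: "'a::idom mat"
  assumes A: "A \<in> carrier_mat (Suc N) N" and i: "i < Suc N" "det (row_del A i) \<noteq> 0"
    and y: "\<And>k. k < Suc N \<Longrightarrow> (\<Sum>b<N. A $$ (k, b) * y b) = 0" and b: "b < N"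
  shows "y b = 0"
proof -
  have R: "row_del A i \<in> carrier_mat N N" using A by (simp add: row_del_def)
  have "row_del A i *\<^sub>v vec N y = 0\<^sub>v N"
    by (rule eq_vecI)
       (use A y in \<open>auto simp: row_del_def scalar_prod_def insert_index_lt atLeast0LessThan\<close>)
  then have "vec N y = 0\<^sub>v N"
    using det_0_iff_vec_prod_zero[OF R] i(2) vec_carrier by blast
  then have "vec N y $ b = 0\<^sub>v N $ b" by simp
  then show ?thesis using b by simp
qed

lemma bij_insert_index: "i < Suc N \<Longrightarrow> bij_betw (insert_index i) {..<N} ({..<Suc N} - {i})"
  unfolding bij_betw_def
proof
  assume i: "i < Suc N"
  show "inj_on (insert_index i) {..<N}"
    by (auto simp: inj_on_def insert_index_def split: if_splits)
  show "insert_index i ` {..<N} = {..<Suc N} - {i}"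
  proof
    show "{..<Suc N} - {i} \<subseteq> insert_index i ` {..<N}"
    proof
      fix x assume x: "x \<in> {..<Suc N} - {i}"
      show "x \<in> insert_index i ` {..<N}"
      proof (cases "x < i")
        case True
        then show ?thesis using i x by (intro image_eqI[of _ _ x]) (auto simp: insert_index_def)
      next
        case False
        then show ?thesis using i x by (intro image_eqI[of _ _ "x - 1"]) (auto simp: insert_index_def)
      qed
    qed
  qed (use i in \<open>auto simp: insert_index_def\<close>)
qed

section \<open>Dimension counts\<close>

text \<open>
  An inequality in place of the rank-nullity theorem, which applies when only a part \<open>K\<close> of the
  kernel is known: extend \<open>K\<close> to a basis of \<open>D\<close>; the images of the new basis vectors span the
  image.
\<close>

lemma (in vector_space_pair) dim_image_plus_kernel_le:
  assumes f: "Vector_Spaces.linear s1 s2 f" and D: "D \<subseteq> vs1.span W" "finite W"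
    and K: "vs1.independent K" "K \<subseteq> D" "\<And>k. k \<in> K \<Longrightarrow> f k = 0"
  shows "vs2.dim (f ` D) + card K \<le> vs1.dim D"
proof -
  obtain B where B: "K \<subseteq> B" "B \<subseteq> D" "vs1.independent B" "D \<subseteq> vs1.span B"
    using vs1.maximal_independent_subset_extend[OF K(2,1)] by blast
  have fin: "finite B"
    using vs1.independent_span_bound[OF D(2) B(3)] B(2) D(1) by blast
  have cB: "card B = vs1.dim D" using B by (intro vs1.basis_card_eq_dim) auto
  have "f ` D \<subseteq> vs2.span (f ` (B - K))"
  proof -
    have "f ` D \<subseteq> f ` vs1.span B" using B(4) by blast
    also have "\<dots> = vs2.span (f ` B)" by (rule linear_span_image[OF f, symmetric])
    also have "\<dots> \<subseteq> vs2.span (f ` (B - K))"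
    proof (rule vs2.span_minimal)
      show "f ` B \<subseteq> vs2.span (f ` (B - K))"
      proof clarify
        fix b assume b: "b \<in> B"
        show "f b \<in> vs2.span (f ` (B - K))"
        proof (cases "b \<in> K")
          case True
          then show ?thesis using K(3) by (simp add: vs2.span_zero)
        next
          case False
          then show ?thesis using b by (intro vs2.span_base) blast
        qed
      qed
    qed (rule vs2.subspace_span)
    finally show ?thesis .
  qed
  then have "vs2.dim (f ` D) \<le> card (f ` (B - K))" using fin by (intro vs2.dim_le_card) auto
  also have "\<dots> \<le> card (B - K)" using fin by (intro card_image_le) auto
  also have "\<dots> = card B - card K" using B(1) fin by (intro card_Diff_subset) (auto dest: finite_subset)
  finally show ?thesis using cB card_mono[OF fin B(1)] by linarith
qed

text \<open>Stated for an indexed family, because distinct indices may carry the same vector.\<close>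

lemma (in vector_space) dependent_family:
  assumes "finite S" "finite W" "\<And>i. i \<in> S \<Longrightarrow> r i \<in> span W" "card W < card S"
  shows "\<exists>c. (\<Sum>i\<in>S. scale (c i) (r i)) = 0 \<and> (\<exists>i\<in>S. c i \<noteq> 0)"
proof (cases "inj_on r S")
  case True
  have "dependent (r ` S)"
  proof (rule ccontr)
    assume "independent (r ` S)"
    then have "card (r ` S) \<le> card W"
      using independent_span_bound[OF assms(2)] assms(3) by blast
    then show False using True assms(4) by (simp add: card_image)
  qed
  then obtain u v where u: "v \<in> r ` S" "u v \<noteq> 0" "(\<Sum>v\<in>r ` S. scale (u v) v) = 0"
    using dependent_finite[of "r ` S"] assms(1) by auto
  then have "(\<Sum>i\<in>S. scale (u (r i)) (r i)) = 0"
    using True by (simp add: sum.reindex)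
  then show ?thesis using u by (intro exI[of _ "\<lambda>i. u (r i)"]) auto
next
  case False
  then obtain i j where ij: "i \<in> S" "j \<in> S" "i \<noteq> j" "r i = r j" by (auto simp: inj_on_def)
  let ?c = "\<lambda>k. if k = i then 1 else if k = j then - 1 else 0"
  have "(\<Sum>k\<in>S. scale (?c k) (r k)) = (\<Sum>k\<in>{i, j}. scale (?c k) (r k))"
    using ij assms(1) by (intro sum.mono_neutral_right) auto
  also have "\<dots> = 0" using ij by simp
  finally show ?thesis using ij by (intro exI[of _ ?c]) auto
qed

lemma sum_apply: "(sum f A) i = (\<Sum>x\<in>A. f x i)"
  by (induction A rule: infinite_finite_induct) (simp_all only: sum.infinite sum.empty sum.insert
    plus_fun_apply zero_fun_apply not_False_eq_True)

interpretation fun_vs: vector_space "\<lambda>(c::complex) (h::nat \<Rightarrow> poly4). (\<lambda>i. const c * h i)"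
proof
  fix a b :: complex and x y :: "nat \<Rightarrow> poly4"
  show "(\<lambda>i. const a * (x + y) i) = (\<lambda>i. const a * x i) + (\<lambda>i. const a * y i)"
    by (rule ext) (simp only: plus_fun_apply distrib_left)
  show "(\<lambda>i. const (a + b) * x i) = (\<lambda>i. const a * x i) + (\<lambda>i. const b * x i)"
    by (rule ext) (simp only: plus_fun_apply const_add distrib_right)
  show "(\<lambda>i. const a * (const b * x i)) = (\<lambda>i. const (a * b) * x i)"
    by (rule ext) (simp only: const_mult mult.assoc)
  show "(\<lambda>i. const 1 * x i) = x"
    by (rule ext) (simp only: const_1 mult_1)
qed

text \<open>
  The coefficient tuples \<open>h\<close> for which \<open>\<Sum>i<K. h i * g i\<close> is a form, when the degrees of the
  \<open>g i\<close> are complementary to \<open>s i\<close>. Entries beyond \<open>K\<close> are zero, so that a tuple is determined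
  by its first \<open>K\<close> components.
\<close>

definition graded_tuples :: "nat \<Rightarrow> (nat \<Rightarrow> nat) \<Rightarrow> (nat \<Rightarrow> poly4) set" where
  "graded_tuples K s = {h. (\<forall>i<K. h i \<in> forms (s i)) \<and> (\<forall>i\<ge>K. h i = 0)}"

definition delta_tuple :: "nat \<times> mon4 \<Rightarrow> nat \<Rightarrow> poly4" where
  "delta_tuple x = (\<lambda>j. if j = fst x then sg (snd x) 1 else 0)"

lemma single_one_neq_0: "0 = sg m (1::complex) \<Longrightarrow> False" "sg m (1::complex) = 0 \<Longrightarrow> False"
  by (metis lookup_single_eq lookup_zero zero_neq_one)+

lemma inj_delta: "inj delta_tuple"
proof (rule injI)
  fix x y assume e: "delta_tuple x = delta_tuple y"
  have "delta_tuple x (fst x) = sg (snd x) 1" by (simp add: delta_tuple_def)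
  then have "delta_tuple y (fst x) = sg (snd x) 1" using e by simp
  then have 1: "fst x = fst y" "sg (snd y) 1 = (sg (snd x) 1 :: poly4)"
    by (auto simp: delta_tuple_def split: if_splits dest: single_one_neq_0)
  then have "lk (sg (snd y) (1::complex)) (snd x) = 1" by simp
  then have "snd y = snd x" by (auto simp: lookup_single when_def split: if_splits)
  then show "x = y" using 1 by (simp add: prod_eq_iff)
qed

lemma graded_tuples_basis:
  fixes K :: nat and s :: "nat \<Rightarrow> nat"
  defines "W \<equiv> delta_tuple ` (SIGMA i:{..<K}. {m. mdeg m = s i})"
  shows "finite W" "card W = (\<Sum>i<K. (s i + 3) choose 3)" "fun_vs.independent W"
    "W \<subseteq> graded_tuples K s" "graded_tuples K s \<subseteq> fun_vs.span W"
proof -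
  let ?S = "SIGMA i:{..<K}. {m :: mon4. mdeg m = s i}"
  have fS: "finite ?S" by (auto intro: finite_mdeg)
  show fW: "finite W" unfolding W_def using fS by simp
  show "card W = (\<Sum>i<K. (s i + 3) choose 3)"
    unfolding W_def
    by (subst card_image) (auto intro: inj_on_subset[OF inj_delta] simp: finite_mdeg card_mdeg)
  show "W \<subseteq> graded_tuples K s"
    by (auto simp: W_def graded_tuples_def delta_tuple_def forms_def split: if_splits)
  show "fun_vs.independent W"
  proof (rule fun_vs.independent_if_scalars_zero[OF fW])
    fix c x assume e: "(\<Sum>x\<in>W. (\<lambda>i. const (c x) * x i)) = 0" and "x \<in> W"
    then obtain i m where im: "x = delta_tuple (i, m)" "(i, m) \<in> ?S" by (auto simp: W_def)
    have "0 = lk ((\<Sum>x\<in>W. (\<lambda>i. const (c x) * x i)) i) m" using e by simp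
    also have "\<dots> = (\<Sum>x\<in>W. c x * lk (x i) m)"
      by (simp add: sum_apply lookup_sum)
    also have "\<dots> = (\<Sum>y\<in>?S. c (delta_tuple y) * lk (delta_tuple y i) m)"
      unfolding W_def by (subst sum.reindex) (auto intro: inj_on_subset[OF inj_delta])
    also have "\<dots> = (\<Sum>y\<in>?S. if y = (i, m) then c (delta_tuple y) else 0)"
    proof (intro sum.cong refl)
      fix y
      have "lk (delta_tuple y i) m = (if y = (i, m) then 1 else 0)"
        by (cases y) (auto simp: delta_tuple_def lookup_single when_def)
      then show "c (delta_tuple y) * lk (delta_tuple y i) m = (if y = (i, m) then c (delta_tuple y) else 0)"
        by simp
    qed
    also have "\<dots> = c x" unfolding im(1) using im(2) fS by (simp only: sum.delta if_True)
    finally show "c x = 0" by simp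
  qed
  show "graded_tuples K s \<subseteq> fun_vs.span W"
  proof
    fix h assume h: "h \<in> graded_tuples K s"
    have "h = (\<Sum>y\<in>?S. (\<lambda>j. const (lk (h (fst y)) (snd y)) * delta_tuple y j))"
    proof (intro ext poly_mapping_eqI)
      fix j k
      have "lk ((\<Sum>y\<in>?S. (\<lambda>j. const (lk (h (fst y)) (snd y)) * delta_tuple y j)) j) k =
        (\<Sum>y\<in>?S. lk (h (fst y)) (snd y) * lk (delta_tuple y j) k)"
        by (simp add: sum_apply lookup_sum)
      also have "\<dots> = (\<Sum>y\<in>?S. if y = (j, k) then lk (h j) k else 0)"
        by (intro sum.cong) (auto simp: delta_tuple_def lookup_single when_def)
      also have "\<dots> = (if (j, k) \<in> ?S then lk (h j) k else 0)" using fS by (simp add: sum.delta)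
      also have "\<dots> = lk (h j) k"
        using h by (cases "j < K") (fastforce simp: graded_tuples_def forms_def in_keys_iff)+
      finally show "lk (h j) k = lk ((\<Sum>y\<in>?S. (\<lambda>j. const (lk (h (fst y)) (snd y)) * delta_tuple y j)) j) k" by simp
    qed
    moreover have "(\<Sum>y\<in>?S. (\<lambda>j. const (lk (h (fst y)) (snd y)) * delta_tuple y j)) \<in> fun_vs.span W"
      by (intro fun_vs.span_sum fun_vs.span_scale fun_vs.span_base) (auto simp: W_def)
    ultimately show "h \<in> fun_vs.span W" by simp
  qed
qed

lemma single_basis:
  fixes M :: "mon4 set"
  assumes fM: "finite M"
  defines "W \<equiv> (\<lambda>m. sg m (1::complex)) ` M"
  shows "card W = card M" "poly_vs.independent W" "poly_vs.span W = {f. ks f \<subseteq> M}"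
proof -
  have inj: "inj_on (\<lambda>m. sg m (1::complex)) A" for A :: "mon4 set"
    by (rule inj_onI) (metis lookup_single_eq lookup_single_not_eq zero_neq_one)
  have fW: "finite W" unfolding W_def using fM by simp
  show "card W = card M" unfolding W_def by (rule card_image[OF inj])
  show "poly_vs.independent W"
  proof (rule poly_vs.independent_if_scalars_zero[OF fW])
    fix c x assume e: "(\<Sum>x\<in>W. const (c x) * x) = 0" and "x \<in> W"
    then obtain m where m: "x = sg m 1" "m \<in> M" by (auto simp: W_def)
    have "0 = lk (\<Sum>x\<in>W. const (c x) * x) m" using e by simp
    also have "\<dots> = (\<Sum>k\<in>M. c (sg k 1) * lk (sg k (1::complex)) m)"
      unfolding W_def by (subst sum.reindex[OF inj]) (simp add: lookup_sum)
    also have "\<dots> = (\<Sum>k\<in>M. if k = m then c (sg k 1) else 0)"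
      by (intro sum.cong) (auto simp: lookup_single when_def)
    also have "\<dots> = c x" using m fM by (simp add: sum.delta)
    finally show "c x = 0" by simp
  qed
  show "poly_vs.span W = {f. ks f \<subseteq> M}"
  proof
    show "poly_vs.span W \<subseteq> {f. ks f \<subseteq> M}"
    proof (rule poly_vs.span_minimal)
      show "poly_vs.subspace {f. ks f \<subseteq> M}"
        unfolding poly_vs.subspace_def
      proof (intro conjI ballI allI)
        fix x y assume "x \<in> {f::poly4. ks f \<subseteq> M}" "y \<in> {f::poly4. ks f \<subseteq> M}"
        then show "x + y \<in> {f. ks f \<subseteq> M}" using Poly_Mapping.keys_add[of x y] by blast
      next
        fix c :: complex and x :: poly4 assume "x \<in> {f. ks f \<subseteq> M}"
        then show "const c * x \<in> {f. ks f \<subseteq> M}" by (auto simp: subset_iff in_keys_iff)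
      qed simp
    qed (auto simp: W_def)
    show "{f. ks f \<subseteq> M} \<subseteq> poly_vs.span W"
    proof clarify
      fix f :: poly4 assume f: "ks f \<subseteq> M"
      have "f = (\<Sum>m\<in>ks f. const (lk f m) * sg m 1)"
        by (subst sum_singles) (simp add: const_def mult_single)
      moreover have "(\<Sum>m\<in>ks f. const (lk f m) * sg m 1) \<in> poly_vs.span W"
        using f by (intro poly_vs.span_sum poly_vs.span_scale poly_vs.span_base) (auto simp: W_def)
      ultimately show "f \<in> poly_vs.span W" by simp
    qed
  qed
qed

lemma dim_forms: "poly_vs.dim (forms t) = (t + 3) choose 3"
proof -
  have "forms t = {f. ks f \<subseteq> {m. mdeg m = t}}" by (auto simp: forms_def)
  then have "forms t = poly_vs.span ((\<lambda>m. sg m 1) ` {m. mdeg m = t})"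
    by (simp add: single_basis(3) finite_mdeg)
  then show ?thesis
    using single_basis(1,2)[OF finite_mdeg, of t]
    by (simp add: poly_vs.dim_eq_card_independent card_mdeg)
qed

section \<open>Homogeneous components\<close>

definition hcomp :: "nat \<Rightarrow> poly4 \<Rightarrow> poly4" where
  "hcomp t f = (\<Sum>m\<in>{m \<in> ks f. mdeg m = t}. sg m (lk f m))"

lemma lk_hcomp: "lk (hcomp t f) m = (if mdeg m = t then lk f m else 0)"
proof -
  have "lk (hcomp t f) m = (\<Sum>k\<in>{m \<in> ks f. mdeg m = t}. if k = m then lk f m else 0)"
    unfolding hcomp_def lookup_sum by (intro sum.cong) (auto simp: lookup_single when_def)
  also have "\<dots> = (if m \<in> {m \<in> ks f. mdeg m = t} then lk f m else 0)"
    by (rule sum.delta) simp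
  finally show ?thesis by (auto simp: in_keys_iff)
qed

lemma hcomp_forms: "hcomp t f \<in> forms t"
  by (auto simp: forms_def in_keys_iff lk_hcomp split: if_splits)

lemma hcomp_add: "hcomp t (f + g) = hcomp t f + hcomp t g"
  by (rule poly_mapping_eqI) (simp add: lk_hcomp lookup_add)

lemma hcomp_0 [simp]: "hcomp t 0 = 0"
  by (rule poly_mapping_eqI) (simp add: lk_hcomp)

lemma hcomp_sum: "hcomp t (sum f A) = (\<Sum>x\<in>A. hcomp t (f x))"
  by (induction A rule: infinite_finite_induct) (simp_all add: hcomp_add)

lemma hcomp_same: "f \<in> forms t \<Longrightarrow> hcomp t f = f"
  by (rule poly_mapping_eqI) (auto simp: lk_hcomp forms_def in_keys_iff)

lemma hcomp_other: "f \<in> forms s \<Longrightarrow> s \<noteq> t \<Longrightarrow> hcomp t f = 0"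
  by (rule poly_mapping_eqI) (auto simp: lk_hcomp forms_def in_keys_iff)

lemma sum_hcomp: "f = (\<Sum>t\<in>mdeg ` ks f. hcomp t f)"
proof (rule poly_mapping_eqI)
  fix k
  show "lk f k = lk (\<Sum>t\<in>mdeg ` ks f. hcomp t f) k"
    by (auto simp: lookup_sum lk_hcomp in_keys_iff)
qed

lemma hcomp_mult:
  assumes g: "g \<in> forms e"
  shows "hcomp t (h * g) = (if e \<le> t then hcomp (t - e) h * g else 0)"
proof -
  have F: "hcomp s h * g \<in> forms (s + e)" for s
    using g hcomp_forms[of s h] by (simp add: forms_homog homog_mult additive_mdeg)
  have "h * g = (\<Sum>s\<in>mdeg ` ks h. hcomp s h * g)"
    by (subst sum_hcomp[of h]) (simp add: sum_distrib_right)
  then have "hcomp t (h * g) = (\<Sum>s\<in>mdeg ` ks h. hcomp t (hcomp s h * g))"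
    by (simp add: hcomp_sum)
  also have "\<dots> = (\<Sum>s\<in>mdeg ` ks h. if s = t - e \<and> e \<le> t then hcomp (t - e) h * g else 0)"
  proof (intro sum.cong refl)
    fix s
    show "hcomp t (hcomp s h * g) = (if s = t - e \<and> e \<le> t then hcomp (t - e) h * g else 0)"
      using hcomp_same[OF F[of s]] hcomp_other[OF F[of s], of t] by (cases "s + e = t") auto
  qed
  also have "\<dots> = (if e \<le> t then hcomp (t - e) h * g else 0)"
  proof (cases "t - e \<in> mdeg ` ks h")
    case True
    then show ?thesis by simp
  next
    case False
    then have "hcomp (t - e) h = 0"
      by (intro poly_mapping_eqI) (simp add: lk_hcomp image_iff, metis in_keys_iff)
    then show ?thesis by simp
  qed
  finally show ?thesis .
qed

lemma forms_add: "f \<in> forms t \<Longrightarrow> g \<in> forms t \<Longrightarrow> f + g \<in> forms t"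
  and forms_diff: "f \<in> forms t \<Longrightarrow> g \<in> forms t \<Longrightarrow> f - g \<in> forms t"
  and forms_uminus: "f \<in> forms t \<Longrightarrow> - f \<in> forms t"
  and forms_0 [simp]: "0 \<in> forms t"
  and forms_mult: "f \<in> forms s \<Longrightarrow> g \<in> forms t \<Longrightarrow> f * g \<in> forms (s + t)"
  and forms_single: "mdeg m = t \<Longrightarrow> sg m c \<in> forms t"
  and forms_const: "const c \<in> forms 0"
  by (auto simp: forms_homog homog_add homog_diff homog_uminus homog_mult additive_mdeg homog_single
      homog_const)

lemma forms_sum: "(\<And>x. x \<in> A \<Longrightarrow> f x \<in> forms t) \<Longrightarrow> sum f A \<in> forms t"
  by (simp add: forms_homog homog_sum)

lemma forms_const_mult: "f \<in> forms t \<Longrightarrow> const c * f \<in> forms t"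
  using forms_mult[OF forms_const] by fastforce

section \<open>Restriction to a line\<close>

definition line_pt :: "complex \<Rightarrow> 4 \<Rightarrow> complex" where
  "line_pt s = (\<lambda>i. if i = 2 then 1 else if i = 3 then s else 0)"

lemma line_pt_simps [simp]: "line_pt s 0 = 0" "line_pt s 1 = 0" "line_pt s 2 = 1" "line_pt s 3 = s"
  by (simp_all add: line_pt_def)

lemma monomial_val_line_pt:
  "monomial_val (line_pt s) m = (if lk m 0 = 0 \<and> lk m 1 = 0 then s ^ lk m 3 else 0)"
  by (auto simp: monomial_val_4 power_0_left)

definition line_restr :: "poly4 \<Rightarrow> complex poly" where
  "line_restr h = (\<Sum>m\<in>{m \<in> ks h. lk m 0 = 0 \<and> lk m 1 = 0}. Polynomial.monom (lk h m) (lk m 3))"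

lemma poly_line_restr: "poly (line_restr h) s = peval (line_pt s) h"
proof -
  have "peval (line_pt s) h = (\<Sum>m\<in>ks h. if lk m 0 = 0 \<and> lk m 1 = 0 then lk h m * s ^ lk m 3 else 0)"
    unfolding peval_def by (intro sum.cong) (simp_all add: monomial_val_line_pt)
  then show ?thesis
    unfolding line_restr_def
    by (simp add: poly_sum poly_monom sum.inter_filter if_distrib[of "\<lambda>q. poly q s"] cong: if_cong)
qed

lemma degree_line_restr: "h \<in> forms p \<Longrightarrow> degree (line_restr h) \<le> p"
  unfolding line_restr_def
  by (intro degree_sum_le) (force simp: forms_def mdeg_4 intro: order.trans[OF degree_monom_le])+

text \<open>
  On the line \<open>x\<^sub>0 = x\<^sub>1 = 0\<close> the form becomes a univariate polynomial of degree at most \<open>p\<close>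
  with \<open>p + 1\<close> roots, so its monomials in \<open>x\<^sub>2\<close> and \<open>x\<^sub>3\<close> alone have coefficient zero.
\<close>

lemma form_zero_on_line:
  assumes h: "h \<in> forms p" and z: "\<And>k. k \<le> p \<Longrightarrow> peval (line_pt (of_nat k)) h = 0"
    and m: "m \<in> ks h"
  shows "lk m 0 + lk m 1 > 0"
proof (rule ccontr)
  assume "\<not> lk m 0 + lk m 1 > 0"
  then have m0: "lk m 0 = 0" "lk m 1 = 0" by auto
  have "line_restr h = 0"
  proof (rule ccontr)
    assume nz: "line_restr h \<noteq> 0"
    have "of_nat ` {..p} \<subseteq> {s. poly (line_restr h) s = 0}"
      using z by (auto simp: poly_line_restr)
    then have "card ((of_nat :: nat \<Rightarrow> complex) ` {..p}) \<le> card {s. poly (line_restr h) s = 0}"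
      using poly_roots_finite[OF nz] card_mono by blast
    also have "\<dots> \<le> degree (line_restr h)" using nz by (rule card_poly_roots_bound)
    also have "\<dots> \<le> p" by (rule degree_line_restr[OF h])
    finally show False by (simp add: card_image inj_on_def)
  qed
  moreover have "coeff (line_restr h) (lk m 3) = lk h m"
  proof -
    have "k = m" if "k \<in> ks h" "lk k 0 = 0" "lk k 1 = 0" "lk k 3 = lk m 3" for k
    proof -
      have "mdeg k = mdeg m" using h that(1) m by (simp add: forms_def)
      then show ?thesis using that m0 by (intro mon_eqI) (auto simp: mdeg_4)
    qed
    then have "coeff (line_restr h) (lk m 3)
        = (\<Sum>k\<in>{k \<in> ks h. lk k 0 = 0 \<and> lk k 1 = 0}. if k = m then lk h k else 0)"
      unfolding line_restr_def coeff_sum coeff_monom by (intro sum.cong) auto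
    then show ?thesis using m m0 by (simp add: sum.delta)
  qed
  ultimately show False using m by (simp add: in_keys_iff)
qed

section \<open>Counting reduced monomials\<close>

lemma real_choose_3: "6 * real (x + 3 choose 3) = (real x + 1) * (real x + 2) * (real x + 3)"
proof -
  have "x + 3 choose 3 = fact (x + 3) div (fact 3 * fact x)"
    using binomial_fact'[of 3 "x + 3"] by simp
  have "real (x + 3 choose 3) = (\<Prod>i = 0..<3. real (x + 3) - of_nat i) / fact 3"
    by (simp only: binomial_gbinomial gbinomial_prod_rev)
  then show ?thesis by (simp add: eval_nat_numeral fact_numeral algebra_simps)
qed

text \<open>
  These monomials are a basis, in degree \<open>t\<close>, of the free \<open>C[x\<^sub>0, x\<^sub>1]\<close>-module on the monomials
  \<open>x\<^sub>2\<^sup>a x\<^sub>3\<^sup>b\<close> with \<open>a + b < p\<close>.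
\<close>

definition red_mons :: "nat \<Rightarrow> nat \<Rightarrow> mon4 set" where
  "red_mons p t = {m. mdeg m = t \<and> lk m 2 + lk m 3 < p}"

lemma finite_red_mons: "finite (red_mons p t)"
  by (rule finite_subset[OF _ finite_mdeg[of t]]) (auto simp: red_mons_def)

text \<open>
  There are \<open>k + 1\<close> monomials of degree \<open>k\<close> in \<open>x\<^sub>2, x\<^sub>3\<close> and \<open>t - k + 1\<close> of the complementary
  degree in \<open>x\<^sub>0, x\<^sub>1\<close>.
\<close>

lemma card_red_mons:
  assumes "p \<le> Suc t"
  shows "card (red_mons p t) = (\<Sum>k<p. (k + 1) * (t + 1 - k))"
proof -
  let ?S = "SIGMA k:{..<p}. {..k} \<times> {..t - k}"
  define f :: "nat \<times> nat \<times> nat \<Rightarrow> mon4" where "f = (\<lambda>(k, a, b). mon b (t - k - b) a (k - a))"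
  define g :: "mon4 \<Rightarrow> nat \<times> nat \<times> nat" where "g m = (lk m 2 + lk m 3, lk m 2, lk m 0)" for m
  have "bij_betw f ?S (red_mons p t)"
  proof (rule bij_betw_byWitness[where f' = g])
    show "\<forall>x\<in>?S. g (f x) = x" by (force simp: f_def g_def)
    show "\<forall>m\<in>red_mons p t. f (g m) = m"
    proof
      fix m assume "m \<in> red_mons p t"
      then show "f (g m) = m"
        by (intro mon_eqI) (auto simp: f_def g_def red_mons_def mdeg_4)
    qed
    have "f (k, a, b) \<in> red_mons p t" if "k < p" "a \<le> k" "b \<le> t - k" for k a b
      using that assms by (simp add: f_def red_mons_def)
    then show "f ` ?S \<subseteq> red_mons p t" by auto
    have "g m \<in> ?S" if "m \<in> red_mons p t" for m
    proof -
      have "lk m 0 \<le> t - (lk m 2 + lk m 3)" "lk m 2 + lk m 3 < p"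
        using that unfolding red_mons_def mdeg_4 mem_Collect_eq by linarith+
      then show ?thesis by (simp add: g_def)
    qed
    then show "g ` red_mons p t \<subseteq> ?S" by (rule image_subsetI)
  qed
  then have "card (red_mons p t) = card ?S" by (metis bij_betw_same_card)
  also have "\<dots> = (\<Sum>k<p. (k + 1) * (t + 1 - k))"
  proof -
    have "card ?S = (\<Sum>k<p. card ({..k} \<times> {..t - k}))" by (rule card_SigmaI) auto
    also have "\<dots> = (\<Sum>k<p. (k + 1) * (t + 1 - k))"
      using assms by (intro sum.cong refl) (simp add: card_cartesian_product Suc_diff_le)
    finally show ?thesis .
  qed
  finally show ?thesis .
qed

lemma real_card_red_mons:
  assumes "p \<le> Suc t"
  shows "real (card (red_mons p t)) =
    real p * (real p + 1) / 2 * (real t + 1) - (real p - 1) * real p * (real p + 1) / 3"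
proof -
  have "real (card (red_mons p t)) = (\<Sum>k<p. (real k + 1) * (real t + 1 - real k))"
  proof -
    have "real (t + 1 - k) = real t + 1 - real k" if "k < p" for k
      using that assms by (simp add: of_nat_diff)
    then show ?thesis
      unfolding card_red_mons[OF assms] of_nat_sum 
      by (intro sum.cong) (auto simp only: of_nat_mult of_nat_add of_nat_1 lessThan_iff)
  qed
  also have "\<dots> = real p * (real p + 1) / 2 * (real t + 1) - (real p - 1) * real p * (real p + 1) / 3"
    by (induction p) (simp_all add: field_simps)
  finally show ?thesis .
qed

text \<open>
  The Hilbert functions of a free module over a polynomial ring in two variables, and of the
  quotient by the minors of a linear Hilbert-Burch matrix, agree: the second summand on the left
  counts coefficient tuples of \<open>p + 1\<close> minors of degree \<open>p\<close>, and the second one on the right the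
  syzygies given by \<open>p\<close> columns.
\<close>

lemma hilbert_burch_count:
  assumes "Suc p \<le> t"
  shows "card (red_mons p t) + Suc p * ((t - p) + 3 choose 3)
    = (t + 3 choose 3) + p * ((t - Suc p) + 3 choose 3)"
proof -
  define s where "s = t - Suc p"
  have t: "t = s + p + 1" "t - p = s + 1" using assms by (auto simp: s_def)
  have "6 * real (card (red_mons p t) + Suc p * ((t - p) + 3 choose 3))
    = 6 * real ((t + 3 choose 3) + p * (s + 3 choose 3))"
    using real_choose_3[of t] real_choose_3[of s] real_choose_3[of "t - p"] assms
    unfolding of_nat_add of_nat_mult t(2)
    apply (simp only: real_card_red_mons distrib_left mult.left_commute[of 6])
    apply (simp add: t(1) field_simps)
    done
  then have "real (card (red_mons p t) + Suc p * ((t - p) + 3 choose 3))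
    = real ((t + 3 choose 3) + p * (s + 3 choose 3))" by (simp only: mult_cancel_left) simp
  then show ?thesis unfolding s_def of_nat_eq_iff .
qed

section \<open>Division by a linear polynomial\<close>

abbreviation var :: "4 \<Rightarrow> poly4" where "var i \<equiv> sg (sg i 1) 1"

lemma peval_var [simp]: "peval v (var i) = v i"
  by simp

lemma div_linear:
  "\<exists>k f0. f = (var i - const a) * k + f0 \<and> (\<forall>v. peval v f0 = peval (v(i := a)) f)"
proof -
  have pow: "\<exists>k. x ^ j = (x - const a) * k + const (a ^ j)" for j and x :: poly4
  proof (induction j)
    case 0
    show ?case by (intro exI[of _ 0]) simp
  next
    case (Suc j)
    then obtain k where k: "x ^ j = (x - const a) * k + const (a ^ j)" by auto
    have "x ^ Suc j = (x - const a) * (x * k + const (a ^ j)) + const (a ^ Suc j)"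
      unfolding power_Suc k const_mult by (simp add: algebra_simps)
    then show ?case by blast
  qed
  have mono: "\<exists>k f0. sg m c = (var i - const a) * k + f0 \<and> (\<forall>v. peval v f0 = peval (v(i := a)) (sg m c))"
    for m :: mon4 and c
  proof -
    define m' where "m' = m - sg i (lk m i)"
    have m: "m = m' + sg i (lk m i)"
      by (rule poly_mapping_eqI) (simp add: m'_def lookup_add lookup_minus lookup_single when_def)
    have m'i: "lk m' i = 0" by (simp add: m'_def lookup_minus)
    have pw: "var i ^ j = sg (sg i j) 1" for j
      by (induction j) (simp_all add: mult_single flip: single_add)
    obtain k where k: "var i ^ lk m i = (var i - const a) * k + const (a ^ lk m i)"
      using pow by blast
    have "sg m c = sg m' c * var i ^ lk m i"
      by (subst m) (simp only: pw mult_single mult_1_right)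
    then have 1: "sg m c = (var i - const a) * (sg m' c * k) + sg m' c * const (a ^ lk m i)"
      unfolding k by (simp add: algebra_simps)
    have 2: "monomial_val v m' = monomial_val (v(i := a)) m'" for v
      unfolding monomial_val_def using m'i by (intro prod.cong) (auto simp: in_keys_iff)
    have "monomial_val (v(i := a)) m = monomial_val (v(i := a)) m' * a ^ lk m i" for v
      by (subst m) (simp add: monomial_val_add)
    then have "peval v (sg m' c * const (a ^ lk m i)) = peval (v(i := a)) (sg m c)" for v
      by (simp add: peval_mult 2[of v])
    then show ?thesis using 1 by blast
  qed
  have "\<exists>k f0. (\<Sum>m\<in>A. sg m (lk f m)) = (var i - const a) * k + f0 \<and>
      (\<forall>v. peval v f0 = peval (v(i := a)) (\<Sum>m\<in>A. sg m (lk f m)))" if "finite A" for A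
    using that
  proof (induction A)
    case empty
    show ?case by (intro exI[of _ 0]) simp
  next
    case (insert m A)
    obtain k f0 where 1: "(\<Sum>m\<in>A. sg m (lk f m)) = (var i - const a) * k + f0"
      "\<forall>v. peval v f0 = peval (v(i := a)) (\<Sum>m\<in>A. sg m (lk f m))" using insert by blast
    obtain k' f0' where 2: "sg m (lk f m) = (var i - const a) * k' + f0'"
      "\<forall>v. peval v f0' = peval (v(i := a)) (sg m (lk f m))" using mono by blast
    have "(\<Sum>m\<in>insert m A. sg m (lk f m)) = (var i - const a) * (k' + k) + (f0' + f0)"
      unfolding sum.insert[OF insert(1,2)] 1(1) 2(1) by (simp add: algebra_simps)
    moreover have "\<forall>v. peval v (f0' + f0) = peval (v(i := a)) (\<Sum>m\<in>insert m A. sg m (lk f m))"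
      unfolding sum.insert[OF insert(1,2)] peval_add using 1(2) 2(2) by simp
    ultimately show ?case by blast
  qed
  from this[of "ks f"] show ?thesis by (simp flip: sum_singles)
qed

text \<open>
  Substituting \<open>a\<close> for \<open>x\<^sub>0\<close> kills the right-hand side and not the factor \<open>x\<^sub>1 - b\<close>, so the
  remainder of \<open>f\<close> modulo \<open>x\<^sub>0 - a\<close> is zero.
\<close>

lemma linear_coprime:
  assumes eq: "(var 1 - const b) * f = (var 0 - const a) * h"
  shows "\<exists>k. f = (var 0 - const a) * k"
proof -
  obtain k f0 where f: "f = (var 0 - const a) * k + f0" "\<forall>v. peval v f0 = peval (v(0 := a)) f"
    using div_linear[of f 0 a] by blast
  have "peval v ((var 1 - const b) * f0) = 0" for v
  proof -
    have "peval (v(0 := a)) ((var 1 - const b) * f) = 0"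
      unfolding eq by (simp add: peval_mult peval_diff)
    then show ?thesis using f(2) by (simp add: peval_mult peval_diff)
  qed
  then have "(var 1 - const b) * f0 = 0" by (rule peval_eq_0_imp)
  moreover have "var 1 - const b \<noteq> 0"
  proof
    assume "var 1 - const b = 0"
    then have "peval (\<lambda>_. b + 1) (var 1 - const b) = 0" by simp
    then show False by (simp add: peval_diff)
  qed
  ultimately have "f0 = 0" by simp
  then show ?thesis using f(1) by auto
qed

lemma var_minus_const_neq_0: "var i - const a \<noteq> 0"
proof
  assume "var i - const a = 0"
  then have "peval (\<lambda>_. a + 1) (var i - const a) = 0" by simp
  then show False by (simp add: peval_diff)
qed

section \<open>Linear Hilbert-Burch matrices\<close>

definition reduced :: "nat \<Rightarrow> poly4 \<Rightarrow> bool" where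
  "reduced p f \<longleftrightarrow> (\<forall>m\<in>ks f. lk m 2 + lk m 3 < p)"

lemma reduced_0 [simp]: "reduced p 0"
  by (simp add: reduced_def)

lemma reduced_add: "reduced p f \<Longrightarrow> reduced p g \<Longrightarrow> reduced p (f + g)"
  using Poly_Mapping.keys_add[of f g] by (auto simp: reduced_def)

lemma reduced_uminus: "reduced p (f :: poly4) \<Longrightarrow> reduced p (- f)"
  by (auto simp: reduced_def in_keys_iff)

lemma reduced_diff: "reduced p f \<Longrightarrow> reduced p g \<Longrightarrow> reduced p (f - g)"
  using reduced_add[of p f "- g"] reduced_uminus[of p g] by simp

lemma reduced_hcomp: "reduced p f \<Longrightarrow> reduced p (hcomp t f)"
  by (auto simp: reduced_def in_keys_iff lk_hcomp split: if_splits)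

lemma reduced_const_mult: "reduced p f \<Longrightarrow> reduced p (const c * f)"
  by (auto simp: reduced_def in_keys_iff)

lemma reduced_var_mult: "reduced p f \<Longrightarrow> i = 0 \<or> i = 1 \<Longrightarrow> reduced p (var i * f)"
  unfolding reduced_def
proof
  fix m assume f: "\<forall>m\<in>ks f. lk m 2 + lk m 3 < p" and i: "i = 0 \<or> i = 1" and m: "m \<in> ks (var i * f)"
  obtain m' where "m = sg i 1 + m'" "m' \<in> ks f"
    using m Poly_Mapping.keys_mult[of "var i" f] by auto
  then show "lk m 2 + lk m 3 < p" using f i by (auto simp: lookup_add lookup_single)
qed

lemma reduced_linear_mult: "reduced p f \<Longrightarrow> i = 0 \<or> i = 1 \<Longrightarrow> reduced p ((var i - const a) * f)"
  unfolding left_diff_distrib by (intro reduced_diff reduced_var_mult reduced_const_mult)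

lemma forms_reduced: "{f \<in> forms t. reduced p f} = {f. ks f \<subseteq> red_mons p t}"
  by (auto simp: forms_def reduced_def red_mons_def)

locale linear_rows =
  fixes A :: "poly4 mat" and N n :: nat
  assumes A: "A \<in> carrier_mat (Suc N) N"
    and n: "0 < n" "n \<le> N"
    and const_rows: "\<And>i j. i < Suc N - n \<Longrightarrow> j < N \<Longrightarrow> A $$ (i, j) \<in> forms 0"
    and linear_rows: "\<And>i j. Suc N - n \<le> i \<Longrightarrow> i < Suc N \<Longrightarrow> j < N \<Longrightarrow> A $$ (i, j) \<in> forms 1"
begin

abbreviation "r \<equiv> Suc N - n"

text \<open>The degree of the entries of a row, and of the minor that omits this row.\<close>

definition rdeg :: "nat \<Rightarrow> nat" where "rdeg i = (if i < r then 0 else 1)"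

definition mdegree :: "nat \<Rightarrow> nat" where "mdegree i = n - rdeg i"

lemma entry_forms: "i < Suc N \<Longrightarrow> j < N \<Longrightarrow> A $$ (i, j) \<in> forms (rdeg i)"
  using const_rows linear_rows by (auto simp: rdeg_def)

lemma sum_rdeg: "(\<Sum>i<Suc N. rdeg i) = n"
proof -
  have "(\<Sum>i<Suc N. rdeg i) = card {i \<in> {..<Suc N}. \<not> i < r}"
    by (simp add: rdeg_def sum.If_cases del: sum.lessThan_Suc) (rule arg_cong[of _ _ card], auto)
  also have "{i \<in> {..<Suc N}. \<not> i < r} = {r..<Suc N}" by auto
  finally show ?thesis using n by simp
qed

lemma det_row_del_forms:
  assumes i: "i < Suc N"
  shows "det (row_del A i) \<in> forms (mdegree i)"
proof -
  have "homog mdeg (\<Sum>a<N. rdeg (insert_index i a)) (det (row_del A i))"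
    using A entry_forms insert_index_lt
    by (intro homog_det[OF additive_mdeg]) (auto simp: row_del_def forms_homog)
  moreover have "(\<Sum>a<N. rdeg (insert_index i a)) = (\<Sum>x\<in>{..<Suc N} - {i}. rdeg x)"
    using sum.reindex_bij_betw[OF bij_insert_index[OF i]] by blast
  moreover have "\<dots> = mdegree i"
    using i sum_rdeg unfolding mdegree_def by (subst sum_diff1_nat) auto
  ultimately show ?thesis by (simp add: forms_homog)
qed

end

text \<open>
  A matrix with one row more than columns, whose first rows are constant and whose last \<open>n\<close> rows
  are linear, such that the minors that omit a linear row restrict to linearly independent forms
  on the line \<open>x\<^sub>0 = x\<^sub>1 = 0\<close>. Independence is expressed by the values at \<open>n\<close> points of the
  line, which determine a binary form of degree \<open>n - 1\<close>. There are as many of these minors as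
  monomials of their degree on the line, so that they span all binary forms of that degree.
\<close>

locale linear_hilbert_burch = linear_rows +
  assumes line: "det (mat n n (\<lambda>(i, k). peval (line_pt (of_nat k)) (det (row_del A (Suc N - n + i))))) \<noteq> 0"
begin

definition minr :: "nat \<Rightarrow> poly4" where "minr i = (-1) ^ i * det (row_del A i)"

definition J :: "poly4 set" where "J = {f. \<exists>h. f = (\<Sum>i<Suc N. h i * minr i)}"

lemma minr_forms: "i < Suc N \<Longrightarrow> minr i \<in> forms (mdegree i)"
  using det_row_del_forms[of i] forms_uminus[of "det (row_del A i)"]
  by (cases "even i") (auto simp: minr_def)

lemma in_J: "f = (\<Sum>i<Suc N. h i * minr i) \<Longrightarrow> f \<in> J"
  unfolding J_def by (rule CollectI, rule exI)

lemma isideal_J: "isideal J"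
  unfolding isideal_def
proof (intro conjI ballI allI)
  show "0 \<in> J" by (rule in_J[of _ "\<lambda>_. 0"]) simp
next
  fix a b assume "a \<in> J" "b \<in> J"
  then obtain h k where hk: "a = (\<Sum>i<Suc N. h i * minr i)" "b = (\<Sum>i<Suc N. k i * minr i)"
    by (auto simp: J_def)
  have "a + b = (\<Sum>i<Suc N. (h i + k i) * minr i)"
    unfolding hk by (simp only: sum.distrib distrib_right)
  then show "a + b \<in> J" by (rule in_J)
next
  fix a x assume "a \<in> J"
  then obtain h where h: "a = (\<Sum>i<Suc N. h i * minr i)" by (auto simp: J_def)
  have "x * a = (\<Sum>i<Suc N. (x * h i) * minr i)"
    unfolding h by (simp only: sum_distrib_left mult.assoc)
  then show "x * a \<in> J" by (rule in_J)
qed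

lemma det_row_del_in_J: "i < Suc N \<Longrightarrow> det (row_del A i) \<in> J"
proof -
  assume i: "i < Suc N"
  have "minr i = (\<Sum>j<Suc N. (if j = i then 1 else 0) * minr j)"
  proof -
    have "(\<Sum>j<Suc N. (if j = i then 1 else 0) * minr j) = (\<Sum>j<Suc N. if j = i then minr j else 0)"
      by (intro sum.cong) auto
    then show ?thesis using i by (simp only: sum.delta finite_lessThan) simp
  qed
  then have "minr i \<in> J" by (rule in_J)
  then have "(-1) ^ i * minr i \<in> J" by (rule isidealD(3)[OF isideal_J])
  then show ?thesis by (simp add: minr_def flip: mult.assoc power_add)
qed

text \<open>
  The minors that omit a linear row span the binary forms of degree \<open>n - 1\<close>, so some combination
  of them agrees with the monomial on the line; their difference \<open>h\<close> has no monomial in \<open>x\<^sub>2\<close>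
  and \<open>x\<^sub>3\<close> alone.
\<close>

lemma binary_monomial_mod_J:
  assumes ab: "a + b = n - 1"
  shows "\<exists>h\<in>forms (n - 1). sg (mon 0 0 a b) 1 - h \<in> J \<and> (\<forall>m\<in>ks h. lk m 0 + lk m 1 > 0)"
proof -
  define f where "f i = det (row_del A (r + i))" for i
  define M where "M = mat n n (\<lambda>(i, k). peval (line_pt (of_nat k)) (f i))"
  have M: "M \<in> carrier_mat n n" and dM: "det M \<noteq> 0" using line by (auto simp: M_def f_def)
  define x where "x = sg (mon 0 0 a b) (1::complex)"
  define w where "w k = peval (line_pt (of_nat k)) x" for k
  \<comment> \<open>Cramer's rule: the combination with coefficients \<open>c\<close> has the prescribed values \<open>w\<close>.\<close>
  define c where "c i = (\<Sum>k<n. w k * adj_mat M $$ (k, i)) / det M" for i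
  have cw: "(\<Sum>i<n. c i * M $$ (i, l)) = w l" if l: "l < n" for l
  proof -
    have "(\<Sum>i<n. adj_mat M $$ (k, i) * M $$ (i, l)) = (if k = l then det M else 0)" if "k < n" for k
    proof -
      have "(\<Sum>i<n. adj_mat M $$ (k, i) * M $$ (i, l)) = (adj_mat M * M) $$ (k, l)"
        using that l M adj_mat(1)[OF M] by (simp add: scalar_prod_def atLeast0LessThan)
      also have "\<dots> = (if k = l then det M else 0)"
        unfolding adj_mat(3)[OF M] using that l by simp
      finally show ?thesis .
    qed
    note adj = this
    have "(\<Sum>i<n. c i * M $$ (i, l)) * det M = (\<Sum>i<n. \<Sum>k<n. w k * (adj_mat M $$ (k, i) * M $$ (i, l)))"
    proof -
      have "c i * M $$ (i, l) * det M = (\<Sum>k<n. w k * (adj_mat M $$ (k, i) * M $$ (i, l)))" for i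
      proof -
        have "c i * M $$ (i, l) * det M = (\<Sum>k<n. w k * adj_mat M $$ (k, i)) * M $$ (i, l)"
          unfolding c_def using dM by simp
        then show ?thesis by (simp add: sum_distrib_right mult.assoc)
      qed
      then show ?thesis by (simp add: sum_distrib_right)
    qed
    also have "\<dots> = (\<Sum>k<n. w k * (\<Sum>i<n. adj_mat M $$ (k, i) * M $$ (i, l)))"
      by (subst sum.swap) (simp add: sum_distrib_left)
    also have "\<dots> = (\<Sum>k<n. if k = l then w k * det M else 0)"
      using adj by (intro sum.cong) auto
    also have "\<dots> = w l * det M" using l by simp
    finally show ?thesis using dM by simp
  qed
  define g where "g = (\<Sum>i<n. const (c i) * f i)"
  have fi: "f i \<in> forms (n - 1)" "f i \<in> J" if "i < n" for i
  proof -
    have ri: "r + i < Suc N" using that n by linarith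
    have "mdegree (r + i) = n - 1" by (simp only: mdegree_def rdeg_def) simp
    then show "f i \<in> forms (n - 1)" "f i \<in> J"
      using det_row_del_forms[OF ri] det_row_del_in_J[OF ri] by (simp_all only: f_def)
  qed
  have g: "g \<in> forms (n - 1)"
    unfolding g_def using fi(1) by (intro forms_sum forms_const_mult) simp
  have gJ: "g \<in> J"
    unfolding g_def using fi(2) by (intro isideal_sum[OF isideal_J] isidealD(3)[OF isideal_J]) simp
  have x: "x \<in> forms (n - 1)" using ab by (simp add: x_def forms_single)
  have h: "x - g \<in> forms (n - 1)" using g x by (simp add: forms_diff)
  have hJ: "x - (x - g) \<in> J" using gJ by simp
  have "lk m 0 + lk m 1 > 0" if "m \<in> ks (x - g)" for m
  proof (rule form_zero_on_line[OF h _ that])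
    fix k assume "k \<le> n - 1"
    then have k: "k < n" using n by simp
    have "peval (line_pt (of_nat k)) g = (\<Sum>i<n. c i * M $$ (i, k))"
      using k by (simp add: g_def peval_sum peval_mult M_def)
    then show "peval (line_pt (of_nat k)) (x - g) = 0" using cw[OF k] by (simp add: peval_diff w_def)
  qed
  then have "\<forall>m\<in>ks (x - g). lk m 0 + lk m 1 > 0" by (intro ballI)
  with hJ have "sg (mon 0 0 a b) 1 - (x - g) \<in> J \<and> (\<forall>m\<in>ks (x - g). lk m 0 + lk m 1 > 0)"
    by (simp only: x_def simp_thms)
  then show ?thesis using h by (rule bexI)
qed

text \<open>
  A factor of degree \<open>n - 1\<close> in \<open>x\<^sub>2\<close> and \<open>x\<^sub>3\<close> can be replaced modulo \<open>J\<close> by monomials in which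
  \<open>x\<^sub>0\<close> or \<open>x\<^sub>1\<close> occurs. This lowers the degree in \<open>x\<^sub>2\<close> and \<open>x\<^sub>3\<close> while the total degree stays
  the same.
\<close>

lemma monomial_reduction:
  "\<exists>g\<in>forms (mdeg m). reduced (n - 1) g \<and> sg m 1 - g \<in> J"
proof (induction "lk m 2 + lk m 3" arbitrary: m rule: less_induct)
  case less
  show ?case
  proof (cases "lk m 2 + lk m 3 < n - 1")
    case True
    then show ?thesis
      using isidealD(1)[OF isideal_J] by (intro bexI[of _ "sg m 1"]) (auto simp: reduced_def forms_single)
  next
    case False
    define a where "a = min (lk m 2) (n - 1)"
    define b where "b = n - 1 - a"
    have ab: "a + b = n - 1" "a \<le> lk m 2" "b \<le> lk m 3" using False by (auto simp: a_def b_def)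
    define m' where "m' = mon (lk m 0) (lk m 1) (lk m 2 - a) (lk m 3 - b)"
    have m: "m = m' + mon 0 0 a b"
      by (rule mon_eqI) (use ab in \<open>simp_all add: m'_def lookup_add\<close>)
    have md: "mdeg m = mdeg m' + (n - 1)" by (subst m) (simp add: mdeg_add ab)
    obtain h where h: "h \<in> forms (n - 1)" "sg (mon 0 0 a b) 1 - h \<in> J" "\<forall>m\<in>ks h. lk m 0 + lk m 1 > 0"
      using binary_monomial_mod_J[OF ab(1)] by blast
    have "\<exists>g\<in>forms (mdeg m). reduced (n - 1) g \<and> sg (k + m') 1 - g \<in> J" if k: "k \<in> ks h" for k
    proof -
      have dk: "mdeg k = n - 1" using h(1) k by (simp add: forms_def)
      have "lk (k + m') 2 + lk (k + m') 3 < lk m 2 + lk m 3"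
        using h(3) k dk ab unfolding mdeg_4 by (auto simp: lookup_add m'_def)
      from less[OF this] show ?thesis using dk md by (simp add: mdeg_add add.commute)
    qed
    then obtain G where G: "\<And>k. k \<in> ks h \<Longrightarrow> G k \<in> forms (mdeg m)"
      "\<And>k. k \<in> ks h \<Longrightarrow> reduced (n - 1) (G k)" "\<And>k. k \<in> ks h \<Longrightarrow> sg (k + m') 1 - G k \<in> J"
      by metis
    define g where "g = (\<Sum>k\<in>ks h. const (lk h k) * G k)"
    have "h * sg m' 1 = (\<Sum>k\<in>ks h. const (lk h k) * sg (k + m') 1)"
      by (subst sum_singles[of h]) (simp add: sum_distrib_right mult_single const_def)
    then have "h * sg m' 1 - g = (\<Sum>k\<in>ks h. const (lk h k) * (sg (k + m') 1 - G k))"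
      by (simp add: g_def right_diff_distrib sum_subtractf)
    then have 1: "h * sg m' 1 - g \<in> J"
      using G(3) by (simp only:) (intro isideal_sum[OF isideal_J] isidealD(3)[OF isideal_J])
    have 2: "(sg (mon 0 0 a b) 1 - h) * sg m' 1 \<in> J" using h(2) by (rule isidealD(4)[OF isideal_J])
    have "sg m 1 - g = (sg (mon 0 0 a b) 1 - h) * sg m' 1 + (h * sg m' 1 - g)"
      by (subst m) (simp add: algebra_simps mult_single)
    then have "sg m 1 - g \<in> J" using isidealD(2)[OF isideal_J 2 1] by (simp only:)
    moreover have "g \<in> forms (mdeg m)"
      unfolding g_def using G(1) by (intro forms_sum forms_const_mult)
    moreover have "reduced (n - 1) g"
    proof -
      have "reduced (n - 1) (\<Sum>k\<in>S. const (lk h k) * G k)" if "S \<subseteq> ks h" for S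
        using that G(2)
        by (induction S rule: infinite_finite_induct) (auto intro: reduced_add reduced_const_mult)
      then show ?thesis by (simp add: g_def)
    qed
    ultimately show ?thesis by blast
  qed
qed

lemma reduction:
  "\<exists>g. reduced (n - 1) g \<and> f - g \<in> J \<and> mdeg ` ks g \<subseteq> mdeg ` ks f"
proof -
  have "\<forall>m. \<exists>g. g \<in> forms (mdeg m) \<and> reduced (n - 1) g \<and> sg m 1 - g \<in> J"
    using monomial_reduction by blast
  then obtain G where G: "\<And>m. G m \<in> forms (mdeg m)" "\<And>m. reduced (n - 1) (G m)" "\<And>m. sg m 1 - G m \<in> J"
    by metis
  have "reduced (n - 1) (\<Sum>m\<in>S. const (lk f m) * G m) \<and>
      (\<Sum>m\<in>S. sg m (lk f m)) - (\<Sum>m\<in>S. const (lk f m) * G m) \<in> J \<and>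
      mdeg ` ks (\<Sum>m\<in>S. const (lk f m) * G m) \<subseteq> mdeg ` S" if "finite S" for S
    using that
  proof (induction S)
    case empty
    then show ?case using isidealD(1)[OF isideal_J] by simp
  next
    case (insert m S)
    let ?s = "\<Sum>m\<in>S. const (lk f m) * G m"
    have 1: "sg m (lk f m) - const (lk f m) * G m = const (lk f m) * (sg m 1 - G m)"
      by (simp add: right_diff_distrib const_def mult_single)
    have "(sg m (lk f m) + (\<Sum>m\<in>S. sg m (lk f m))) - (const (lk f m) * G m + ?s)
      = (sg m (lk f m) - const (lk f m) * G m) + ((\<Sum>m\<in>S. sg m (lk f m)) - ?s)"
      by simp
    also have "\<dots> \<in> J"
      unfolding 1 using insert isidealD(2,3)[OF isideal_J] G(3) by blast
    finally have "(sg m (lk f m) + (\<Sum>m\<in>S. sg m (lk f m))) - (const (lk f m) * G m + ?s) \<in> J" .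
    moreover have "mdeg ` ks (const (lk f m) * G m + ?s) \<subseteq> mdeg ` insert m S"
    proof -
      have "mdeg ` ks (const (lk f m) * G m) \<subseteq> {mdeg m}"
        using forms_const_mult[OF G(1), of "lk f m" m] by (auto simp: forms_def)
      then show ?thesis
        using Poly_Mapping.keys_add[of "const (lk f m) * G m" ?s] insert by blast
    qed
    ultimately show ?case using insert G(2) by (simp add: reduced_add reduced_const_mult)
  qed
  from this[OF finite_keys[of f], unfolded sum_singles[of f, symmetric]] show ?thesis by blast
qed

lemma hcomp_J: "f \<in> J \<Longrightarrow> hcomp t f \<in> J"
proof -
  assume "f \<in> J"
  then obtain h where h: "f = (\<Sum>i<Suc N. h i * minr i)" by (auto simp: J_def)
  have "hcomp t f = (\<Sum>i<Suc N. (if mdegree i \<le> t then hcomp (t - mdegree i) (h i) else 0) * minr i)"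
    unfolding h hcomp_sum
  proof (intro sum.cong refl)
    fix i assume "i \<in> {..<Suc N}"
    then show "hcomp t (h i * minr i)
      = (if mdegree i \<le> t then hcomp (t - mdegree i) (h i) else 0) * minr i"
      using hcomp_mult[OF minr_forms, of i t "h i"] by auto
  qed
  then show ?thesis by (rule in_J)
qed

text \<open>
  The map from coefficient tuples onto \<open>J\<close>, and the map from \<open>N\<close>-tuples into its kernel that is
  given by the matrix.
\<close>

definition comb :: "(nat \<Rightarrow> poly4) \<Rightarrow> poly4" where "comb h = (\<Sum>i<Suc N. h i * minr i)"

definition syz :: "(nat \<Rightarrow> poly4) \<Rightarrow> nat \<Rightarrow> poly4" where
  "syz u = (\<lambda>i. if i < Suc N then \<Sum>b<N. A $$ (i, b) * u b else 0)"

lemma comb_image: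
  assumes t: "n \<le> t"
  shows "comb ` graded_tuples (Suc N) (\<lambda>i. t - mdegree i) = J \<inter> forms t"
proof
  have le: "mdegree i \<le> t" for i using t by (simp add: mdegree_def)
  show "comb ` graded_tuples (Suc N) (\<lambda>i. t - mdegree i) \<subseteq> J \<inter> forms t"
  proof
    fix y assume "y \<in> comb ` graded_tuples (Suc N) (\<lambda>i. t - mdegree i)"
    then obtain h where h: "y = comb h" "\<And>i. i < Suc N \<Longrightarrow> h i \<in> forms (t - mdegree i)"
      by (auto simp: graded_tuples_def)
    have "comb h \<in> forms t" unfolding comb_def
    proof (rule forms_sum)
      fix i assume "i \<in> {..<Suc N}"
      then show "h i * minr i \<in> forms t"
        using forms_mult[OF h(2) minr_forms, of i i] le[of i] by simp
    qed
    then show "y \<in> J \<inter> forms t" using h in_J[of y h] by (simp add: comb_def)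
  qed
  show "J \<inter> forms t \<subseteq> comb ` graded_tuples (Suc N) (\<lambda>i. t - mdegree i)"
  proof
    fix f assume f: "f \<in> J \<inter> forms t"
    then obtain h where h: "f = (\<Sum>i<Suc N. h i * minr i)" by (auto simp: J_def)
    define k where "k i = (if i < Suc N then hcomp (t - mdegree i) (h i) else 0)" for i
    have "f = hcomp t f" using f by (simp add: hcomp_same)
    also have "\<dots> = comb k"
      unfolding h hcomp_sum comb_def k_def
    proof (intro sum.cong refl)
      fix i assume "i \<in> {..<Suc N}"
      then show "hcomp t (h i * minr i)
        = (if i < Suc N then hcomp (t - mdegree i) (h i) else 0) * minr i"
        using hcomp_mult[OF minr_forms, of i t "h i"] le[of i] by auto
    qed
    finally have "f = comb k" .
    moreover have "k \<in> graded_tuples (Suc N) (\<lambda>i. t - mdegree i)"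
      by (simp add: graded_tuples_def k_def hcomp_forms)
    ultimately show "f \<in> comb ` graded_tuples (Suc N) (\<lambda>i. t - mdegree i)" by blast
  qed
qed

lemma comb_syz: "comb (syz u) = 0"
proof -
  have "comb (syz u) = (\<Sum>i<Suc N. \<Sum>b<N. u b * (A $$ (i, b) * minr i))"
    unfolding comb_def syz_def 
    by (intro sum.cong) (auto simp: sum_distrib_left sum_distrib_right ac_simps simp del: sum.lessThan_Suc)
  also have "\<dots> = (\<Sum>b<N. u b * (\<Sum>i<Suc N. A $$ (i, b) * minr i))"
    by (subst sum.swap) (simp only: sum_distrib_left)
  also have "\<dots> = 0"
    using signed_minors_syzygy[OF A] by (simp add: minr_def del: sum.lessThan_Suc)
  finally show ?thesis .
qed

lemma some_minor_nonzero: "\<exists>i<n. det (row_del A (r + i)) \<noteq> 0"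
proof (rule ccontr)
  assume "\<not> ?thesis"
  then have "mat n n (\<lambda>(i, k). peval (line_pt (of_nat k)) (det (row_del A (r + i)))) = 0\<^sub>m n n"
    by (intro eq_matI) auto
  then show False using line n by simp
qed

text \<open>Some maximal minor is nonzero, and the polynomial ring is a domain.\<close>

lemma syz_inj:
  assumes z: "syz u = syz v" and u: "u \<in> graded_tuples N s" "v \<in> graded_tuples N s"
  shows "u = v"
proof
  fix b
  obtain i where i: "i < n" "det (row_del A (r + i)) \<noteq> 0" using some_minor_nonzero by blast
  show "u b = v b"
  proof (cases "b < N")
    case True
    have "u b - v b = 0"
    proof (rule inj_row_del[OF A, of "r + i" "\<lambda>b. u b - v b"])
      fix k assume k: "k < Suc N"
      have "syz u k = syz v k" using z by simp
      then show "(\<Sum>b<N. A $$ (k, b) * (u b - v b)) = 0"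
        using k by (simp add: syz_def right_diff_distrib sum_subtractf)
    qed (use i n True in auto)
    then show ?thesis by simp
  next
    case False
    then show ?thesis using u by (simp add: graded_tuples_def)
  qed
qed

lemma linear_comb: "Vector_Spaces.linear (\<lambda>c h i. const c * h i) (\<lambda>c f. const c * f) comb"
  by unfold_locales
     (simp_all only: comb_def plus_fun_apply distrib_right sum.distrib sum_distrib_left mult.assoc)

lemma linear_syz: "Vector_Spaces.linear (\<lambda>c h i. const c * h i) (\<lambda>c h i. const c * h i) syz"
proof unfold_locales
  fix u v :: "nat \<Rightarrow> poly4" and c
  show "syz (u + v) = syz u + syz v"
    by (rule ext) (simp add: syz_def distrib_left sum.distrib)
  show "syz (\<lambda>i. const c * u i) = (\<lambda>i. const c * syz u i)"
    by (rule ext) (simp add: syz_def sum_distrib_left mult.left_commute)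
qed

text \<open>
  Counting coefficient tuples modulo the syzygies that come from the columns of the matrix: \<open>r\<close>
  minors of degree \<open>n\<close>, \<open>n\<close> minors of degree \<open>n - 1\<close>, and \<open>N = r + n - 1\<close> columns.
\<close>

lemma dim_J_le:
  assumes t: "n \<le> t"
  shows "poly_vs.dim (J \<inter> forms t) + (n - 1) * (t - n + 3 choose 3) \<le> n * (Suc t - n + 3 choose 3)"
proof -
  interpret fp: vector_space_pair "\<lambda>(c::complex) (h::nat \<Rightarrow> poly4) i. const c * h i" "\<lambda>c (f::poly4). const c * f"
    by unfold_locales
  interpret ff: vector_space_pair "\<lambda>(c::complex) (h::nat \<Rightarrow> poly4) i. const c * h i"
      "\<lambda>(c::complex) (h::nat \<Rightarrow> poly4) i. const c * h i"
    by unfold_locales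
  let ?D = "graded_tuples (Suc N) (\<lambda>i. t - mdegree i)"
  let ?W = "delta_tuple ` (SIGMA i:{..<Suc N}. {m. mdeg m = t - mdegree i})"
  let ?E = "graded_tuples N (\<lambda>_. t - n)"
  let ?V = "delta_tuple ` (SIGMA i:{..<N}. {m. mdeg m = t - n})"
  note W = graded_tuples_basis[of "Suc N" "\<lambda>i. t - mdegree i"]
  note V = graded_tuples_basis[of N "\<lambda>_. t - n"]
  have inj: "inj_on syz (fun_vs.span ?V)"
  proof -
    have "fun_vs.span ?V \<subseteq> ?E"
    proof (rule fun_vs.span_minimal)
      show "fun_vs.subspace ?E"
        unfolding fun_vs.subspace_def by (auto simp: graded_tuples_def forms_add forms_const_mult)
    qed (rule V(4))
    then show ?thesis using syz_inj by (meson inj_onI subsetD)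
  qed
  have K: "fun_vs.independent (syz ` ?V)"
    by (rule ff.linear_independent_injective_image[OF linear_syz V(3) inj])
  have cK: "card (syz ` ?V) = N * (t - n + 3 choose 3)"
    using V(2) card_image[OF inj_on_subset[OF inj fun_vs.span_superset]] by simp
  have KD: "syz ` ?V \<subseteq> ?D"
  proof (rule image_subsetI)
    fix u assume "u \<in> ?V"
    then have u: "u \<in> ?E" using V(4) by blast
    have "syz u i \<in> forms (t - mdegree i)" if i: "i < Suc N" for i
    proof -
      have "rdeg i + (t - n) = t - mdegree i" using t n by (auto simp: mdegree_def rdeg_def)
      then have "A $$ (i, b) * u b \<in> forms (t - mdegree i)" if "b < N" for b
        using forms_mult[OF entry_forms[OF i that], of "u b" "t - n"] u that
        by (simp add: graded_tuples_def)
      then show ?thesis using i by (auto simp: syz_def intro!: forms_sum)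
    qed
    then show "syz u \<in> ?D" by (simp add: graded_tuples_def syz_def)
  qed
  have "poly_vs.dim (comb ` ?D) + card (syz ` ?V) \<le> fun_vs.dim ?D"
    using comb_syz by (intro fp.dim_image_plus_kernel_le[OF linear_comb W(5,1) K KD]) auto
  also have "fun_vs.dim ?D \<le> card ?W" by (rule fun_vs.dim_le_card[OF W(5,1)])
  also have "card ?W = (\<Sum>i<Suc N. (t - mdegree i) + 3 choose 3)" by (rule W(2))
  also have "\<dots> = r * (t - n + 3 choose 3) + n * (Suc t - n + 3 choose 3)"
  proof -
    have S: "{..<Suc N} = {..<r} \<union> {r..<Suc N}" by auto
    have "(\<Sum>i<r. (t - mdegree i) + 3 choose 3) = (\<Sum>i<r. (t - n) + 3 choose 3)"
      by (intro sum.cong) (auto simp: mdegree_def rdeg_def)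
    moreover have "(\<Sum>i\<in>{r..<Suc N}. (t - mdegree i) + 3 choose 3) = (\<Sum>i\<in>{r..<Suc N}. (Suc t - n) + 3 choose 3)"
      using n t by (intro sum.cong) (auto simp: mdegree_def rdeg_def Suc_diff_le)
    ultimately show ?thesis unfolding S using n by (subst sum.union_disjoint) auto
  qed
  finally have "poly_vs.dim (J \<inter> forms t) + N * (t - n + 3 choose 3)
      \<le> r * (t - n + 3 choose 3) + n * (Suc t - n + 3 choose 3)"
    unfolding comb_image[OF t] cK .
  moreover have "N * (t - n + 3 choose 3) = (n - 1) * (t - n + 3 choose 3) + r * (t - n + 3 choose 3)"
    using n by (subst add_mult_distrib[symmetric]) simp
  ultimately show ?thesis by linarith
qed

lemma forms_sum_J_reduced:
  assumes "f \<in> forms t"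
  obtains g where "g \<in> forms t" "reduced (n - 1) g" "f - g \<in> J \<inter> forms t"
proof -
  obtain g where g: "reduced (n - 1) g" "f - g \<in> J" "mdeg ` ks g \<subseteq> mdeg ` ks f"
    using reduction by blast
  have "g \<in> forms t" using g(3) assms by (auto simp: forms_def)
  then show ?thesis using that g assms by (auto intro: forms_diff)
qed

text \<open>
  The forms in \<open>J\<close> and the reduced forms together span all forms. Since their dimensions add up
  to at most the dimension of this space, there is no room for a relation between them.
\<close>

lemma J_reduced_direct:
  assumes t: "n \<le> t"
  shows "poly_vs.dim (J \<inter> forms t) + card (red_mons (n - 1) t) = (t + 3 choose 3)"
    and "J \<inter> forms t \<inter> {f. reduced (n - 1) f} = {0}"
proof -
  let ?W = "(\<lambda>m. sg m (1::complex)) ` {m. mdeg m = t}"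
  let ?R = "(\<lambda>m. sg m (1::complex)) ` red_mons (n - 1) t"
  note W = single_basis[OF finite_mdeg[of t]]
  note R = single_basis[OF finite_red_mons[of "n - 1" t]]
  have spanW: "poly_vs.span ?W = forms t" unfolding W(3) by (auto simp: forms_def)
  have spanR: "poly_vs.span ?R = {f \<in> forms t. reduced (n - 1) f}" unfolding R(3) forms_reduced ..
  have le: "poly_vs.dim (J \<inter> forms t) + card (red_mons (n - 1) t) \<le> (t + 3 choose 3)"
    using dim_J_le[OF t] hilbert_burch_count[of "n - 1" t] n t by (simp add: Suc_diff_le)
  have main: "card C + card (red_mons (n - 1) t) = (t + 3 choose 3)
     \<and> poly_vs.independent (C \<union> ?R) \<and> C \<inter> ?R = {}"
    if C: "C \<subseteq> J \<inter> forms t" "poly_vs.independent C" "J \<inter> forms t \<subseteq> poly_vs.span C" for C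
  proof -
    have fC: "finite C"
      using poly_vs.independent_span_bound[OF _ C(2), of ?W] C(1) spanW finite_mdeg by auto
    have cC: "card C = poly_vs.dim (J \<inter> forms t)" using C by (intro poly_vs.basis_card_eq_dim) auto
    have sp: "forms t \<subseteq> poly_vs.span (C \<union> ?R)"
    proof
      fix f assume "f \<in> forms t"
      then obtain g where g: "g \<in> forms t" "reduced (n - 1) g" "f - g \<in> J \<inter> forms t"
        by (rule forms_sum_J_reduced)
      have "g \<in> poly_vs.span (C \<union> ?R)"
        using g spanR poly_vs.span_mono[of ?R "C \<union> ?R"] by auto
      moreover have "f - g \<in> poly_vs.span (C \<union> ?R)"
        using g C(3) poly_vs.span_mono[of C "C \<union> ?R"] by auto
      ultimately have "(f - g) + g \<in> poly_vs.span (C \<union> ?R)" by (intro poly_vs.span_add)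
      then show "f \<in> poly_vs.span (C \<union> ?R)" by simp
    qed
    have dim: "poly_vs.dim (forms t) = (t + 3 choose 3)" by (rule dim_forms)
    have fR: "finite ?R" using finite_red_mons by simp
    obtain B where B: "B \<subseteq> C \<union> ?R" "poly_vs.independent B" "C \<union> ?R \<subseteq> poly_vs.span B"
      using poly_vs.maximal_independent_subset by blast
    have sB: "forms t \<subseteq> poly_vs.span B"
      using sp poly_vs.span_mono[OF B(3)] by (auto simp: poly_vs.span_span)
    have "C \<union> ?R \<subseteq> forms t" using C(1) spanR poly_vs.span_superset[of ?R] by auto
    then have cB: "card B = (t + 3 choose 3)"
      using poly_vs.basis_card_eq_dim[OF _ sB B(2)] B(1) dim by auto
    have "card B \<le> card (C \<union> ?R)" using B(1) fC fR by (intro card_mono) auto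
    moreover have "card (C \<union> ?R) \<le> card C + card ?R" by (rule card_Un_le)
    moreover have "card C + card ?R \<le> card B" using le cB cC R(1) by simp
    ultimately have eqs: "card B = card (C \<union> ?R)" "card (C \<union> ?R) = card C + card ?R"
      by linarith+
    have "B = C \<union> ?R" using eqs(1) B(1) fC fR by (intro card_subset_eq) auto
    moreover have "C \<inter> ?R = {}"
      using eqs(2) card_Un_Int[OF fC fR] fC fR by simp
    ultimately show ?thesis using B(2) eqs R(1) cB by simp
  qed
  obtain C where C: "C \<subseteq> J \<inter> forms t" "poly_vs.independent C" "J \<inter> forms t \<subseteq> poly_vs.span C"
    using poly_vs.maximal_independent_subset by blast
  show "poly_vs.dim (J \<inter> forms t) + card (red_mons (n - 1) t) = (t + 3 choose 3)"
    using main[OF C] C poly_vs.basis_card_eq_dim[OF C(1,3,2)] by simp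
  show "J \<inter> forms t \<inter> {f. reduced (n - 1) f} = {0}"
  proof (rule ccontr)
    assume "J \<inter> forms t \<inter> {f. reduced (n - 1) f} \<noteq> {0}"
    moreover have "0 \<in> J \<inter> forms t \<inter> {f. reduced (n - 1) f}"
      using isidealD(1)[OF isideal_J] by simp
    ultimately obtain f where f: "f \<in> J \<inter> forms t" "reduced (n - 1) f" "f \<noteq> 0" by blast
    have "poly_vs.independent {f}" using f(3) by simp
    then obtain D where D: "{f} \<subseteq> D" "D \<subseteq> J \<inter> forms t" "poly_vs.independent D"
        "J \<inter> forms t \<subseteq> poly_vs.span D"
      using poly_vs.maximal_independent_subset_extend[of "{f}" "J \<inter> forms t"] f(1) by blast
    have ind: "poly_vs.independent (D \<union> ?R)" and dis: "D \<inter> ?R = {}"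
      using main[OF D(2,3,4)] by auto
    have "f \<in> poly_vs.span ?R" using f spanR by auto
    then have "f \<in> poly_vs.span ((D \<union> ?R) - {f})"
      using dis D(1) poly_vs.span_mono[of ?R "(D \<union> ?R) - {f}"] by blast
    then show False using ind D(1) unfolding poly_vs.dependent_def by blast
  qed
qed

text \<open>
  Multiplication by a power of \<open>x\<^sub>0\<close> moves a homogeneous component into the range of degrees of
  the dimension count, and it preserves reducedness.
\<close>

lemma J_reduced_0:
  assumes f: "f \<in> J" "reduced (n - 1) f"
  shows "f = 0"
proof -
  have "hcomp t f = 0" for t
  proof -
    let ?g = "var 0 ^ n * hcomp t f"
    have pw: "var 0 ^ j \<in> forms j" for j
    proof (induction j)
      case (Suc j)
      then show ?case using forms_mult[of "var 0" 1 "var 0 ^ j" j] by (simp add: forms_single)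
    qed (use forms_const[of 1] in simp)
    have red: "reduced (n - 1) (var 0 ^ j * hcomp t f)" for j
    proof (induction j)
      case (Suc j)
      then show ?case using reduced_var_mult[OF Suc, of 0] by (simp add: mult.assoc)
    qed (use reduced_hcomp[OF f(2)] in simp)
    have "?g \<in> forms (n + t)" by (rule forms_mult[OF pw hcomp_forms])
    moreover have "?g \<in> J" using hcomp_J[OF f(1)] by (rule isidealD(3)[OF isideal_J])
    ultimately have "?g \<in> J \<inter> forms (n + t) \<inter> {f. reduced (n - 1) f}"
      using red[of n] by (intro IntI CollectI)
    then have "?g = 0" unfolding J_reduced_direct(2)[OF le_add1[of n t]] by (rule singletonD)
    then show ?thesis using var_minus_const_neq_0[of 0 0] by simp
  qed
  then show ?thesis using sum_hcomp[of f] by simp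
qed

lemma hilbert_function_J:
  assumes "n \<le> t"
  shows "hilbert_function J t = card (red_mons (n - 1) t)"
  using J_reduced_direct(1)[OF assms] by (simp add: hilbert_function_def dim_forms)

text \<open>
  The quotient is free over \<open>C[x\<^sub>0, x\<^sub>1]\<close>: replace \<open>f\<close> by its reduced representative, which
  remains reduced after multiplication by \<open>x\<^sub>0 - a\<close>.
\<close>

lemma regular_0:
  assumes "(var 0 - const a) * f \<in> J"
  shows "f \<in> J"
proof -
  obtain g where g: "reduced (n - 1) g" "f - g \<in> J" using reduction by blast
  have "(var 0 - const a) * g = (var 0 - const a) * f - (var 0 - const a) * (f - g)"
    by (simp only: right_diff_distrib) simp
  also have "\<dots> \<in> J"
    by (rule isidealD(6)[OF isideal_J assms isidealD(3)[OF isideal_J g(2)]])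
  finally have "(var 0 - const a) * g = 0"
    using reduced_linear_mult[OF g(1)] by (intro J_reduced_0) auto
  then have "g = 0" using var_minus_const_neq_0[of 0 a] by simp
  then show ?thesis using g(2) by simp
qed

text \<open>
  For reduced representatives the relation holds in the polynomial ring itself, where \<open>x\<^sub>0 - a\<close>
  and \<open>x\<^sub>1 - b\<close> are coprime.
\<close>

lemma regular_1:
  assumes "(var 1 - const b) * f - (var 0 - const a) * h \<in> J"
  shows "\<exists>k. f - (var 0 - const a) * k \<in> J"
proof -
  obtain f' where f': "reduced (n - 1) f'" "f - f' \<in> J" using reduction by blast
  obtain h' where h': "reduced (n - 1) h'" "h - h' \<in> J" using reduction by blast
  let ?x = "var 0 - const a" and ?y = "var 1 - const b"
  have "?y * f' - ?x * h' = (?y * f - ?x * h) - ?y * (f - f') + ?x * (h - h')"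
    by (simp only: right_diff_distrib) simp
  also have "\<dots> \<in> J"
    by (rule isidealD(2)[OF isideal_J isidealD(6)[OF isideal_J assms isidealD(3)[OF isideal_J f'(2)]]
        isidealD(3)[OF isideal_J h'(2)]])
  finally have "?y * f' - ?x * h' \<in> J" .
  then have "?y * f' - ?x * h' = 0"
    using reduced_linear_mult[OF f'(1), of 1 b] reduced_linear_mult[OF h'(1), of 0 a]
    by (intro J_reduced_0 reduced_diff) auto
  then obtain k where "f' = ?x * k" using linear_coprime[of b f' a h'] by auto
  then show ?thesis using f'(2) by auto
qed

end

section \<open>Prime ideals below a regular sequence\<close>

definition isprime :: "'a::comm_ring_1 set \<Rightarrow> bool" where
  "isprime P \<longleftrightarrow> isideal P \<and> 1 \<notin> P \<and> (\<forall>a b. a * b \<in> P \<longrightarrow> a \<in> P \<or> b \<in> P)"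

lemma isprime_power:
  assumes "isprime P" "y ^ k \<in> P"
  shows "y \<in> P"
  using assms(2) by (induction k) (use assms(1) in \<open>auto simp: isprime_def\<close>)

lemma isideal_adjoin:
  assumes K: "isideal K"
  shows "isideal {h. \<exists>q\<in>K. \<exists>g. h = q + g * f}" (is "isideal ?K")
  unfolding isideal_def
proof (intro conjI ballI allI)
  show "0 \<in> ?K" using isidealD(1)[OF K] by (auto intro!: bexI[of _ 0] exI[of _ 0])
next
  fix a b assume "a \<in> ?K" "b \<in> ?K"
  then obtain q g q' g' where "q \<in> K" "a = q + g * f" "q' \<in> K" "b = q' + g' * f" by auto
  then have "q + q' \<in> K" "a + b = (q + q') + (g + g') * f"
    using isidealD(2)[OF K] by (auto simp: algebra_simps)
  then show "a + b \<in> ?K" by blast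
next
  fix a x assume "a \<in> ?K"
  then obtain q g where "q \<in> K" "a = q + g * f" by auto
  then have "x * q \<in> K" "x * a = x * q + (x * g) * f"
    using isidealD(3)[OF K] by (auto simp: algebra_simps)
  then show "x * a \<in> ?K" by blast
qed

text \<open>
  Zorn's lemma: an ideal that is maximal among those that contain \<open>I\<close> and miss the
  multiplicative set \<open>S\<close> is prime, since adjoining any further element creates an element of
  \<open>S\<close>.
\<close>

lemma prime_avoiding:
  fixes I :: "'a::comm_ring_1 set"
  assumes I: "isideal I" and S: "1 \<in> S" "\<And>a b. a \<in> S \<Longrightarrow> b \<in> S \<Longrightarrow> a * b \<in> S" and dis: "I \<inter> S = {}"
  shows "\<exists>P. isprime P \<and> I \<subseteq> P \<and> P \<inter> S = {}"
proof -
  let ?A = "{K. isideal K \<and> I \<subseteq> K \<and> K \<inter> S = {}}"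
  have "\<exists>M\<in>?A. \<forall>K\<in>?A. M \<subseteq> K \<longrightarrow> K = M"
  proof (rule subset_Zorn_nonempty)
    show "?A \<noteq> {}" using I dis by blast
  next
    fix C assume C: "C \<noteq> {}" "subset.chain ?A C"
    then have CA: "C \<subseteq> ?A" and ch: "\<And>K L. K \<in> C \<Longrightarrow> L \<in> C \<Longrightarrow> K \<subseteq> L \<or> L \<subseteq> K"
      by (auto simp: subset_chain_def)
    have "isideal (\<Union>C)"
      unfolding isideal_def
    proof (intro conjI ballI allI)
      obtain K where K: "K \<in> C" using C(1) by blast
      then have "0 \<in> K" using CA isidealD(1)[of K] by blast
      then show "0 \<in> \<Union>C" using K by blast
    next
      fix a b assume "a \<in> \<Union>C" "b \<in> \<Union>C"
      then obtain K L where KL: "K \<in> C" "a \<in> K" "L \<in> C" "b \<in> L" by blast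
      then obtain M where "M \<in> C" "a \<in> M" "b \<in> M" using ch[of K L] by blast
      then show "a + b \<in> \<Union>C" using CA isidealD(2)[of M] by blast
    next
      fix a x assume "a \<in> \<Union>C"
      then obtain K where K: "K \<in> C" "a \<in> K" by blast
      then have "x * a \<in> K" using CA isidealD(3)[of K a x] by blast
      then show "x * a \<in> \<Union>C" using K(1) by blast
    qed
    then show "\<Union>C \<in> ?A" using C(1) CA by blast
  qed
  then obtain M where MA: "M \<in> ?A" and max': "\<forall>K\<in>?A. M \<subseteq> K \<longrightarrow> K = M" by (rule bexE)
  from MA have M: "isideal M" "I \<subseteq> M" "M \<inter> S = {}" by simp_all
  have max: "K = M" if "isideal K" "I \<subseteq> K" "K \<inter> S = {}" "M \<subseteq> K" for K
    using max' that by simp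
  have meet: "\<exists>q\<in>M. \<exists>g. q + g * f \<in> S" if "f \<notin> M" for f
  proof (rule ccontr)
    assume no: "\<not> ?thesis"
    let ?K = "{h. \<exists>q\<in>M. \<exists>g. h = q + g * f}"
    have "q \<in> ?K" if "q \<in> M" for q
      using that by (intro CollectI bexI[of _ q] exI[of _ 0]) simp_all
    then have "M \<subseteq> ?K" by blast
    moreover have "f \<in> ?K"
      using isidealD(1)[OF M(1)] by (intro CollectI bexI[of _ 0] exI[of _ 1]) simp_all
    moreover have "?K \<inter> S = {}" using no by blast
    ultimately have "?K = M" using M(2) by (intro max[OF isideal_adjoin[OF M(1)]]) simp_all
    then show False using \<open>f \<in> ?K\<close> that by simp
  qed
  have "isprime M"
    unfolding isprime_def
  proof (intro conjI allI impI)
    show "1 \<notin> M" using M(3) S(1) by blast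
  next
    fix a b assume ab: "a * b \<in> M"
    show "a \<in> M \<or> b \<in> M"
    proof (rule ccontr)
      assume "\<not> (a \<in> M \<or> b \<in> M)"
      then obtain q g q' g' where 1: "q \<in> M" "q + g * a \<in> S" "q' \<in> M" "q' + g' * b \<in> S"
        using meet by metis
      have "(q + g * a) * (q' + g' * b) = (q' + g' * b) * q + (g * a) * q' + (g * g') * (a * b)"
        by (simp add: algebra_simps)
      moreover have "\<dots> \<in> M"
        by (intro isidealD(2)[OF M(1)] isidealD(3)[OF M(1)] 1(1,3) ab)
      ultimately have "(q + g * a) * (q' + g' * b) \<in> M \<inter> S" using S(2)[OF 1(2,4)] by simp
      then show False using M(3) by blast
    qed
  qed (rule M(1))
  then show ?thesis using M by blast
qed

text \<open>
  This is what bounds depth by height. The multiplicative set of all \<open>x\<^sup>k s\<close> with \<open>s\<close> outside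
  \<open>P\<close> misses \<open>I\<close>, because \<open>x\<close> is regular modulo \<open>I\<close>. A prime that avoids it lies inside \<open>P\<close> and
  omits \<open>x\<close>.
\<close>

lemma prime_below_regular:
  assumes I: "isideal I" and P: "isprime P" "I \<subseteq> P" and x: "x \<in> P" "\<And>a. a * x \<in> I \<Longrightarrow> a \<in> I"
  shows "\<exists>P'. isprime P' \<and> I \<subseteq> P' \<and> P' \<subset> P"
proof -
  define S where "S = {x ^ k * s | k s. s \<notin> P}"
  have "1 \<in> S" unfolding S_def using P(1) by (intro CollectI exI[of _ 0] exI[of _ 1]) (auto simp: isprime_def)
  moreover have "a * b \<in> S" if aS: "a \<in> S" and bS: "b \<in> S" for a b
  proof -
    obtain k s where 1: "a = x ^ k * s" "s \<notin> P" using aS unfolding S_def by blast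
    obtain l u where 2: "b = x ^ l * u" "u \<notin> P" using bS unfolding S_def by blast
    from 1 2 have "a * b = x ^ (k + l) * (s * u)" "s * u \<notin> P"
      using P(1) by (auto simp: power_add isprime_def ac_simps)
    then show ?thesis unfolding S_def by blast
  qed
  moreover have "I \<inter> S = {}"
  proof (rule ccontr)
    assume "I \<inter> S \<noteq> {}"
    then obtain k s where ks: "x ^ k * s \<in> I" "s \<notin> P" unfolding S_def by blast
    have "x ^ k * s \<in> I \<Longrightarrow> s \<in> I"
    proof (induction k)
      case (Suc k)
      have "(x ^ k * s) * x \<in> I" using Suc.prems by (simp add: ac_simps)
      then show ?case using x(2) Suc.IH by blast
    qed simp
    then show False using ks P(2) by blast
  qed
  ultimately obtain P' where P': "isprime P'" "I \<subseteq> P'" "P' \<inter> S = {}"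
    using prime_avoiding[OF I, of S] by blast
  have "a \<in> P" if "a \<in> P'" for a
  proof (rule ccontr)
    assume "a \<notin> P"
    then have "a \<in> S" unfolding S_def by (intro CollectI exI[of _ 0] exI[of _ a]) simp
    then show False using that P'(3) by blast
  qed
  moreover have "x \<notin> P'"
  proof -
    have "x \<in> S" unfolding S_def using P(1)
      by (intro CollectI exI[of _ 1] exI[of _ 1]) (auto simp: isprime_def)
    then show ?thesis using P'(3) by blast
  qed
  ultimately show ?thesis using P' x(1) by blast
qed

lemma prime_chain_below_regular:
  assumes "\<And>i. i \<le> k \<Longrightarrow> isideal (I i)" "\<And>i. i < k \<Longrightarrow> I i \<subseteq> I (Suc i)"
    "\<And>i. i < k \<Longrightarrow> x i \<in> I (Suc i)" "\<And>i a. i < k \<Longrightarrow> a * x i \<in> I i \<Longrightarrow> a \<in> I i"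
    "isprime P" "I k \<subseteq> P"
  shows "\<exists>p. (\<forall>i\<le>k. isprime (p i) \<and> I 0 \<subseteq> p i) \<and> (\<forall>i<k. p i \<subset> p (Suc i)) \<and> p k = P"
  using assms
proof (induction k arbitrary: P)
  case 0
  then show ?case by (intro exI[of _ "\<lambda>_. P"]) auto
next
  case (Suc k)
  have Ik: "I k \<subseteq> P" using Suc.prems(2)[of k] Suc.prems(6) by auto
  have xk: "x k \<in> P" using Suc.prems(3)[of k] Suc.prems(6) by auto
  have isI: "isideal (I k)" using Suc.prems(1)[of k] by simp
  have "\<exists>P'. isprime P' \<and> I k \<subseteq> P' \<and> P' \<subset> P"
    by (rule prime_below_regular[OF isI Suc.prems(5) Ik xk]) (use Suc.prems(4)[of k] in simp)
  then obtain P' where P': "isprime P'" "I k \<subseteq> P'" "P' \<subset> P" by blast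
  have "\<exists>p. (\<forall>i\<le>k. isprime (p i) \<and> I 0 \<subseteq> p i) \<and> (\<forall>i<k. p i \<subset> p (Suc i)) \<and> p k = P'"
  proof (rule Suc.IH)
    fix i assume "i \<le> k" then show "isideal (I i)" using Suc.prems(1)[of i] by simp
  next
    fix i assume i: "i < k"
    show "I i \<subseteq> I (Suc i)" "x i \<in> I (Suc i)" using Suc.prems(2,3)[of i] i by simp_all
    fix a assume "a * x i \<in> I i" then show "a \<in> I i" using Suc.prems(4)[of i a] i by simp
  qed (use P' in simp_all)
  then obtain p where p: "\<forall>i\<le>k. isprime (p i) \<and> I 0 \<subseteq> p i" "\<forall>i<k. p i \<subset> p (Suc i)" "p k = P'"
    by blast
  have "I 0 \<subseteq> P" using p(1,3) P'(3) by auto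
  then show ?case
    using p P' Suc.prems(5)
    by (intro exI[of _ "p(Suc k := P)"]) (auto simp: le_Suc_eq less_Suc_eq)
qed

section \<open>Hilbert's basis theorem\<close>

text \<open>A monotone subsequence exists, and natural numbers cannot decrease forever.\<close>

lemma nat_nondecreasing_subseq:
  fixes s :: "nat \<Rightarrow> nat"
  shows "\<exists>f :: nat \<Rightarrow> nat. strict_mono f \<and> (\<forall>i j. i \<le> j \<longrightarrow> s (f i) \<le> s (f j))"
proof -
  obtain f where f: "strict_mono f" "monoseq (\<lambda>k. s (f k))" using seq_monosub[of s] by blast
  show ?thesis
  proof (cases "incseq (\<lambda>k. s (f k))")
    case True
    then have "\<forall>i j. i \<le> j \<longrightarrow> s (f i) \<le> s (f j)" by (simp add: incseq_def)
    then show ?thesis using f(1) by blast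
  next
    case False
    then have dec: "decseq (\<lambda>k. s (f k))" using f(2) by (simp add: monoseq_iff)
    define m where "m = (LEAST v. \<exists>k. v = s (f k))"
    have "\<exists>k. m = s (f k)" unfolding m_def by (rule LeastI_ex) blast
    then obtain k where k: "m = s (f k)" by blast
    have "s (f (k + i)) = m" for i
    proof (rule antisym)
      show "s (f (k + i)) \<le> m" using dec k by (simp add: decseq_def)
      show "m \<le> s (f (k + i))" unfolding m_def by (rule Least_le) blast
    qed
    then have "\<forall>i j. i \<le> j \<longrightarrow> s (f (k + i)) \<le> s (f (k + j))" by simp
    moreover have "strict_mono (\<lambda>i. f (k + i))" using f(1) by (simp add: strict_mono_def)
    ultimately show ?thesis by blast
  qed
qed

text \<open>
  Pass successively to subsequences along which each of the four exponents is nondecreasing.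
\<close>

lemma dickson:
  fixes s :: "nat \<Rightarrow> mon4"
  shows "\<exists>i j e. i < j \<and> s j = s i + e"
proof -
  have step: "\<exists>f :: nat \<Rightarrow> nat. strict_mono f \<and> (\<forall>i j. i \<le> j \<longrightarrow> lk (s (g (f i))) k \<le> lk (s (g (f j))) k)" for g :: "nat \<Rightarrow> nat" and k
    using nat_nondecreasing_subseq[of "\<lambda>i. lk (s (g i)) k"] by simp
  obtain f0 :: "nat \<Rightarrow> nat" where "strict_mono f0 \<and> (\<forall>i j. i \<le> j \<longrightarrow> lk (s (f0 i)) 0 \<le> lk (s (f0 j)) 0)"
    using step[of "\<lambda>x. x" 0] by (rule exE)
  then have f0: "strict_mono f0" "\<And>i j. i \<le> j \<Longrightarrow> lk (s (f0 i)) 0 \<le> lk (s (f0 j)) 0" by simp_all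
  obtain f1 :: "nat \<Rightarrow> nat" where "strict_mono f1 \<and>
      (\<forall>i j. i \<le> j \<longrightarrow> lk (s (f0 (f1 i))) 1 \<le> lk (s (f0 (f1 j))) 1)"
    using step[of f0 1] by (rule exE)
  then have f1: "strict_mono f1" "\<And>i j. i \<le> j \<Longrightarrow> lk (s (f0 (f1 i))) 1 \<le> lk (s (f0 (f1 j))) 1"
    by simp_all
  obtain f2 :: "nat \<Rightarrow> nat" where "strict_mono f2 \<and>
      (\<forall>i j. i \<le> j \<longrightarrow> lk (s (f0 (f1 (f2 i)))) 2 \<le> lk (s (f0 (f1 (f2 j)))) 2)"
    using step[of "\<lambda>i. f0 (f1 i)" 2] by (rule exE)
  then have f2: "strict_mono f2"
    "\<And>i j. i \<le> j \<Longrightarrow> lk (s (f0 (f1 (f2 i)))) 2 \<le> lk (s (f0 (f1 (f2 j)))) 2" by simp_all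
  obtain f3 :: "nat \<Rightarrow> nat" where "strict_mono f3 \<and>
      (\<forall>i j. i \<le> j \<longrightarrow> lk (s (f0 (f1 (f2 (f3 i))))) 3 \<le> lk (s (f0 (f1 (f2 (f3 j))))) 3)"
    using step[of "\<lambda>i. f0 (f1 (f2 i))" 3] by (rule exE)
  then have f3: "strict_mono f3"
    "\<And>i j. i \<le> j \<Longrightarrow> lk (s (f0 (f1 (f2 (f3 i))))) 3 \<le> lk (s (f0 (f1 (f2 (f3 j))))) 3" by simp_all
  define a where "a = f3 0"
  define b where "b = f3 1"
  have ab: "a < b" using f3(1) by (simp add: a_def b_def strict_mono_def)
  have 2: "f2 a < f2 b" using ab f2(1) by (simp add: strict_mono_def)
  have 1: "f1 (f2 a) < f1 (f2 b)" using 2 f1(1) by (simp add: strict_mono_def)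
  let ?i = "f0 (f1 (f2 a))" and ?j = "f0 (f1 (f2 b))"
  have 0: "?i < ?j" using 1 f0(1) by (simp add: strict_mono_def)
  have "lk (s ?i) k \<le> lk (s ?j) k" for k
    using forall_4[of "\<lambda>k. lk (s ?i) k \<le> lk (s ?j) k"] f0(2)[of "f1 (f2 a)" "f1 (f2 b)"] f1(2)[of "f2 a" "f2 b"]
      f2(2)[of a b] f3(2)[of 0 1] ab 1 2 by (auto simp: a_def b_def)
  then have "s ?j = s ?i + (s ?j - s ?i)"
    by (intro poly_mapping_eqI) (simp add: lookup_add lookup_minus)
  then show ?thesis using 0 by blast
qed

lemma mon4_zero_le: "(0 :: mon4) \<le> m"
proof (cases "m = 0")
  case False
  then have ne: "ks m \<noteq> {}" by simp
  define k where "k = Min (ks m)"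
  have k: "k \<in> ks m" "\<And>j. j < k \<Longrightarrow> j \<notin> ks m"
    using ne by (auto simp: k_def)
  have "less_fun (lk 0) (lk m)"
    unfolding less_fun_def using k by (intro exI[of _ k]) (auto simp: in_keys_iff)
  then show ?thesis by (simp add: less_eq_poly_mapping.rep_eq)
qed simp

lemma wf_mon4: "wf {(m :: mon4, m'). m < m'}"
  unfolding wf_iff_no_infinite_down_chain
proof
  assume "\<exists>f. \<forall>i. (f (Suc i), f i) \<in> {(m :: mon4, m'). m < m'}"
  then obtain f :: "nat \<Rightarrow> mon4" where f: "\<And>i. f (Suc i) < f i" by auto
  obtain i j e where ij: "i < j" "f j = f i + e" using dickson[of f] by blast
  have "f i \<le> f j" using ij(2) mon4_zero_le[of e] by (simp add: add_increasing2)
  moreover have "f j < f i" using ij(1)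
  proof (induction j)
    case (Suc j)
    then show ?case using f[of j] by (cases "i = j") (auto simp: less_Suc_eq intro: less_trans)
  next
    case 0
    then show ?case by simp
  qed
  ultimately show False by simp
qed

text \<open>
  The monomial order is the one of the type of finitely supported maps. It is a compatible
  linear order, and Dickson's lemma makes it a well-order.
\<close>

definition lmon :: "poly4 \<Rightarrow> mon4" where "lmon f = Max (ks f)"

lemma lmon_in: "f \<noteq> 0 \<Longrightarrow> lmon f \<in> ks f"
  unfolding lmon_def by (rule Max_in) auto

lemma lmon_ge: "m \<in> ks f \<Longrightarrow> m \<le> lmon f"
  unfolding lmon_def by (rule Max_ge) auto

lemma lk_single_mult: "lk (sg e c * f) (e + m) = c * lk f (m :: mon4)"
proof -
  have "sg e c * f = (\<Sum>k\<in>ks f. sg (e + k) (c * lk f k))"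
    by (subst sum_singles[of f]) (simp add: sum_distrib_left mult_single)
  then have "lk (sg e c * f) (e + m) = (\<Sum>k\<in>ks f. if k = m then c * lk f k else 0)"
    by (auto simp: lookup_sum lookup_single when_def intro!: sum.cong)
  then show ?thesis by (simp add: sum.delta in_keys_iff)
qed

lemma lead_cancel:
  assumes f: "f \<noteq> 0" and g: "g \<noteq> 0" and e: "lmon f = lmon g + e"
  shows "\<exists>c. f = sg e c * g \<or> lmon (f - sg e c * g) < lmon f"
proof -
  define c where "c = lk f (lmon f) / lk g (lmon g)"
  have nz: "lk g (lmon g) \<noteq> 0" using lmon_in[OF g] by (simp add: in_keys_iff)
  let ?h = "f - sg e c * g"
  have "lmon ?h < lmon f" if "?h \<noteq> 0"
  proof -
    have m: "lmon ?h \<in> ks ?h" using lmon_in[OF that] .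
    have le: "lmon ?h \<le> lmon f"
    proof -
      have "lmon ?h \<in> ks f \<or> lmon ?h \<in> ks (sg e c * g)" using m by (auto simp: in_keys_iff lookup_minus)
      then show ?thesis
      proof
        assume "lmon ?h \<in> ks (sg e c * g)"
        then obtain k where "lmon ?h = e + k" "k \<in> ks g"
          using Poly_Mapping.keys_mult[of "sg e c" g] by (auto split: if_splits)
        then show ?thesis using e lmon_ge[of k g] by (simp add: add.commute add_left_mono)
      qed (rule lmon_ge)
    qed
    have "lk ?h (lmon f) = 0"
      using nz lk_single_mult[of e c g "lmon g"] by (simp add: lookup_minus c_def e add.commute)
    then have "lmon ?h \<noteq> lmon f" using m by (auto simp: in_keys_iff)
    then show ?thesis using le by simp
  qed
  then show ?thesis by (intro exI[of _ c]) auto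
qed

definition gen_ideal :: "'a::comm_ring_1 set \<Rightarrow> 'a set" where
  "gen_ideal F = \<Inter>{I. isideal I \<and> F \<subseteq> I}"

lemma isideal_gen: "isideal (gen_ideal F)"
  unfolding isideal_def gen_ideal_def by (auto simp: isidealD)

lemma gen_ideal_self: "F \<subseteq> gen_ideal F"
  by (auto simp: gen_ideal_def)

lemma gen_ideal_minimal: "isideal I \<Longrightarrow> F \<subseteq> I \<Longrightarrow> gen_ideal F \<subseteq> I"
  by (auto simp: gen_ideal_def)

text \<open>
  Otherwise choose successively elements outside the ideal generated so far with the smallest
  possible leading monomial.  By Dickson's lemma some leading monomial divides a later one, and
  subtracting a multiple of the earlier element makes the later leading monomial smaller.
\<close>

lemma hilbert_basis:
  fixes I :: "poly4 set"
  assumes I: "isideal I"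
  shows "\<exists>F. finite F \<and> F \<subseteq> I \<and> gen_ideal F = I"
proof (rule ccontr)
  assume no: "\<not> ?thesis"
  have "\<exists>f. f \<in> I - gen_ideal F \<and> (\<forall>g\<in>I - gen_ideal F. \<not> lmon g < lmon f)"
    if F: "finite F" "F \<subseteq> I" for F
  proof -
    have "I - gen_ideal F \<noteq> {}" using no F gen_ideal_minimal[OF I F(2)] by blast
    then obtain m where m: "m \<in> lmon ` (I - gen_ideal F)"
      "\<And>k. (k, m) \<in> {(m, m'). m < m'} \<Longrightarrow> k \<notin> lmon ` (I - gen_ideal F)"
      using wfE_min[OF wf_mon4] by (metis equals0I image_is_empty)
    then show ?thesis by fastforce
  qed
  then obtain pick where pick: "\<And>F. finite F \<Longrightarrow> F \<subseteq> I \<Longrightarrow> pick F \<in> I - gen_ideal F"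
    "\<And>F g. finite F \<Longrightarrow> F \<subseteq> I \<Longrightarrow> g \<in> I - gen_ideal F \<Longrightarrow> \<not> lmon g < lmon (pick F)"
    by metis
  define F where "F = rec_nat {} (\<lambda>_ F. insert (pick F) F)"
  have F: "finite (F k) \<and> F k \<subseteq> I" for k
    by (induction k) (use pick(1) in \<open>auto simp: F_def\<close>)
  define f where "f k = pick (F k)" for k
  have FSuc: "F (Suc k) = insert (f k) (F k)" for k by (simp add: F_def f_def)
  have in_later: "f i \<in> F j" if "i < j" for i j
    using that by (induction j) (auto simp: FSuc less_Suc_eq)
  have fI: "f k \<in> I - gen_ideal (F k)" for k using pick(1)[of "F k"] F[of k] by (auto simp: f_def)
  have nz: "f k \<noteq> 0" for k using fI[of k] isidealD(1)[OF isideal_gen, of "F k"] by (metis DiffD2)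
  obtain i j e where ij: "i < j" "lmon (f j) = lmon (f i) + e"
    using dickson[of "\<lambda>k. lmon (f k)"] by blast
  obtain c where c: "f j = sg e c * f i \<or> lmon (f j - sg e c * f i) < lmon (f j)"
    using lead_cancel[OF nz nz ij(2)] by blast
  have mem: "sg e c * f i \<in> gen_ideal (F j)"
    using in_later[OF ij(1)] gen_ideal_self by (intro isidealD(3)[OF isideal_gen]) blast
  have "f j - sg e c * f i \<notin> gen_ideal (F j)"
  proof
    assume "f j - sg e c * f i \<in> gen_ideal (F j)"
    then have "(f j - sg e c * f i) + sg e c * f i \<in> gen_ideal (F j)"
      using mem by (rule isidealD(2)[OF isideal_gen])
    then show False using fI[of j] by simp
  qed
  moreover have "f j - sg e c * f i \<in> I"
    using fI[of i] fI[of j] by (intro isidealD(6)[OF I] isidealD(3)[OF I]) auto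
  ultimately have "\<not> lmon (f j - sg e c * f i) < lmon (f j)"
    using pick(2)[of "F j"] F[of j] by (auto simp: f_def)
  then have "f j = sg e c * f i" using c by simp
  then show False using mem fI[of j] by simp
qed

section \<open>A weak Nullstellensatz\<close>

text \<open>
  Substitution of the ring element \<open>x\<close> for the variable of a univariate polynomial, by Horner's
  scheme.
\<close>

definition poly_at :: "poly4 \<Rightarrow> complex poly \<Rightarrow> poly4" where
  "poly_at x p = fold_coeffs (\<lambda>c h. const c + x * h) p 0"

lemma poly_at_0 [simp]: "poly_at x 0 = 0"
  by (simp add: poly_at_def)

lemma poly_at_pCons [simp]: "poly_at x (pCons c p) = const c + x * poly_at x p"
  unfolding poly_at_def by (cases "c = 0 \<and> p = 0") (auto simp: fold_coeffs_pCons_eq)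

lemma poly_at_add: "poly_at x (p + q) = poly_at x p + poly_at x q"
  by (induction p q rule: poly_induct2) (simp_all add: const_add algebra_simps)

lemma poly_at_smult: "poly_at x (Polynomial.smult c p) = const c * poly_at x p"
  by (induction p) (simp_all add: const_mult algebra_simps)

lemma poly_at_sum: "poly_at x (sum f A) = (\<Sum>a\<in>A. poly_at x (f a))"
  by (induction A rule: infinite_finite_induct) (simp_all add: poly_at_add)

lemma const_uminus: "const (- c) = - const c"
  by (simp add: const_def single_uminus)

lemma poly_at_linear_mult: "poly_at x ([:- b, 1:] * p) = (x - const b) * poly_at x p"
proof -
  have "[:- b, 1:] * p = pCons 0 p + Polynomial.smult (- b) p" by simp
  then show ?thesis
    by (simp only: poly_at_add poly_at_smult const_uminus poly_at_pCons const_0) (simp add: algebra_simps)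
qed

lemma poly_at_prod: "finite S \<Longrightarrow> poly_at x (\<Prod>b\<in>S. [:- b, 1:]) = (\<Prod>b\<in>S. x - const b)"
proof (induction S rule: finite_induct)
  case empty
  show ?case by (simp add: one_pCons)
next
  case (insert b S)
  show ?case
    unfolding prod.insert[OF insert(1,2)] poly_at_linear_mult insert(3) ..
qed

text \<open>
  A univariate complex polynomial splits into linear factors, and a prime ideal contains one of
  them.
\<close>

lemma poly_at_in_prime:
  assumes P: "isprime P" and p: "p \<noteq> 0" "poly_at x p \<in> P"
  shows "\<exists>b. x - const b \<in> P"
  using p
proof (induction "degree p" arbitrary: p rule: less_induct)
  case less
  show ?case
  proof (cases "degree p = 0")
    case True
    then obtain c where c: "p = [:c:]" "c \<noteq> 0" using less.prems(1) by (metis degree_eq_zeroE pCons_0_0)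
    then have "const (1 / c) * const c \<in> P" using less.prems(2) P isidealD(3)[of P] by (simp add: isprime_def)
    then show ?thesis using c P by (simp add: isprime_def flip: const_mult)
  next
    case False
    then obtain b where b: "poly p b = 0"
      using fundamental_theorem_of_algebra[of p] by (auto simp: constant_degree)
    then obtain q where q: "p = [:- b, 1:] * q" by (auto simp: poly_eq_0_iff_dvd elim: dvdE)
    then have "q \<noteq> 0" using less.prems(1) by auto
    then have d: "degree q < degree p" unfolding q by (subst degree_mult_eq) auto
    have "x - const b \<in> P \<or> poly_at x q \<in> P"
      using less.prems(2) P unfolding q poly_at_linear_mult by (simp add: isprime_def)
    then show ?thesis using less.hyps[OF d \<open>q \<noteq> 0\<close>] by blast
  qed
qed

text \<open>
  If no \<open>x - a\<close> lies in the maximal ideal \<open>P\<close>, then all of them are invertible modulo \<open>P\<close>. There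
  are uncountably many inverses, so infinitely many of them have representatives of bounded
  degree, and these are linearly dependent. A linear relation becomes, after clearing
  denominators, a nonzero polynomial in \<open>x\<close> that lies in \<open>P\<close>.
\<close>

lemma nullstellensatz:
  fixes x :: poly4
  assumes P: "isprime P" and max: "\<And>f. f \<notin> P \<Longrightarrow> \<exists>g. f * g - 1 \<in> P"
  shows "\<exists>a. x - const a \<in> P"
proof (rule ccontr)
  assume no: "\<nexists>a. x - const a \<in> P"
  have I: "isideal P" using P by (simp add: isprime_def)
  have "\<forall>a. \<exists>g. (x - const a) * g - 1 \<in> P" using no max by blast
  then obtain g where g: "\<And>a. (x - const a) * g a - 1 \<in> P" by metis
  define U where "U D = {a. \<forall>m\<in>ks (g a). mdeg m \<le> D}" for D
  have "\<exists>D. infinite (U D)"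
  proof (rule ccontr)
    assume "\<nexists>D. infinite (U D)"
    then have "countable (\<Union>D. U D)" by (auto intro: countable_finite)
    moreover have "(\<Union>D. U D) = UNIV"
    proof -
      have "a \<in> U (Max (mdeg ` ks (g a)))" for a by (auto simp: U_def)
      then show ?thesis by blast
    qed
    ultimately have "countable (UNIV :: complex set)" by simp
    then have "countable (Re ` (UNIV :: complex set))" by (rule countable_image)
    moreover have "Re ` UNIV = UNIV" by (metis Re_complex_of_real surj_def)
    ultimately show False using uncountable_UNIV_real by simp
  qed
  then obtain D where D: "infinite (U D)" by blast
  define M where "M = (\<Union>t\<le>D. {m :: mon4. mdeg m = t})"
  have fM: "finite M" by (simp add: M_def finite_mdeg)
  obtain S where S: "S \<subseteq> U D" "finite S" "card S = Suc (card M)"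
    using infinite_arbitrarily_large[OF D] by blast
  let ?W = "(\<lambda>m. sg m (1::complex)) ` M"
  have "g a \<in> poly_vs.span ?W" if "a \<in> S" for a
    using that S(1) unfolding single_basis(3)[OF fM] by (auto simp: U_def M_def)
  then obtain c where c: "(\<Sum>a\<in>S. const (c a) * g a) = 0" "\<exists>a\<in>S. c a \<noteq> 0"
    using poly_vs.dependent_family[of S ?W g] fM S single_basis(1)[OF fM] by auto
  \<comment> \<open>The numerator of \<open>\<Sum>a\<in>S. c a / (x - a)\<close>.\<close>
  define q where "q = (\<Sum>a\<in>S. Polynomial.smult (c a) (\<Prod>b\<in>S - {a}. [:- b, 1:]))"
  have "(\<Prod>b\<in>S. x - const b) * g a - (\<Prod>b\<in>S - {a}. x - const b) \<in> P" if "a \<in> S" for a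
  proof -
    have "(\<Prod>b\<in>S. x - const b) * g a - (\<Prod>b\<in>S - {a}. x - const b)
      = (\<Prod>b\<in>S - {a}. x - const b) * ((x - const a) * g a - 1)"
      unfolding prod.remove[OF S(2) that] by (simp add: algebra_simps)
    then show ?thesis using isidealD(3)[OF I g] by simp
  qed
  then have "(\<Sum>a\<in>S. const (c a) * ((\<Prod>b\<in>S. x - const b) * g a - (\<Prod>b\<in>S - {a}. x - const b))) \<in> P"
    by (intro isideal_sum[OF I] isidealD(3)[OF I])
  also have "(\<Sum>a\<in>S. const (c a) * ((\<Prod>b\<in>S. x - const b) * g a - (\<Prod>b\<in>S - {a}. x - const b)))
    = (\<Prod>b\<in>S. x - const b) * (\<Sum>a\<in>S. const (c a) * g a) - poly_at x q"
    using S(2) by (simp add: q_def poly_at_sum poly_at_smult poly_at_prod right_diff_distrib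
        sum_subtractf sum_distrib_left mult.left_commute)
  finally have "poly_at x q \<in> P" using isidealD(5)[OF I, of "- poly_at x q"] by (simp add: c(1))
  moreover have "q \<noteq> 0"
  proof -
    obtain a where a: "a \<in> S" "c a \<noteq> 0" using c(2) by blast
    have "poly q a = (\<Sum>a'\<in>S. if a' = a then c a * (\<Prod>b\<in>S - {a}. a - b) else 0)"
      unfolding q_def poly_sum poly_smult poly_prod
    proof (intro sum.cong refl)
      fix a' assume "a' \<in> S"
      show "c a' * (\<Prod>b\<in>S - {a'}. poly [:- b, 1:] a) = (if a' = a then c a * (\<Prod>b\<in>S - {a}. a - b) else 0)"
        using S(2) a(1) by (auto simp: prod_zero_iff)
    qed
    also have "\<dots> = c a * (\<Prod>b\<in>S - {a}. a - b)" using a(1) S(2) by simp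
    also have "\<dots> \<noteq> 0" using a(2) S(2) by (auto simp: prod_zero_iff)
    finally show ?thesis by auto
  qed
  ultimately show False using poly_at_in_prime[OF P] no by blast
qed

section \<open>Quotient rings of the polynomial ring\<close>

abbreviation cls :: "poly4 set \<Rightarrow> poly4 \<Rightarrow> poly4 set" where
  "cls J f \<equiv> J +>\<^bsub>PR\<^esub> f"

definition preim :: "poly4 set \<Rightarrow> poly4 set set \<Rightarrow> poly4 set" where
  "preim J p = {f. cls J f \<in> p}"

text \<open>
  Ideals of the quotient are handled through their preimages in the polynomial ring, which are
  plain subsets of a type instead of sets of cosets.
\<close>

locale quotient_by =
  fixes J :: "poly4 set"
  assumes isideal: "isideal J"
begin

abbreviation Q :: "poly4 set ring" where "Q \<equiv> coordinate_ring J"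

lemma PR_cring: "cring PR" by (rule cring_from_type_algebra)

lemma PR_ring: "ring PR" by (rule ring_from_type_algebra)

lemma ideal_J: "ideal J PR" using isideal by (simp add: ideal_isideal)

lemma Q_cring: "cring Q" by (rule ideal.quotient_is_cring[OF ideal_J PR_cring])

lemma Q_ring: "ring Q" by (rule ideal.quotient_is_ring[OF ideal_J])

lemma cls_hom: "ring_hom_ring PR Q (cls J)" by (rule ideal.rcos_ring_hom_ring[OF ideal_J])

lemma Q_carrier: "carrier Q = range (cls J)"
  by (auto simp: FactRing_def A_RCOSETS_def' image_def)

lemma cls_carrier [simp]: "cls J f \<in> carrier Q" by (simp add: Q_carrier)

lemma cls_mult: "cls J f \<otimes>\<^bsub>Q\<^esub> cls J g = cls J (f * g)"
  using ring_hom_mult[OF ideal.rcos_ring_hom[OF ideal_J], of f g] by simp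

lemma cls_one: "\<one>\<^bsub>Q\<^esub> = cls J 1"
  using ring_hom_one[OF ideal.rcos_ring_hom[OF ideal_J]] by simp

lemma cls_eq: "cls J f = cls J g \<longleftrightarrow> f - g \<in> J"
  using ring.quotient_eq_iff_same_a_r_cos[OF PR_ring ideal_J, of f g]
  by (simp add: a_minus_def PR_a_inv)

lemma cls_zero: "\<zero>\<^bsub>Q\<^esub> = cls J 0"
  using ring.a_rcos_zero[OF PR_ring ideal_J isidealD(1)[OF isideal]] by (simp add: FactRing_def)

lemma Q_carrierE:
  assumes "x \<in> carrier Q"
  obtains f where "x = cls J f"
  using assms by (auto simp: Q_carrier)

lemma preim_isideal: "ideal p Q \<Longrightarrow> isideal (preim J p)"
  using ring_hom_ring.ideal_vimage[OF cls_hom, of p] by (simp add: ideal_isideal preim_def)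

lemma J_le_preim:
  assumes p: "ideal p Q"
  shows "J \<subseteq> preim J p"
proof
  fix f assume "f \<in> J"
  then have "cls J f = \<zero>\<^bsub>Q\<^esub>" unfolding cls_zero cls_eq by simp
  then show "f \<in> preim J p"
    using additive_subgroup.zero_closed[OF ideal.axioms(1)[OF p]] by (simp add: preim_def)
qed

lemma image_preim:
  assumes "p \<subseteq> carrier Q"
  shows "cls J ` preim J p = p"
  using assms by (fastforce simp: preim_def Q_carrier)

lemma image_ideal: "isideal K \<Longrightarrow> ideal (cls J ` K) Q"
  using ring.ring_ideal_imp_quot_ideal[OF PR_ring ideal_J, of K] by (simp add: ideal_isideal)

lemma preim_image:
  assumes K: "isideal K" "J \<subseteq> K"
  shows "preim J (cls J ` K) = K"
proof
  show "preim J (cls J ` K) \<subseteq> K"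
  proof
    fix f assume "f \<in> preim J (cls J ` K)"
    then obtain g where g: "g \<in> K" "f - g \<in> J" by (auto simp: preim_def cls_eq)
    then have "(f - g) + g \<in> K" using K by (intro isidealD(2)[OF K(1)]) auto
    then show "f \<in> K" by simp
  qed
qed (auto simp: preim_def)

lemma preim_prime:
  assumes p: "primeideal p Q"
  shows "isprime (preim J p)"
  unfolding isprime_def
proof (intro conjI allI impI)
  interpret primeideal p Q by (rule p)
  show "isideal (preim J p)" by (rule preim_isideal) (rule is_ideal)
  show "1 \<notin> preim J p"
    using one_imp_carrier I_notcarr by (auto simp: preim_def cls_one)
  fix a b assume "a * b \<in> preim J p"
  then have "cls J a \<otimes>\<^bsub>Q\<^esub> cls J b \<in> p" by (simp add: preim_def cls_mult)
  then show "a \<in> preim J p \<or> b \<in> preim J p"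
    using I_prime[of "cls J a" "cls J b"] by (simp add: preim_def)
qed

lemma image_prime:
  assumes K: "isprime K" "J \<subseteq> K"
  shows "primeideal (cls J ` K) Q"
proof (rule primeidealI)
  have I: "isideal K" using K(1) by (simp add: isprime_def)
  show "ideal (cls J ` K) Q" by (rule image_ideal[OF I])
  show "cring Q" by (rule Q_cring)
  have mem: "cls J f \<in> cls J ` K \<longleftrightarrow> f \<in> K" for f
    using preim_image[OF I K(2)] by (auto simp: preim_def)
  show "carrier Q \<noteq> cls J ` K" using mem[of 1] K(1) cls_carrier[of 1] unfolding isprime_def by metis
  fix a b assume a: "a \<in> carrier Q" and b: "b \<in> carrier Q" and ab: "a \<otimes>\<^bsub>Q\<^esub> b \<in> cls J ` K"
  obtain f where f: "a = cls J f" using a by (rule Q_carrierE)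
  obtain g where g: "b = cls J g" using b by (rule Q_carrierE)
  show "a \<in> cls J ` K \<or> b \<in> cls J ` K"
    using ab K(1) unfolding f g cls_mult mem by (auto simp: isprime_def)
qed

lemma ideal_carrier: "ideal p Q \<Longrightarrow> p \<subseteq> carrier Q"
  by (rule additive_subgroup.a_subset[OF ideal.axioms(1)])

lemma preim_strict:
  assumes "ideal p Q" "ideal q Q" "p \<subset> q"
  shows "preim J p \<subset> preim J q"
proof -
  have "preim J p \<subseteq> preim J q" using assms(3) by (auto simp: preim_def)
  moreover have "preim J p \<noteq> preim J q"
    using assms(3) image_preim[OF ideal_carrier[OF assms(1)]] image_preim[OF ideal_carrier[OF assms(2)]]
    by (metis psubset_eq)
  ultimately show ?thesis by (rule psubsetI)
qed

lemma Q_noetherian: "noetherian_ring Q"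
proof (intro noetherian_ring.intro noetherian_ring_axioms.intro)
  show "ring Q" by (rule Q_ring)
  fix p assume p: "ideal p Q"
  obtain F where F: "finite F" "F \<subseteq> preim J p" "gen_ideal F = preim J p"
    using hilbert_basis[OF preim_isideal[OF p]] by blast
  have FC: "cls J ` F \<subseteq> carrier Q" by auto
  have G: "ideal (genideal Q (cls J ` F)) Q" by (rule ring.genideal_ideal[OF Q_ring FC])
  have "p = genideal Q (cls J ` F)"
  proof
    show "genideal Q (cls J ` F) \<subseteq> p"
      using F(2) by (intro ring.genideal_minimal[OF Q_ring p]) (auto simp: preim_def)
    have "F \<subseteq> preim J (genideal Q (cls J ` F))"
      using ring.genideal_self[OF Q_ring FC] by (auto simp: preim_def)
    then have "preim J p \<subseteq> preim J (genideal Q (cls J ` F))"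
      unfolding F(3)[symmetric] by (intro gen_ideal_minimal preim_isideal[OF G])
    then have "cls J ` preim J p \<subseteq> cls J ` preim J (genideal Q (cls J ` F))" by (rule image_mono)
    then show "p \<subseteq> genideal Q (cls J ` F)"
      unfolding image_preim[OF ideal_carrier[OF p]] image_preim[OF ideal_carrier[OF G]] .
  qed
  then show "\<exists>S\<subseteq>carrier Q. finite S \<and> p = genideal Q S" using F(1) FC by blast
qed

text \<open>An element outside the maximal ideal generates the unit ideal together with it.\<close>

lemma maximal_preim:
  assumes p: "maximalideal p Q" and f: "f \<notin> preim J p"
  shows "\<exists>g. f * g - 1 \<in> preim J p"
proof -
  interpret maximalideal p Q by (rule p)
  have I: "isideal (preim J p)" by (rule preim_isideal) (rule is_ideal)
  let ?K = "{h. \<exists>q\<in>preim J p. \<exists>g. h = q + g * f}"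
  have sub: "preim J p \<subseteq> ?K"
  proof
    fix q assume "q \<in> preim J p"
    then show "q \<in> ?K" by (intro CollectI bexI[of _ q] exI[of _ 0]) simp_all
  qed
  have fK: "f \<in> ?K"
    using isidealD(1)[OF I] by (intro CollectI bexI[of _ 0] exI[of _ 1]) simp_all
  have K: "isideal ?K" by (rule isideal_adjoin[OF I])
  have pK: "p \<subseteq> cls J ` ?K"
    using image_mono[OF sub, of "cls J"] image_preim[OF ideal_carrier[OF is_ideal]] by simp
  have "cls J ` ?K = p \<or> cls J ` ?K = carrier Q"
    by (rule I_maximal[OF image_ideal[OF K] pK]) auto
  moreover have "cls J ` ?K \<noteq> p" using fK f by (auto simp: preim_def)
  ultimately have "cls J 1 \<in> cls J ` ?K" by simp
  then have "1 \<in> preim J (cls J ` ?K)" by (simp add: preim_def)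
  also have "\<dots> = ?K" using J_le_preim[OF is_ideal] sub by (intro preim_image[OF K]) blast
  finally obtain q g where qg: "q \<in> preim J p" "1 = q + g * f" by blast
  then have "f * g - 1 = - q" by (simp add: algebra_simps)
  then show ?thesis using isidealD(5)[OF I qg(1)] by (intro exI[of _ g]) simp
qed

lemma prime_chainI:
  assumes "\<And>i. i \<le> k \<Longrightarrow> isprime (q i) \<and> J \<subseteq> q i" "\<And>i. i < k \<Longrightarrow> q i \<subset> q (Suc i)"
  shows "prime_chain Q (\<lambda>i. cls J ` q i) k"
  unfolding prime_chain_def
proof (intro conjI allI impI)
  fix i assume "i \<le> k"
  then show "primeideal (cls J ` q i) Q" using assms(1) by (intro image_prime) auto
next
  fix i assume i: "i < k"
  have pre: "preim J (cls J ` q j) = q j" if "j \<le> k" for j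
    using assms(1)[OF that] by (intro preim_image) (auto simp: isprime_def)
  have "cls J ` q i \<subseteq> cls J ` q (Suc i)" using assms(2)[OF i] by (intro image_mono) simp
  moreover have "cls J ` q i \<noteq> cls J ` q (Suc i)"
  proof
    assume "cls J ` q i = cls J ` q (Suc i)"
    then have "preim J (cls J ` q i) = preim J (cls J ` q (Suc i))" by (rule arg_cong)
    then have "q i = q (Suc i)" unfolding pre[OF less_imp_le[OF i]] pre[OF Suc_leI[OF i]] .
    then show False using assms(2)[OF i] by simp
  qed
  ultimately show "cls J ` q i \<subset> cls J ` q (Suc i)" by (rule psubsetI)
qed

text \<open>
  The ideals generated by initial segments of a regular sequence form the chain from which
  \<open>prime_chain_below_regular\<close> builds a strict chain of primes ending in \<open>p\<close>.
\<close>

lemma length_regular_le_height: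
  assumes xs: "regular_sequence Q xs" "set xs \<subseteq> p" and p: "primeideal p Q"
  shows "enat (length xs) \<le> height Q p"
proof -
  let ?k = "length xs"
  define G where "G i = genideal Q (set (take i xs))" for i
  have car: "set (take i xs) \<subseteq> carrier Q" for i
    using xs(1) set_take_subset[of i xs] by (auto simp: regular_sequence_def)
  have GI: "ideal (G i) Q" for i unfolding G_def by (rule ring.genideal_ideal[OF Q_ring car])
  have ip: "ideal p Q" by (rule primeideal.axioms(1)[OF p])
  have "\<exists>f. xs ! i = cls J f" if "i < ?k" for i
  proof -
    have "xs ! i \<in> carrier Q" using xs(1) nth_mem[OF that] by (auto simp: regular_sequence_def)
    then show ?thesis by (auto simp: Q_carrier)
  qed
  then obtain x where x: "\<And>i. i < ?k \<Longrightarrow> xs ! i = cls J (x i)" by metis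
  have "\<exists>q. (\<forall>i\<le>?k. isprime (q i) \<and> preim J (G 0) \<subseteq> q i) \<and> (\<forall>i<?k. q i \<subset> q (Suc i)) \<and> q ?k = preim J p"
  proof (rule prime_chain_below_regular)
    fix i show "isideal (preim J (G i))" by (rule preim_isideal[OF GI])
  next
    fix i assume i: "i < ?k"
    have sub: "set (take (Suc i) xs) = insert (xs ! i) (set (take i xs))"
      using i by (simp add: take_Suc_conv_app_nth)
    have self: "set (take (Suc i) xs) \<subseteq> G (Suc i)"
      unfolding G_def by (rule ring.genideal_self[OF Q_ring car])
    then have "G i \<subseteq> G (Suc i)"
      unfolding G_def[of i] sub by (intro ring.genideal_minimal[OF Q_ring GI]) auto
    then show "preim J (G i) \<subseteq> preim J (G (Suc i))" by (auto simp: preim_def)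
    show "x i \<in> preim J (G (Suc i))" using self x[OF i] unfolding sub by (auto simp: preim_def)
    fix a assume "a * x i \<in> preim J (G i)"
    then have "cls J a \<otimes>\<^bsub>Q\<^esub> xs ! i \<in> G i" using x[OF i] by (simp add: preim_def cls_mult)
    then have "cls J a \<in> G i"
      using xs(1) i cls_carrier[of a] by (simp add: regular_sequence_def G_def)
    then show "a \<in> preim J (G i)" by (simp add: preim_def)
  next
    show "isprime (preim J p)" by (rule preim_prime[OF p])
    have "G ?k \<subseteq> p" unfolding G_def using xs(2) by (intro ring.genideal_minimal[OF Q_ring ip]) auto
    then show "preim J (G ?k) \<subseteq> preim J p" by (auto simp: preim_def)
  qed
  then obtain q where q: "\<forall>i\<le>?k. isprime (q i) \<and> preim J (G 0) \<subseteq> q i" "\<forall>i<?k. q i \<subset> q (Suc i)"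
      "q ?k = preim J p" by blast
  have "prime_chain Q (\<lambda>i. cls J ` q i) ?k"
  proof (rule prime_chainI)
    fix i assume "i \<le> ?k"
    then show "isprime (q i) \<and> J \<subseteq> q i"
      using q(1) order.trans[OF J_le_preim[OF GI, of 0], of "q i"] by simp
  qed (use q(2) in simp)
  moreover have "cls J ` q ?k = p" unfolding q(3) by (rule image_preim[OF ideal_carrier[OF ip]])
  ultimately show ?thesis unfolding height_def by (intro Sup_upper) blast
qed

lemma depth_le_height: "primeideal p Q \<Longrightarrow> depth Q p \<le> height Q p"
  unfolding depth_def by (rule Sup_least) (auto intro: length_regular_le_height)

lemma height_le_krull_dim: "height Q p \<le> krull_dim Q"
  unfolding height_def krull_dim_def by (rule Sup_subset_mono) blast

end

section \<open>Prime chains and growth\<close>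

text \<open>
  Cancel the lowest power of \<open>y\<close>, which is not in the prime \<open>Q\<close>; all terms but the lowest one
  are then multiples of \<open>y\<close> and lie in \<open>P\<close>.
\<close>

lemma lowest_term:
  assumes Q: "isprime Q" and P: "isideal P" "Q \<subseteq> P" and y: "y \<in> P" "y \<notin> Q"
    and S: "finite S" "S \<noteq> {}" and s: "(\<Sum>a\<in>S. y ^ a * g a) \<in> Q"
  shows "g (Min S) \<in> P"
proof -
  define a0 where "a0 = Min S"
  have a0: "a0 \<in> S" "\<And>a. a \<in> S \<Longrightarrow> a0 \<le> a" using S by (auto simp: a0_def)
  have "(\<Sum>a\<in>S. y ^ a * g a) = y ^ a0 * (\<Sum>a\<in>S. y ^ (a - a0) * g a)"
    unfolding sum_distrib_left
    using a0 by (intro sum.cong) (auto simp flip: mult.assoc power_add)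
  then have "(\<Sum>a\<in>S. y ^ (a - a0) * g a) \<in> Q"
    using s isprime_power[OF Q] y(2) Q unfolding isprime_def by metis
  then have 1: "(\<Sum>a\<in>S. y ^ (a - a0) * g a) \<in> P" using P(2) by blast
  have 2: "(\<Sum>a\<in>S. y ^ (a - a0) * g a) = g a0 + (\<Sum>a\<in>S - {a0}. y ^ (a - a0) * g a)"
    using S(1) a0(1) by (subst sum.remove[of _ a0]) auto
  have "(\<Sum>a\<in>S - {a0}. y ^ (a - a0) * g a) \<in> P"
  proof (rule isideal_sum[OF P(1)])
    fix a assume "a \<in> S - {a0}"
    then have "0 < a - a0" using a0(2)[of a] by auto
    then have "y ^ (a - a0) = y ^ (a - a0 - 1) * y" by (cases "a - a0") simp_all
    then have "y ^ (a - a0) \<in> P" using isidealD(3)[OF P(1) y(1)] by simp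
    then show "y ^ (a - a0) * g a \<in> P" by (rule isidealD(4)[OF P(1)])
  qed
  from isidealD(6)[OF P(1) 1 this] have "g a0 \<in> P" unfolding 2 by simp
  then show ?thesis by (simp add: a0_def)
qed

definition deg_le :: "nat \<Rightarrow> poly4 \<Rightarrow> bool" where
  "deg_le D f \<longleftrightarrow> (\<forall>m\<in>ks f. mdeg m \<le> D)"

lemma deg_le_mult:
  assumes "deg_le D f" "deg_le E g"
  shows "deg_le (D + E) (f * g)"
  unfolding deg_le_def
proof
  fix m assume "m \<in> ks (f * g)"
  then obtain a b where "m = a + b" "a \<in> ks f" "b \<in> ks g" using Poly_Mapping.keys_mult[of f g] by auto
  then show "mdeg m \<le> D + E" using assms by (auto simp: deg_le_def mdeg_add intro: add_mono)
qed

lemma deg_le_power: "deg_le D f \<Longrightarrow> deg_le (k * D) (f ^ k)"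
proof (induction k)
  case 0
  show ?case by (simp add: deg_le_def)
next
  case (Suc k)
  then show ?case using deg_le_mult[of D f "k * D" "f ^ k"] by simp
qed

lemma deg_le_mono: "deg_le D f \<Longrightarrow> D \<le> E \<Longrightarrow> deg_le E f"
  by (force simp: deg_le_def)

lemma deg_le_exists: "\<exists>D. deg_le D f"
  by (intro exI[of _ "Max (mdeg ` ks f)"]) (simp add: deg_le_def)

text \<open>
  Elements taken from the steps of a chain of primes are algebraically independent modulo the
  smallest prime: by three applications of \<open>lowest_term\<close>, the coefficient of the lexicographically
  lowest monomial of a relation, a nonzero constant, would lie in the largest prime.
\<close>

lemma chain_independent:
  fixes P0 P1 P2 P3 :: "poly4 set"
  assumes P: "isprime P0" "isprime P1" "isprime P2" "isprime P3" "P0 \<subseteq> P1" "P1 \<subseteq> P2" "P2 \<subseteq> P3"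
    and y: "y1 \<in> P1" "y1 \<notin> P0" "y2 \<in> P2" "y2 \<notin> P1" "y3 \<in> P3" "y3 \<notin> P2"
    and rel: "(\<Sum>a\<le>k. y1 ^ a * (\<Sum>b\<le>k. y2 ^ b * (\<Sum>e\<le>k. y3 ^ e * const (c a b e)))) \<in> P0"
    and abe: "a \<le> (k::nat)" "b \<le> k" "e \<le> k"
  shows "c a b e = 0"
proof (rule ccontr)
  assume nz: "c a b e \<noteq> 0"
  have I: "isideal P1" "isideal P2" "isideal P3" using P by (auto simp: isprime_def)
  define g1 where "g1 a = (\<Sum>b\<le>k. y2 ^ b * (\<Sum>e\<le>k. y3 ^ e * const (c a b e)))" for a
  define S1 where "S1 = {a. a \<le> k \<and> (\<exists>b\<le>k. \<exists>e\<le>k. c a b e \<noteq> 0)}"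
  have S1: "finite S1" "S1 \<noteq> {}" using nz abe by (auto simp: S1_def)
  have "(\<Sum>a\<le>k. y1 ^ a * g1 a) = (\<Sum>a\<in>S1. y1 ^ a * g1 a)"
    by (intro sum.mono_neutral_right) (auto simp: S1_def g1_def)
  then have "(\<Sum>a\<in>S1. y1 ^ a * g1 a) \<in> P0" using rel by (simp add: g1_def)
  then have 1: "g1 (Min S1) \<in> P1" by (rule lowest_term[OF P(1) I(1) P(5) y(1,2) S1])
  define a' where "a' = Min S1"
  have "a' \<in> S1" using S1 by (simp add: a'_def)
  then obtain b' e' where a': "b' \<le> k" "e' \<le> k" "c a' b' e' \<noteq> 0" by (auto simp: S1_def)
  define g2 where "g2 b = (\<Sum>e\<le>k. y3 ^ e * const (c a' b e))" for b
  define S2 where "S2 = {b. b \<le> k \<and> (\<exists>e\<le>k. c a' b e \<noteq> 0)}"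
  have S2: "finite S2" "S2 \<noteq> {}" using a' by (auto simp: S2_def)
  have "(\<Sum>b\<le>k. y2 ^ b * g2 b) = (\<Sum>b\<in>S2. y2 ^ b * g2 b)"
    by (intro sum.mono_neutral_right) (auto simp: S2_def g2_def)
  then have "(\<Sum>b\<in>S2. y2 ^ b * g2 b) \<in> P1" using 1 by (simp add: g1_def g2_def a'_def)
  then have 2: "g2 (Min S2) \<in> P2" by (rule lowest_term[OF P(2) I(2) P(6) y(3,4) S2])
  define b'' where "b'' = Min S2"
  have "b'' \<in> S2" using S2 by (simp add: b''_def)
  then obtain e'' where b'': "e'' \<le> k" "c a' b'' e'' \<noteq> 0" by (auto simp: S2_def)
  define S3 where "S3 = {e. e \<le> k \<and> c a' b'' e \<noteq> 0}"
  have S3: "finite S3" "S3 \<noteq> {}" using b'' by (auto simp: S3_def)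
  have "(\<Sum>e\<le>k. y3 ^ e * const (c a' b'' e)) = (\<Sum>e\<in>S3. y3 ^ e * const (c a' b'' e))"
    by (intro sum.mono_neutral_right) (auto simp: S3_def)
  then have "(\<Sum>e\<in>S3. y3 ^ e * const (c a' b'' e)) \<in> P2" using 2 by (simp add: g2_def b''_def)
  then have 3: "const (c a' b'' (Min S3)) \<in> P3" by (rule lowest_term[OF P(3) I(3) P(7) y(5,6) S3])
  have "c a' b'' (Min S3) \<noteq> 0" using Min_in[OF S3] by (auto simp: S3_def)
  then have "const (1 / c a' b'' (Min S3)) * const (c a' b'' (Min S3)) = (1 :: poly4)"
    by (simp flip: const_mult)
  then show False using isidealD(3)[OF I(3) 3] P(4) unfolding isprime_def by metis
qed

context linear_hilbert_burch
begin

sublocale quotient_by J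
  by unfold_locales (rule isideal_J)

text \<open>
  Modulo \<open>J\<close> the polynomials of degree at most \<open>s\<close> span a space of dimension \<open>O(s\<^sup>2)\<close>, whereas a
  chain of three steps provides about \<open>s\<^sup>3\<close> independent elements.
\<close>

lemma prime_chain_le_2:
  assumes "prime_chain Q p l"
  shows "l \<le> 2"
proof (rule ccontr)
  assume "\<not> l \<le> 2"
  then have l: "3 \<le> l" by simp
  have pr: "primeideal (p i) Q" if "i \<le> 3" for i using assms l that by (auto simp: prime_chain_def)
  have st: "p i \<subset> p (Suc i)" if "i < 3" for i using assms l that by (auto simp: prime_chain_def)
  define P where "P i = preim J (p i)" for i
  have P: "isprime (P i)" if "i \<le> 3" for i unfolding P_def by (rule preim_prime[OF pr[OF that]])
  have PS: "P i \<subset> P (Suc i)" if "i < 3" for i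
    unfolding P_def using pr[of i] pr[of "Suc i"] st[OF that] that
    by (intro preim_strict primeideal.axioms(1)) auto
  obtain y1 where y1: "y1 \<in> P 1" "y1 \<notin> P 0" using PS[of 0] by auto
  obtain y2 where y2: "y2 \<in> P 2" "y2 \<notin> P 1" using PS[of 1] by (auto simp: numeral_2_eq_2)
  obtain y3 where y3: "y3 \<in> P 3" "y3 \<notin> P 2" using PS[of 2] by (auto simp: numeral_3_eq_3 numeral_2_eq_2)
  have JP: "J \<subseteq> P 0" unfolding P_def by (rule J_le_preim[OF primeideal.axioms(1)[OF pr]]) simp
  obtain D1 D2 D3 where "deg_le D1 y1" "deg_le D2 y2" "deg_le D3 y3" using deg_le_exists by metis
  then obtain D where D: "deg_le D y1" "deg_le D y2" "deg_le D y3"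
    by (metis deg_le_mono max.cobounded1 max.cobounded2 max.coboundedI1)
  \<comment> \<open>With this exponent bound the \<open>(k + 1)\<^sup>3\<close> products outnumber the at most \<open>n\<^sup>2 (s + 1)\<^sup>2\<close>
    reduced monomials of degree at most \<open>s\<close>.\<close>
  define k where "k = n * n * (3 * D + 1) ^ 2"
  define s where "s = 3 * k * D"
  define y where "y = (\<lambda>(a, b, e). y1 ^ a * (y2 ^ b * y3 ^ e))"
  define M where "M = {m :: mon4. mdeg m \<le> s \<and> lk m 2 + lk m 3 < n - 1}"
  have Mim: "M \<subseteq> (\<lambda>(a, b, c, e). mon a b c e) ` ({..s} \<times> {..s} \<times> {..<n} \<times> {..<n})"
  proof
    fix m assume m: "m \<in> M"
    have "lk m 0 \<le> s" "lk m 1 \<le> s" "lk m 2 < n" "lk m 3 < n"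
      using m unfolding M_def mdeg_4 mem_Collect_eq by linarith+
    then show "m \<in> (\<lambda>(a, b, c, e). mon a b c e) ` ({..s} \<times> {..s} \<times> {..<n} \<times> {..<n})"
      by (intro image_eqI[of _ _ "(lk m 0, lk m 1, lk m 2, lk m 3)"]) (simp_all add: mon_lk)
  qed
  have fM: "finite M" by (rule finite_subset[OF Mim]) simp
  have "card M \<le> card ({..s} \<times> {..s} \<times> {..<n} \<times> {..<n})"
    by (rule order.trans[OF card_mono[OF _ Mim] card_image_le]) simp_all
  also have "\<dots> = n * n * (s + 1) ^ 2" by (simp add: card_cartesian_product power2_eq_square algebra_simps)
  also have "\<dots> < (k + 1) ^ 3"
  proof -
    have "s + 1 \<le> (3 * D + 1) * (k + 1)" by (simp add: s_def algebra_simps)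
    then have "(s + 1) ^ 2 \<le> ((3 * D + 1) * (k + 1)) ^ 2" by (rule power_mono) simp
    then have "n * n * (s + 1) ^ 2 \<le> n * n * ((3 * D + 1) * (k + 1)) ^ 2" by (rule mult_le_mono2)
    also have "\<dots> = k * (k + 1) ^ 2" by (simp only: k_def power_mult_distrib mult.assoc)
    also have "\<dots> < (k + 1) * (k + 1) ^ 2" by (rule mult_strict_right_mono) simp_all
    finally show ?thesis by (simp only: power3_eq_cube power2_eq_square mult.assoc)
  qed
  finally have cM: "card M < (k + 1) ^ 3" .
  let ?B = "{..k} \<times> {..k} \<times> {..k}"
  let ?W = "(\<lambda>m. sg m (1::complex)) ` M"
  have dy: "deg_le s (y x)" if xB: "x \<in> ?B" for x
  proof -
    obtain a b e where x: "x = (a, b, e)" "a \<le> k" "b \<le> k" "e \<le> k" using xB by auto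
    have "deg_le (a * D + (b * D + e * D)) (y x)"
      unfolding y_def x by (simp add: deg_le_mult deg_le_power D)
    moreover have "a * D + (b * D + e * D) \<le> s"
    proof -
      have "s = k * D + (k * D + k * D)" by (simp add: s_def)
      then show ?thesis using x by (simp add: add_mono)
    qed
    ultimately show ?thesis by (rule deg_le_mono)
  qed
  have "\<exists>g. y x - g \<in> J \<and> g \<in> poly_vs.span ?W" if "x \<in> ?B" for x
  proof -
    obtain g where g: "reduced (n - 1) g" "y x - g \<in> J" "mdeg ` ks g \<subseteq> mdeg ` ks (y x)"
      using reduction by blast
    have "ks g \<subseteq> M"
    proof
      fix m assume m: "m \<in> ks g"
      then obtain m' where "m' \<in> ks (y x)" "mdeg m = mdeg m'" using g(3) by auto
      then show "m \<in> M" using dy[OF that] g(1) m by (simp add: M_def deg_le_def reduced_def)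
    qed
    then show ?thesis using g(2) unfolding single_basis(3)[OF fM] by blast
  qed
  then obtain g where g: "\<And>x. x \<in> ?B \<Longrightarrow> y x - g x \<in> J" "\<And>x. x \<in> ?B \<Longrightarrow> g x \<in> poly_vs.span ?W"
    by metis
  have "card ?W < card ?B"
  proof -
    have "card ?B = (k + 1) ^ 3" by (simp add: card_cartesian_product power3_eq_cube)
    then show ?thesis using cM single_basis(1)[OF fM] by (simp only:)
  qed
  then obtain c where c: "(\<Sum>x\<in>?B. const (c x) * g x) = 0" "\<exists>x\<in>?B. c x \<noteq> 0"
    using poly_vs.dependent_family[of ?B ?W g] fM g(2) by auto
  have "(\<Sum>x\<in>?B. const (c x) * (y x - g x)) \<in> J"
    using g(1) by (intro isideal_sum[OF isideal_J] isidealD(3)[OF isideal_J])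
  then have "(\<Sum>x\<in>?B. const (c x) * y x) \<in> P 0"
    using c(1) JP by (auto simp: right_diff_distrib sum_subtractf)
  also have "(\<Sum>x\<in>?B. const (c x) * y x)
    = (\<Sum>a\<le>k. y1 ^ a * (\<Sum>b\<le>k. y2 ^ b * (\<Sum>e\<le>k. y3 ^ e * const (c (a, b, e)))))"
    unfolding sum.cartesian_product' y_def prod.case sum_distrib_left
    by (intro sum.cong refl) (simp only: ac_simps)
  finally have rel: "(\<Sum>a\<le>k. y1 ^ a * (\<Sum>b\<le>k. y2 ^ b * (\<Sum>e\<le>k. y3 ^ e * const (c (a, b, e))))) \<in> P 0" .
  obtain a b e where abe: "a \<le> k" "b \<le> k" "e \<le> k" "c (a, b, e) \<noteq> 0" using c(2) by auto
  have "c (a, b, e) = 0"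
    by (rule chain_independent[of "P 0" "P 1" "P 2" "P 3" y1 y2 y3 "\<lambda>a b e. c (a, b, e)" k])
       (use P PS[of 0] PS[of 1] PS[of 2] y1 y2 y3 rel abe in \<open>auto simp: numeral_2_eq_2 numeral_3_eq_3\<close>)
  then show False using abe(4) by simp
qed

lemma krull_dim_le_2: "krull_dim Q \<le> 2"
  unfolding krull_dim_def
proof (rule Sup_least)
  fix x assume "x \<in> {enat l | l p. prime_chain Q p l}"
  then obtain l where "x = enat l" "l \<le> 2" using prime_chain_le_2 by auto
  then show "x \<le> 2" by (simp add: numeral_eq_enat)
qed

lemma depth_ge_2:
  assumes p: "ideal p Q" "p \<noteq> carrier Q"
    and ab: "var 0 - const a \<in> preim J p" "var 1 - const b \<in> preim J p"
  shows "2 \<le> depth Q p"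
proof -
  let ?u = "var 0 - const a" and ?v = "var 1 - const b"
  let ?xs = "[cls J ?u, cls J ?v]"
  have sp: "set ?xs \<subseteq> p" using ab by (simp add: preim_def)
  have "regular_sequence Q ?xs"
    unfolding regular_sequence_def
  proof (intro conjI allI impI ballI)
    show "set ?xs \<subseteq> carrier Q" by simp
    show "genideal Q (set ?xs) \<noteq> carrier Q"
      using ring.genideal_minimal[OF Q_ring p(1) sp] p ideal_carrier[OF p(1)] by blast
    fix i x assume i: "i < length ?xs" and x: "x \<in> carrier Q"
      and reg: "x \<otimes>\<^bsub>Q\<^esub> ?xs ! i \<in> genideal Q (set (take i ?xs))"
    obtain f where f: "x = cls J f" using x by (rule Q_carrierE)
    consider "i = 0" | "i = 1" using i by fastforce
    then show "x \<in> genideal Q (set (take i ?xs))"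
    proof cases
      case 1
      have "genideal Q {} \<subseteq> {\<zero>\<^bsub>Q\<^esub>}"
        by (rule ring.genideal_minimal[OF Q_ring ring.zeroideal[OF Q_ring]]) simp
      then have "cls J (f * ?u) = cls J 0" using reg 1 f by (auto simp: cls_mult cls_zero)
      then have "?u * f \<in> J" by (simp add: cls_eq mult.commute)
      then have "f \<in> J" by (rule regular_0)
      then have "x = \<zero>\<^bsub>Q\<^esub>" unfolding f cls_zero cls_eq by simp
      then show ?thesis
        using 1 additive_subgroup.zero_closed[OF ideal.axioms(1)[OF ring.genideal_ideal[OF Q_ring, of "{}"]]]
        by simp
    next
      case 2
      have G: "genideal Q {cls J ?u} = {y \<otimes>\<^bsub>Q\<^esub> cls J ?u | y. y \<in> carrier Q}"
        using cring.cgenideal_eq_genideal[OF Q_cring cls_carrier, of ?u] by (simp add: cgenideal_def)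
      have "cls J (f * ?v) \<in> genideal Q {cls J ?u}" using reg 2 f by (simp add: cls_mult)
      then obtain y where y: "cls J (f * ?v) = y \<otimes>\<^bsub>Q\<^esub> cls J ?u" "y \<in> carrier Q" unfolding G by blast
      obtain h where h: "y = cls J h" using y(2) by (rule Q_carrierE)
      have "?v * f - ?u * h \<in> J" using y(1) unfolding h cls_mult cls_eq by (simp add: mult.commute)
      then obtain k where "f - ?u * k \<in> J" using regular_1 by blast
      then have "x = cls J k \<otimes>\<^bsub>Q\<^esub> cls J ?u" unfolding f cls_mult cls_eq by (simp add: mult.commute)
      then show ?thesis using 2 G by auto
    qed
  qed
  then have "enat (length ?xs) \<le> depth Q p" unfolding depth_def using sp by (intro Sup_upper) blast
  then show ?thesis by (simp add: numeral_eq_enat numeral_2_eq_2)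
qed

text \<open>
  At every maximal ideal, 2 is a lower bound for the depth and an upper bound for the height.
\<close>

lemma cohen_macaulay_Q: "cohen_macaulay Q"
  unfolding cohen_macaulay_def
proof (intro conjI allI impI)
  show "cring Q" by (rule Q_cring)
  show "noetherian_ring Q" by (rule Q_noetherian)
  fix p assume p: "maximalideal p Q"
  have pr: "primeideal p Q" by (rule cring.maximalideal_prime[OF Q_cring p])
  have id: "ideal p Q" by (rule primeideal.axioms(1)[OF pr])
  have "\<exists>a. var i - const a \<in> preim J p" for i
    by (rule nullstellensatz[OF preim_prime[OF pr] maximal_preim[OF p]])
  then obtain a b where ab: "var 0 - const a \<in> preim J p" "var 1 - const b \<in> preim J p" by metis
  have "2 \<le> depth Q p"
    by (rule depth_ge_2[OF id _ ab]) (use maximalideal.I_notcarr[OF p] in blast)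
  moreover have "height Q p \<le> 2" using height_le_krull_dim krull_dim_le_2 by (rule order.trans)
  ultimately show "depth Q p = height Q p"
    using depth_le_height[OF pr] by (meson order.antisym order.trans)
qed

text \<open>
  The ideal of the origin contains \<open>J\<close>, because the minors have positive degree for \<open>n \<ge> 2\<close>; its
  depth is at least 2.
\<close>

lemma krull_dim_Q:
  assumes n2: "2 \<le> n"
  shows "krull_dim Q = 2"
proof (rule antisym)
  show "krull_dim Q \<le> 2" by (rule krull_dim_le_2)
  define K where "K = {f :: poly4. peval (\<lambda>_. 0) f = 0}"
  have K: "isprime K"
    unfolding isprime_def isideal_def by (auto simp: K_def peval_add peval_mult)
  have "J \<subseteq> K"
  proof
    fix f assume "f \<in> J"
    then obtain h where h: "f = (\<Sum>i<Suc N. h i * minr i)" by (auto simp: J_def)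
    have "peval (\<lambda>_. 0) (minr i) = 0" if "i < Suc N" for i
    proof -
      have "0 < mdegree i" using n2 by (simp add: mdegree_def rdeg_def)
      then show ?thesis
        using peval_forms_scale[OF minr_forms[OF that], of 0 "\<lambda>_. 0"] by (simp add: zero_power)
    qed
    then show "f \<in> K" unfolding h K_def by (simp add: peval_sum peval_mult del: sum.lessThan_Suc)
  qed
  note JK = this
  have pr: "primeideal (cls J ` K) Q" by (rule image_prime[OF K JK])
  have "preim J (cls J ` K) = K" using K JK by (intro preim_image) (auto simp: isprime_def)
  then have ab: "var 0 - const 0 \<in> preim J (cls J ` K)" "var 1 - const 0 \<in> preim J (cls J ` K)"
    by (auto simp: K_def)
  have "2 \<le> depth Q (cls J ` K)"
    by (rule depth_ge_2[OF primeideal.axioms(1)[OF pr] _ ab]) (use primeideal.I_notcarr[OF pr] in blast)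
  then show "2 \<le> krull_dim Q"
    using depth_le_height[OF pr] height_le_krull_dim by (meson order.trans)
qed

end

section \<open>Derivatives of order one less than the degree\<close>

text \<open>
  The falling factorial: for \<open>a < k\<close> the factor with \<open>j = a\<close> is zero, so truncated subtraction
  gives the right value.
\<close>

definition falling :: "nat \<Rightarrow> nat \<Rightarrow> complex" where
  "falling a k = (\<Prod>j<k. of_nat (a - j))"

lemma falling_eq_0: "a < k \<Longrightarrow> falling a k = 0"
  by (auto simp: falling_def)

lemma falling_self: "falling a a = fact a"
proof -
  have "(\<Prod>j<a. of_nat (a - j) :: complex) = (\<Prod>j<a. of_nat (Suc j))"
    by (rule prod.reindex_bij_witness[of _ "\<lambda>j. a - Suc j" "\<lambda>j. a - Suc j"]) auto
  then show ?thesis by (simp add: falling_def fact_prod_Suc atLeast0LessThan)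
qed

lemma falling_Suc_self: "falling (Suc a) a = of_nat (Suc a) * fact a"
proof -
  have "falling (Suc a) (Suc a) = falling (Suc a) a" by (simp add: falling_def)
  then show ?thesis using falling_self[of "Suc a"] by simp
qed

lemma partial_deriv_single:
  "partial_deriv i (sg M c) = sg (M - sg i 1) (of_nat (lk M i) * c)"
  by (cases "c = 0") (simp_all add: partial_deriv_def)

lemma iterate_partial_deriv:
  "(partial_deriv i ^^ k) (sg M c) = sg (M - sg i k) (falling (lk M i) k * c)"
proof (induction k)
  case 0
  show ?case by (simp add: falling_def)
next
  case (Suc k)
  have "M - sg i k - sg i 1 = M - sg i (Suc k)"
    by (rule poly_mapping_eqI) (simp add: lookup_minus lookup_single when_def)
  moreover have "of_nat (lk (M - sg i k) i) * (falling (lk M i) k * c) = falling (lk M i) (Suc k) * c"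
    by (simp add: falling_def lookup_minus)
  ultimately show ?case using Suc by (simp only: funpow.simps o_apply partial_deriv_single)
qed

lemma iterated_deriv_single:
  "iterated_deriv m (sg M 1) = sg (M - m) (\<Prod>i\<in>UNIV. falling (lk M i) (lk m i))"
proof -
  have "M - sg 3 (lk m 3) - sg 2 (lk m 2) - sg 1 (lk m 1) - sg 0 (lk m 0) = M - m"
    by (rule mon_eqI) (simp_all add: lookup_minus lookup_single)
  then show ?thesis
    by (simp add: iterated_deriv_def iterate_partial_deriv lookup_minus lookup_single prod_4 ac_simps)
qed

definition mfact :: "mon4 \<Rightarrow> complex" where "mfact m = (\<Prod>i\<in>UNIV. fact (lk m i))"

lemma mfact_nonzero: "mfact m \<noteq> 0"
  by (simp add: mfact_def prod_4)

text \<open>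
  A derivative of order \<open>d - 1\<close> of a monomial of degree \<open>d\<close> is nonzero only in this situation,
  and then it is a multiple of a variable.
\<close>

lemma monomial_one_more:
  assumes "mdeg M = Suc (mdeg m)" "\<And>i. lk m i \<le> lk M (i::4)"
  shows "\<exists>i. M = m + sg i 1"
proof -
  have "M = m + (M - m)"
    using assms(2) by (intro poly_mapping_eqI) (simp add: lookup_add lookup_minus)
  then have "mdeg (M - m) = 1" using assms(1) mdeg_add[of m "M - m"] by simp
  then have "\<exists>i. M - m = sg i 1"
  proof -
    let ?e = "M - m"
    have s: "lk ?e 0 + lk ?e 1 + lk ?e 2 + lk ?e 3 = 1"
      using \<open>mdeg (M - m) = 1\<close> by (simp add: mdeg_4)
    then consider "lk ?e 0 = 1" | "lk ?e 1 = 1" | "lk ?e 2 = 1" | "lk ?e 3 = 1" by linarith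
    then show ?thesis
    proof cases
      case 1 then show ?thesis using s by (intro exI[of _ 0] mon_eqI) (simp_all add: lookup_single)
    next
      case 2 then show ?thesis using s by (intro exI[of _ 1] mon_eqI) (simp_all add: lookup_single)
    next
      case 3 then show ?thesis using s by (intro exI[of _ 2] mon_eqI) (simp_all add: lookup_single)
    next
      case 4 then show ?thesis using s by (intro exI[of _ 3] mon_eqI) (simp_all add: lookup_single)
    qed
  qed
  then show ?thesis using \<open>M = m + (M - m)\<close> by metis
qed

lemma deriv_entry_one_more:
  "iterated_deriv m (sg (m + sg i 1) 1) = sg (sg i 1) (mfact m * of_nat (Suc (lk m i)))"
proof -
  have "(\<Prod>k\<in>UNIV. falling (lk (m + sg i 1) k) (lk m k))
    = (\<Prod>k\<in>UNIV. (if k = i then of_nat (Suc (lk m i)) else 1) * fact (lk m k))"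
    by (intro prod.cong) (auto simp: lookup_add lookup_single falling_self falling_Suc_self when_def)
  also have "\<dots> = mfact m * of_nat (Suc (lk m i))"
    by (simp add: prod.distrib mfact_def prod.delta)
  finally show ?thesis by (simp add: iterated_deriv_single)
qed

lemma deriv_entry_other:
  assumes "mdeg M = Suc (mdeg m)" "\<nexists>i. M = m + sg i 1"
  shows "iterated_deriv m (sg M 1) = 0"
proof -
  obtain i where "lk M i < lk m i" using monomial_one_more[OF assms(1)] assms(2) by (meson not_le)
  then have "(\<Prod>i\<in>UNIV. falling (lk M i) (lk m i)) = 0"
    by (intro prod_zero bexI[of _ i]) (simp_all add: falling_eq_0)
  then show ?thesis unfolding iterated_deriv_single by (simp only: single_zero)
qed

text \<open>
  The coefficient of \<open>m\<close> in \<open>\<Sum>i. q\<^sub>i \<partial>F/\<partial>x\<^sub>i\<close>, the derivative of \<open>F\<close> in the direction \<open>q\<close>.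
\<close>

definition dcoeff :: "(4 \<Rightarrow> complex) \<Rightarrow> poly4 \<Rightarrow> mon4 \<Rightarrow> complex" where
  "dcoeff q F m = (\<Sum>i\<in>UNIV. of_nat (Suc (lk m i)) * q i * lk F (m + sg i 1))"

text \<open>
  This identifies a linear row of the interpolation matrix at \<open>q\<close>: up to the nonzero factor
  \<open>mfact m\<close>, it computes a coefficient of the derivative in the direction \<open>q\<close>. Taking the
  derivatives of order \<open>d - 1\<close> at \<open>q\<close> amounts to taking the coefficients of one derivative along
  \<open>q\<close>.
\<close>

lemma derivs_eq_dcoeff:
  assumes m: "Suc (mdeg m) = d"
  shows "(\<Sum>M | mdeg M = d. lk F M * peval q (iterated_deriv m (sg M 1))) = mfact m * dcoeff q F m"
proof -
  let ?g = "\<lambda>M. lk F M * peval q (iterated_deriv m (sg M 1))"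
  have inj: "inj (\<lambda>i::4. m + sg i 1)"
  proof (rule injI)
    fix i j :: 4 assume "m + sg i 1 = m + sg j (1::nat)"
    then have "sg i 1 = sg j (1::nat)" by simp
    then show "i = j" by (metis lookup_single_eq lookup_single_not_eq zero_neq_one)
  qed
  have "(\<Sum>M | mdeg M = d. ?g M) = (\<Sum>M\<in>range (\<lambda>i. m + sg i 1). ?g M)"
  proof (rule sum.mono_neutral_right)
    show "range (\<lambda>i. m + sg i 1) \<subseteq> {M. mdeg M = d}" using m by (auto simp: mdeg_add)
    show "\<forall>M\<in>{M. mdeg M = d} - range (\<lambda>i. m + sg i 1). ?g M = 0"
      using deriv_entry_other m by (auto simp: image_iff)
  qed (rule finite_mdeg)
  also have "\<dots> = (\<Sum>i\<in>UNIV. ?g (m + sg i 1))" by (rule sum.reindex_cong[OF inj]) auto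
  also have "\<dots> = mfact m * dcoeff q F m"
    unfolding dcoeff_def sum_distrib_left deriv_entry_one_more
    by (intro sum.cong) (simp_all add: ac_simps)
  finally show ?thesis .
qed

section \<open>Cones\<close>

definition line_mon :: "(4 \<Rightarrow> complex) \<Rightarrow> (4 \<Rightarrow> complex) \<Rightarrow> mon4 \<Rightarrow> complex poly" where
  "line_mon p q m = (\<Prod>i\<in>UNIV. [:p i, q i:] ^ lk m i)"

text \<open>
  The restriction of a form of degree \<open>d\<close> to the line \<open>p + s q\<close>, as a univariate polynomial in
  \<open>s\<close>.
\<close>

definition line_form :: "(4 \<Rightarrow> complex) \<Rightarrow> (4 \<Rightarrow> complex) \<Rightarrow> nat \<Rightarrow> poly4 \<Rightarrow> complex poly" where
  "line_form p q d F = (\<Sum>m | mdeg m = d. Polynomial.smult (lk F m) (line_mon p q m))"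

lemma poly_line_mon: "poly (line_mon p q m) s = monomial_val (\<lambda>i. p i + s * q i) m"
  by (simp add: line_mon_def poly_prod monomial_val_superset[of UNIV])

lemma poly_line_form:
  assumes "F \<in> forms d"
  shows "poly (line_form p q d F) s = peval (\<lambda>i. p i + s * q i) F"
  using assms
  by (subst peval_superset[OF finite_mdeg[of d]])
     (auto simp: line_form_def poly_sum poly_line_mon forms_def)

lemma degree_line_form: "degree (line_form p q d F) \<le> d"
  unfolding line_form_def
proof (rule degree_sum_le[OF finite_mdeg])
  fix m :: mon4 assume m: "m \<in> {m. mdeg m = d}"
  have "degree ([:p i, q i:] ^ lk m i) \<le> lk m i" for i
    using degree_power_le[of "[:p i, q i:]" "lk m i"] by (rule order.trans) simp
  then have "degree (line_mon p q m) \<le> (\<Sum>i\<in>UNIV. lk m i)"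
    unfolding line_mon_def by (intro order.trans[OF degree_prod_sum_le] sum_mono) auto
  also have "\<dots> = d" using m by (simp add: mdeg_4 sum_4)
  finally show "degree (Polynomial.smult (lk F m) (line_mon p q m)) \<le> d"
    using degree_smult_le order.trans by blast
qed

lemma smult_sum_right: "Polynomial.smult c (\<Sum>x\<in>A. f x) = (\<Sum>x\<in>A. Polynomial.smult c (f x))"
  by (induction A rule: infinite_finite_induct) (simp_all add: smult_add_right)

lemma smult_sum_left: "Polynomial.smult (\<Sum>x\<in>A. c x) p = (\<Sum>x\<in>A. Polynomial.smult (c x) p)"
  by (induction A rule: infinite_finite_induct) (simp_all add: smult_add_left)

lemma pderiv_sum_set: "pderiv (\<Sum>x\<in>A. f x) = (\<Sum>x\<in>A. pderiv (f x :: complex poly))"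
  by (induction A rule: infinite_finite_induct) (simp_all add: pderiv_add)

lemma pderiv_power_const:
  assumes "pderiv L = [:c :: complex:]"
  shows "pderiv (L ^ a) = Polynomial.smult (of_nat a * c) (L ^ (a - 1))"
proof (cases a)
  case (Suc k)
  show ?thesis unfolding Suc pderiv_power_Suc assms by (simp add: mult.commute)
qed simp

lemma pderiv_line_mon:
  "pderiv (line_mon p q M) = (\<Sum>i\<in>UNIV. Polynomial.smult (of_nat (lk M i) * q i) (line_mon p q (M - sg i 1)))"
  unfolding line_mon_def pderiv_prod
proof (intro sum.cong refl)
  fix i :: 4
  have "(\<Prod>k\<in>UNIV. [:p k, q k:] ^ lk (M - sg i 1) k)
      = [:p i, q i:] ^ (lk M i - 1) * (\<Prod>k\<in>UNIV - {i}. [:p k, q k:] ^ lk M k)"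
    by (subst prod.remove[of _ i]) (auto simp: lookup_minus lookup_single intro!: prod.cong)
  moreover have "pderiv ([:p i, q i:] ^ lk M i)
      = Polynomial.smult (of_nat (lk M i) * q i) ([:p i, q i:] ^ (lk M i - 1))"
    by (rule pderiv_power_const) (simp add: pderiv_pCons)
  ultimately show "prod (\<lambda>k. [:p k, q k:] ^ lk M k) (UNIV - {i}) * pderiv ([:p i, q i:] ^ lk M i)
    = Polynomial.smult (of_nat (lk M i) * q i) (\<Prod>k\<in>UNIV. [:p k, q k:] ^ lk (M - sg i 1) k)"
    by (simp add: mult.commute)
qed

lemma pderiv_line_form:
  assumes d: "0 < d"
  shows "pderiv (line_form p q d F) = (\<Sum>m | mdeg m = d - 1. Polynomial.smult (dcoeff q F m) (line_mon p q m))"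
proof -
  let ?g = "\<lambda>i M. Polynomial.smult (lk F M * (of_nat (lk M i) * q i)) (line_mon p q (M - sg i 1))"
  have "pderiv (line_form p q d F) = (\<Sum>M | mdeg M = d. \<Sum>i\<in>UNIV. ?g i M)"
    unfolding line_form_def
    by (simp add: pderiv_sum_set pderiv_smult pderiv_line_mon smult_sum_right)
  also have "\<dots> = (\<Sum>i\<in>UNIV. \<Sum>M | mdeg M = d. ?g i M)" by (rule sum.swap)
  also have "\<dots> = (\<Sum>i\<in>UNIV. \<Sum>m | mdeg m = d - 1. ?g i (m + sg i 1))"
  proof (rule sum.cong[OF refl])
    fix i :: 4
    have "(\<Sum>M | mdeg M = d. ?g i M) = (\<Sum>M | mdeg M = d \<and> lk M i \<noteq> 0. ?g i M)"
      by (rule sum.mono_neutral_right) (auto intro: finite_mdeg)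
    also have "\<dots> = (\<Sum>m | mdeg m = d - 1. ?g i (m + sg i 1))"
    proof (rule sum.reindex_bij_witness[of _ "\<lambda>m. m + sg i 1" "\<lambda>M. M - sg i 1"])
      fix M assume "M \<in> {M. mdeg M = d \<and> lk M i \<noteq> 0}"
      then have M: "mdeg M = d" "lk M i \<noteq> 0" by auto
      show e: "M - sg i 1 + sg i 1 = M"
        by (rule poly_mapping_eqI) (use M in \<open>auto simp: lookup_add lookup_minus lookup_single when_def\<close>)
      have "mdeg (M - sg i 1) + 1 = d"
        using M(1) mdeg_add[of "M - sg i 1" "sg i 1"] by (simp only: e mdeg_single)
      then show "M - sg i 1 \<in> {m. mdeg m = d - 1}" by simp
      show "?g i (M - sg i 1 + sg i 1) = ?g i M" by (simp only: e)
    next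
      fix m assume "m \<in> {m :: mon4. mdeg m = d - 1}"
      then show "m + sg i 1 \<in> {M. mdeg M = d \<and> lk M i \<noteq> 0}"
        using d by (simp add: mdeg_add lookup_add)
      show "m + sg i 1 - sg i 1 = m" by simp
    qed
    finally show "(\<Sum>M | mdeg M = d. ?g i M) = (\<Sum>m | mdeg m = d - 1. ?g i (m + sg i 1))" .
  qed
  also have "\<dots> = (\<Sum>m | mdeg m = d - 1. \<Sum>i\<in>UNIV. ?g i (m + sg i 1))" by (rule sum.swap)
  also have "\<dots> = (\<Sum>m | mdeg m = d - 1. Polynomial.smult (dcoeff q F m) (line_mon p q m))"
  proof (intro sum.cong refl)
    fix m :: mon4
    show "(\<Sum>i\<in>UNIV. ?g i (m + sg i 1)) = Polynomial.smult (dcoeff q F m) (line_mon p q m)"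
      unfolding dcoeff_def smult_sum_left by (intro sum.cong) (simp_all add: lookup_add ac_simps)
  qed
  finally show ?thesis .
qed

text \<open>
  The projection from \<open>q\<close> identifies vectors that differ by a multiple of \<open>q\<close>; so an invariant
  form is the pullback of the equation of a plane curve, and its zero set is a union of lines
  through \<open>q\<close>.
\<close>

definition is_cone :: "nat \<Rightarrow> (4 \<Rightarrow> complex) \<Rightarrow> poly4 \<Rightarrow> bool" where
  "is_cone d q F \<longleftrightarrow> F \<in> forms d \<and> (\<forall>p s. peval (\<lambda>i. p i + s * q i) F = peval p F)"

text \<open>
  In characteristic zero, invariance along \<open>q\<close> means that the derivative along \<open>q\<close> vanishes.
\<close>

lemma is_cone_iff_dcoeff:
  assumes d: "0 < d" and F: "F \<in> forms d"
  shows "is_cone d q F \<longleftrightarrow> (\<forall>m. mdeg m = d - 1 \<longrightarrow> dcoeff q F m = 0)"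
proof
  assume z: "\<forall>m. mdeg m = d - 1 \<longrightarrow> dcoeff q F m = 0"
  have "peval (\<lambda>i. p i + s * q i) F = peval p F" for p s
  proof -
    have "pderiv (line_form p q d F) = 0" unfolding pderiv_line_form[OF d] using z by simp
    then obtain c where "line_form p q d F = [:c:]" using pderiv_iszero by blast
    then have "poly (line_form p q d F) s = poly (line_form p q d F) 0" by simp
    then show ?thesis by (simp add: poly_line_form[OF F])
  qed
  then show "is_cone d q F" using F by (simp add: is_cone_def)
next
  assume c: "is_cone d q F"
  define G where "G = (\<Sum>m | mdeg m = d - 1. sg m (dcoeff q F m))"
  have "peval p G = 0" for p
  proof -
    have "poly (line_form p q d F) s = poly [:peval p F:] s" for s
      using c by (simp add: poly_line_form[OF F] is_cone_def)
    then have "line_form p q d F = [:peval p F:]" by (simp add: poly_eq_poly_eq_iff[symmetric] fun_eq_iff)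
    then have "pderiv (line_form p q d F) = 0" by simp
    then have "poly (\<Sum>m | mdeg m = d - 1. Polynomial.smult (dcoeff q F m) (line_mon p q m)) 0 = 0"
      unfolding pderiv_line_form[OF d] by simp
    then show ?thesis by (simp add: G_def peval_sum poly_sum poly_line_mon)
  qed
  then have G0: "G = 0" by (rule peval_eq_0_imp)
  show "\<forall>m. mdeg m = d - 1 \<longrightarrow> dcoeff q F m = 0"
  proof (intro allI impI)
    fix m :: mon4 assume m: "mdeg m = d - 1"
    have "lk G m = (\<Sum>k | mdeg k = d - 1. if k = m then dcoeff q F k else 0)"
      unfolding G_def lookup_sum by (intro sum.cong) (auto simp: lookup_single when_def)
    also have "\<dots> = dcoeff q F m" using m finite_mdeg by (simp add: sum.delta)
    finally show "dcoeff q F m = 0" using G0 by simp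
  qed
qed

section \<open>Powers of the ideal of a point\<close>

lemma isideal_vanishing_ideal: "isideal (vanishing_ideal Z)"
proof -
  interpret R: ring PR by (rule ring_from_type_algebra)
  show ?thesis unfolding vanishing_ideal_def using R.genideal_ideal by (simp add: ideal_isideal)
qed

lemma vanishing_ideal_minimal:
  assumes "isideal I" "\<And>f. homogeneous f \<Longrightarrow> \<forall>P\<in>Z. peval (rep_proj3 P) f = 0 \<Longrightarrow> f \<in> I"
  shows "vanishing_ideal Z \<subseteq> I"
proof -
  interpret R: ring PR by (rule ring_from_type_algebra)
  show ?thesis unfolding vanishing_ideal_def
    using assms by (intro R.genideal_minimal) (auto simp: ideal_isideal)
qed

lemma vanishing_ideal_gen:
  assumes "homogeneous f" "\<And>P. P \<in> Z \<Longrightarrow> peval (rep_proj3 P) f = 0"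
  shows "f \<in> vanishing_ideal Z"
proof -
  interpret R: ring PR by (rule ring_from_type_algebra)
  show ?thesis unfolding vanishing_ideal_def
    using assms R.genideal_self[of "{f. homogeneous f \<and> (\<forall>P\<in>Z. peval (rep_proj3 P) f = 0)}"] by auto
qed

lemma vanishing_ideal_forms:
  "vanishing_ideal Z \<inter> forms t = {F \<in> forms t. \<forall>P\<in>Z. peval (rep_proj3 P) F = 0}"
proof -
  have "isideal {f. \<forall>P\<in>Z. peval (rep_proj3 P) f = 0}"
    by (simp add: isideal_def peval_add peval_mult)
  then have "vanishing_ideal Z \<subseteq> {f. \<forall>P\<in>Z. peval (rep_proj3 P) f = 0}"
    by (rule vanishing_ideal_minimal) auto
  then have 1: "vanishing_ideal Z \<inter> forms t \<subseteq> {F \<in> forms t. \<forall>P\<in>Z. peval (rep_proj3 P) F = 0}"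
    by blast
  have "F \<in> vanishing_ideal Z" if "F \<in> forms t" "\<forall>P\<in>Z. peval (rep_proj3 P) F = 0" for F
    using that by (intro vanishing_ideal_gen) (auto simp: homogeneous_def)
  then show ?thesis using 1 by (intro equalityI) (simp_all add: subset_iff)
qed

lemma ideal_power_0: "ideal_power I 0 = UNIV"
  by (simp add: ideal_power_def ideals_set_def nat_pow_def)

lemma ideal_power_Suc: "ideal_power I (Suc k) = ideal_prod PR (ideal_power I k) I"
  by (simp add: ideal_power_def ideals_set_def nat_pow_def)

lemma ideal_power_mult_power:
  assumes "a \<in> ideal_power I j" "y \<in> I"
  shows "a * y ^ k \<in> ideal_power I (j + k)"
proof (induction k)
  case (Suc k)
  have "(a * y ^ k) * y \<in> ideal_power I (Suc (j + k))"
    unfolding ideal_power_Suc using ideal_prod.prod[OF Suc assms(2), of PR] by simp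
  then show ?case by (simp add: ac_simps)
qed (use assms in simp)

text \<open>Vanishing to order \<open>k\<close> at \<open>q\<close>, measured along lines through \<open>q\<close>.\<close>

definition order_ge :: "(4 \<Rightarrow> complex) \<Rightarrow> nat \<Rightarrow> poly4 \<Rightarrow> bool" where
  "order_ge q k F \<longleftrightarrow> (\<forall>x. \<exists>R. \<forall>\<epsilon>. peval (\<lambda>i. q i + \<epsilon> * x i) F = \<epsilon> ^ k * poly R \<epsilon>)"

lemma order_ge_0: "order_ge q 0 F"
  using line_poly_peval[of F] by (auto simp: order_ge_def line_poly_def)

lemma order_ge_add: "order_ge q k F \<Longrightarrow> order_ge q k G \<Longrightarrow> order_ge q k (F + G)"
  unfolding order_ge_def
proof
  fix x
  assume F: "\<forall>x. \<exists>R. \<forall>\<epsilon>. peval (\<lambda>i. q i + \<epsilon> * x i) F = \<epsilon> ^ k * poly R \<epsilon>"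
    and G: "\<forall>x. \<exists>R. \<forall>\<epsilon>. peval (\<lambda>i. q i + \<epsilon> * x i) G = \<epsilon> ^ k * poly R \<epsilon>"
  obtain R where R: "\<forall>\<epsilon>. peval (\<lambda>i. q i + \<epsilon> * x i) F = \<epsilon> ^ k * poly R \<epsilon>"
    using F[rule_format, of x] by (rule exE)
  obtain S where S: "\<forall>\<epsilon>. peval (\<lambda>i. q i + \<epsilon> * x i) G = \<epsilon> ^ k * poly S \<epsilon>"
    using G[rule_format, of x] by (rule exE)
  show "\<exists>R. \<forall>\<epsilon>. peval (\<lambda>i. q i + \<epsilon> * x i) (F + G) = \<epsilon> ^ k * poly R \<epsilon>"
    by (rule exI[of _ "R + S"]) (simp add: peval_add R S distrib_left)
qed

lemma order_ge_mult:
  assumes "order_ge q k F" "order_ge q l G"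
  shows "order_ge q (k + l) (F * G)"
  unfolding order_ge_def
proof
  fix x
  obtain R where R: "\<forall>\<epsilon>. peval (\<lambda>i. q i + \<epsilon> * x i) F = \<epsilon> ^ k * poly R \<epsilon>"
    using assms(1)[unfolded order_ge_def, rule_format, of x] by (rule exE)
  obtain S where S: "\<forall>\<epsilon>. peval (\<lambda>i. q i + \<epsilon> * x i) G = \<epsilon> ^ l * poly S \<epsilon>"
    using assms(2)[unfolded order_ge_def, rule_format, of x] by (rule exE)
  show "\<exists>R. \<forall>\<epsilon>. peval (\<lambda>i. q i + \<epsilon> * x i) (F * G) = \<epsilon> ^ (k + l) * poly R \<epsilon>"
    by (rule exI[of _ "R * S"]) (simp add: peval_mult power_add R S ac_simps)
qed

lemma order_ge_vanishing_ideal: "F \<in> vanishing_ideal {P} \<Longrightarrow> order_ge (rep_proj3 P) 1 F"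
proof -
  let ?q = "rep_proj3 P"
  have "isideal {F. order_ge ?q 1 F}"
    unfolding isideal_def
  proof (intro conjI ballI allI)
    show "0 \<in> {F. order_ge ?q 1 F}" by (auto simp: order_ge_def intro!: exI[of _ 0])
    fix F G assume "F \<in> {F. order_ge ?q 1 F}"
    then show "G * F \<in> {F. order_ge ?q 1 F}" using order_ge_mult[OF order_ge_0[of ?q G], of 1 F] by simp
  qed (simp add: order_ge_add)
  then have "vanishing_ideal {P} \<subseteq> {F. order_ge ?q 1 F}"
  proof (rule vanishing_ideal_minimal)
    fix f assume f: "\<forall>P'\<in>{P}. peval (rep_proj3 P') f = 0"
    have "\<exists>R. \<forall>\<epsilon>. peval (\<lambda>i. ?q i + \<epsilon> * x i) f = \<epsilon> ^ 1 * poly R \<epsilon>" for x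
    proof -
      obtain S where S: "\<And>\<epsilon>. peval (\<lambda>i. ?q i + \<epsilon> * x i) f = poly S \<epsilon>"
        using line_poly_peval[of f] unfolding line_poly_def by metis
      have "poly S 0 = 0" using S[of 0] f by simp
      then obtain R where "S = [:- 0, 1:] * R" unfolding poly_eq_0_iff_dvd by (rule dvdE)
      then have "poly S \<epsilon> = \<epsilon> ^ 1 * poly R \<epsilon>" for \<epsilon> by simp
      then show ?thesis using S by metis
    qed
    then show "f \<in> {F. order_ge ?q 1 F}" by (simp add: order_ge_def)
  qed
  then show "F \<in> vanishing_ideal {P} \<Longrightarrow> order_ge ?q 1 F" by blast
qed

lemma order_ge_ideal_power:
  "F \<in> ideal_power (vanishing_ideal {P}) k \<Longrightarrow> order_ge (rep_proj3 P) k F"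
proof (induction k arbitrary: F)
  case 0
  show ?case by (rule order_ge_0)
next
  case (Suc k)
  have "F \<in> ideal_prod PR (ideal_power (vanishing_ideal {P}) k) (vanishing_ideal {P})"
    using Suc.prems by (simp add: ideal_power_Suc)
  then show ?case
  proof (induction rule: ideal_prod.induct)
    case (prod i j)
    then show ?case
      using order_ge_mult[OF Suc.IH order_ge_vanishing_ideal, of i j] by simp
  next
    case (sum a b)
    then show ?case by (simp add: order_ge_add)
  qed
qed

text \<open>
  Along \<open>q + \<epsilon> x\<close> the form is a polynomial of degree at most \<open>d\<close> divisible by \<open>\<epsilon>\<^sup>d\<close>, hence
  \<open>c \<epsilon>\<^sup>d\<close>. By homogeneity the restriction to \<open>x + s q\<close> is then equal to \<open>c\<close> for all \<open>s \<noteq> 0\<close>,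
  hence for all \<open>s\<close>.
\<close>

lemma order_ge_is_cone:
  assumes F: "F \<in> forms d" and o: "order_ge q d F"
  shows "is_cone d q F"
  unfolding is_cone_def
proof (intro conjI allI F)
  fix x s
  obtain R where R: "\<forall>\<epsilon>. peval (\<lambda>i. q i + \<epsilon> * x i) F = \<epsilon> ^ d * poly R \<epsilon>"
    using o[unfolded order_ge_def, rule_format, of x] by (rule exE)
  have "poly (line_form q x d F) \<epsilon> = poly (Polynomial.monom 1 d * R) \<epsilon>" for \<epsilon>
    by (simp add: poly_line_form[OF F] R poly_monom)
  then have eq: "line_form q x d F = Polynomial.monom 1 d * R"
    by (simp add: poly_eq_poly_eq_iff[symmetric] fun_eq_iff)
  have "degree R = 0"
  proof (cases "R = 0")
    case False
    then have "degree (Polynomial.monom 1 d * R) = d + degree R"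
      by (subst degree_mult_eq) (auto simp: degree_monom_eq)
    then show ?thesis using degree_line_form[of q x d F] eq by simp
  qed simp
  then obtain c where c: "R = [:c:]" by (rule degree_eq_zeroE)
  have nz: "peval (\<lambda>i. x i + s * q i) F = c" if "s \<noteq> 0" for s
  proof -
    have "(\<lambda>i. x i + s * q i) = (\<lambda>i. s * (q i + (1 / s) * x i))" 
      using that by (intro ext) (simp add: distrib_left)
    then have "peval (\<lambda>i. x i + s * q i) F = s ^ d * ((1 / s) ^ d * c)"
      using peval_forms_scale[OF F, of s "\<lambda>i. q i + (1 / s) * x i"] R[rule_format, of "1 / s"] c
      by (simp only:) simp
    then show ?thesis using that by (simp add: power_divide)
  qed
  have "line_form x q d F - [:c:] = 0"
  proof (rule ccontr)
    assume "line_form x q d F - [:c:] \<noteq> 0"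
    then have "finite {s. poly (line_form x q d F - [:c:]) s = 0}" by (rule poly_roots_finite)
    moreover have "UNIV - {0} \<subseteq> {s. poly (line_form x q d F - [:c:]) s = 0}"
      using nz by (auto simp: poly_line_form[OF F])
    ultimately have "finite (UNIV - {0} :: complex set)" by (rule rev_finite_subset)
    then show False using infinite_UNIV_char_0[where 'a = complex] by simp
  qed
  then have "poly (line_form x q d F) s = poly (line_form x q d F) 0" by simp
  then show "peval (\<lambda>i. x i + s * q i) F = peval x F" by (simp add: poly_line_form[OF F])
qed

lemma rep_proj3_nonzero: "\<exists>k. rep_proj3 P k \<noteq> 0"
proof -
  have "proportional (rep_proj3 P) (rep_proj3 P)" by (rule Quotient3_rep_reflp[OF Quotient3_proj3])
  then show ?thesis by (auto simp: proportional_def fun_eq_iff)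
qed

text \<open>
  A cone with vertex \<open>q\<close> is a polynomial in the linear forms \<open>x\<^sub>i - (q\<^sub>i / q\<^sub>k) x\<^sub>k\<close>, which vanish at \<open>q\<close>.
\<close>

lemma cone_in_ideal_power:
  assumes c: "is_cone d (rep_proj3 P) F"
  shows "F \<in> ideal_power (vanishing_ideal {P}) d"
proof -
  let ?q = "rep_proj3 P" and ?I = "vanishing_ideal {P}"
  have F: "F \<in> forms d" using c by (simp add: is_cone_def)
  obtain k where k: "?q k \<noteq> 0" using rep_proj3_nonzero by blast
  define y where "y i = var i - const (?q i / ?q k) * var k" for i
  have yI: "y i \<in> ?I" for i
  proof (rule vanishing_ideal_gen)
    have "y i \<in> forms 1"
      unfolding y_def by (intro forms_diff forms_const_mult forms_single) simp_all
    then show "homogeneous (y i)" by (auto simp: homogeneous_def)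
  qed (use k in \<open>simp add: y_def peval_diff peval_mult\<close>)
  define Y where "Y m = 1 * y 0 ^ lk m 0 * y 1 ^ lk m 1 * y 2 ^ lk m 2 * y 3 ^ lk m 3" for m :: mon4
  define G where "G = (\<Sum>m\<in>ks F. const (lk F m) * Y m)"
  have "F - G = 0"
  proof (rule peval_eq_0_imp)
    fix v
    define w where "w = (\<lambda>i. v i + (- (v k / ?q k)) * ?q i)"
    have "peval v (y i) = w i" for i
      by (simp add: y_def w_def peval_diff peval_mult)
    then have "peval v (Y m) = monomial_val w m" for m
      by (simp add: Y_def peval_mult peval.hom_power monomial_val_4)
    then have "peval v G = peval w F" by (simp add: G_def peval_sum peval_mult peval_def[of w F])
    also have "\<dots> = peval v F" using c unfolding w_def is_cone_def by blast
    finally show "peval v (F - G) = 0" by (simp add: peval_diff)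
  qed
  then have FG: "F = G" by simp
  have Ym: "Y m \<in> ideal_power ?I d" if "m \<in> ks F" for m
  proof -
    have "1 \<in> ideal_power ?I 0" by (simp add: ideal_power_0)
    then have "Y m \<in> ideal_power ?I (0 + lk m 0 + lk m 1 + lk m 2 + lk m 3)"
      unfolding Y_def by (intro ideal_power_mult_power yI)
    moreover have "0 + lk m 0 + lk m 1 + lk m 2 + lk m 3 = d"
      using that F by (simp add: forms_def mdeg_4)
    ultimately show ?thesis by simp
  qed
  have "isideal (ideal_power ?I d)"
  proof (induction d)
    case 0
    show ?case by (simp add: ideal_power_0 isideal_def)
  next
    case (Suc d)
    then show ?case
      using cring.axioms(1)[OF cring_from_type_algebra] ring.ideal_prod_is_ideal[OF ring_from_type_algebra]
        isideal_vanishing_ideal[of "{P}"]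
      unfolding ideal_power_Suc ideal_isideal[symmetric] by blast
  qed
  then have "G \<in> ideal_power ?I d"
    unfolding G_def using Ym by (intro isideal_sum isidealD(3))
  then show ?thesis by (rule ssubst[OF FG])
qed

lemma ideal_power_forms: "ideal_power (vanishing_ideal {P}) d \<inter> forms d = {F. is_cone d (rep_proj3 P) F}"
  using order_ge_is_cone order_ge_ideal_power cone_in_ideal_power
  by (auto simp: is_cone_def)

text \<open>
  Positivity of the dimension is what matters, because the generic dimension will be zero.
\<close>

lemma cone_dim_pos_iff:
  "cone_dim d Z P > 0 \<longleftrightarrow>
    (\<exists>F. F \<noteq> 0 \<and> is_cone d (rep_proj3 P) F \<and> (\<forall>P'\<in>Z. peval (rep_proj3 P') F = 0))"
proof -
  define K where "K = {F. is_cone d (rep_proj3 P) F \<and> (\<forall>P'\<in>Z. peval (rep_proj3 P') F = 0)}"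
  have "vanishing_ideal Z \<inter> ideal_power (vanishing_ideal {P}) d \<inter> forms d
      = (vanishing_ideal Z \<inter> forms d) \<inter> (ideal_power (vanishing_ideal {P}) d \<inter> forms d)" by blast
  also have "\<dots> = K" unfolding vanishing_ideal_forms ideal_power_forms K_def by (auto simp: is_cone_def)
  finally have cd: "cone_dim d Z P = poly_vs.dim K" by (simp add: cone_dim_def)
  obtain B where B: "B \<subseteq> K" "poly_vs.independent B" "K \<subseteq> poly_vs.span B"
    using poly_vs.maximal_independent_subset by blast
  have "K \<subseteq> poly_vs.span ((\<lambda>m. sg m 1) ` {m. mdeg m = d})"
    unfolding single_basis(3)[OF finite_mdeg] by (auto simp: K_def is_cone_def forms_def)
  then have "finite B"
    using poly_vs.independent_span_bound[OF _ B(2)] B(1) finite_mdeg by blast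
  moreover have "card B = poly_vs.dim K" using B by (intro poly_vs.basis_card_eq_dim)
  moreover have "B = {} \<longleftrightarrow> (\<forall>F\<in>K. F = 0)"
  proof
    assume "B = {}"
    then show "\<forall>F\<in>K. F = 0" using B(3) by auto
  next
    assume "\<forall>F\<in>K. F = 0"
    then have "B \<subseteq> {0}" using B(1) by blast
    then show "B = {}" using B(2) poly_vs.dependent_zero by blast
  qed
  ultimately have "cone_dim d Z P > 0 \<longleftrightarrow> (\<exists>F\<in>K. F \<noteq> 0)"
    unfolding cd by (metis card_gt_0_iff)
  then show ?thesis by (auto simp: K_def)
qed

section \<open>Interpolation matrices\<close>

lemma set_monomials: "set (monomials d) = {m. mdeg m = d}"
  by (simp add: monomials_def finite_mdeg)

lemma distinct_monomials: "distinct (monomials d)"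
  by (simp add: monomials_def)

lemma length_monomials: "length (monomials d) = (d + 3) choose 3"
  using distinct_card[OF distinct_monomials, of d] by (simp add: set_monomials card_mdeg)

lemma nth_monomials: "j < length (monomials d) \<Longrightarrow> mdeg (monomials d ! j) = d"
  using nth_mem[of j "monomials d"] by (simp add: set_monomials)

lemma monomials_nth_ex: "mdeg m = d \<Longrightarrow> \<exists>j<length (monomials d). m = monomials d ! j"
proof -
  assume "mdeg m = d"
  then have "m \<in> set (monomials d)" by (simp only: set_monomials mem_Collect_eq)
  then obtain j where "j < length (monomials d)" "monomials d ! j = m"
    unfolding in_set_conv_nth by blast
  then show ?thesis by blast
qed

lemma sum_monomials: "(\<Sum>j<length (monomials d). f (monomials d ! j)) = (\<Sum>m | mdeg m = d. f m)"
proof -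
  have "bij_betw (\<lambda>j. monomials d ! j) {..<length (monomials d)} {m. mdeg m = d}"
    using bij_betw_nth[OF distinct_monomials refl, of "set (monomials d)" d] by (simp add: set_monomials)
  then show ?thesis by (rule sum.reindex_bij_betw)
qed

text \<open>
  The interpolation matrix with arbitrary vectors as points, so that its minors can be evaluated
  at any values of the coordinates.
\<close>

definition vec_matrix :: "nat \<Rightarrow> nat \<Rightarrow> (nat \<Rightarrow> 4 \<Rightarrow> complex) \<Rightarrow> poly4 mat" where
  "vec_matrix d r v = mat (r + length (monomials (d - 1))) (length (monomials d))
     (\<lambda>(i, j). if i < r then const (monomial_val (v i) (monomials d ! j))
               else iterated_deriv (monomials (d - 1) ! (i - r)) (sg (monomials d ! j) 1))"

lemma interpolation_matrix_vec:
  "interpolation_matrix d Ps = vec_matrix d (length Ps) (\<lambda>i. rep_proj3 (Ps ! i))"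
  by (simp only: interpolation_matrix_def vec_matrix_def Let_def)

lemma vec_matrix_carrier:
  "vec_matrix d r v \<in> carrier_mat (r + length (monomials (d - 1))) (length (monomials d))"
  by (simp add: vec_matrix_def)

lemma iterated_deriv_forms:
  assumes "Suc (mdeg m) = mdeg M"
  shows "iterated_deriv m (sg M 1) \<in> forms 1"
proof (cases "\<exists>i. M = m + sg i 1")
  case True
  then obtain i where M: "M = m + sg i 1" by blast
  show ?thesis unfolding M deriv_entry_one_more by (rule forms_single) simp
next
  case False
  then show ?thesis using deriv_entry_other[of M m] assms by simp
qed

lemma vec_matrix_entries:
  assumes "0 < d" "j < length (monomials d)"
  shows "i < r \<Longrightarrow> vec_matrix d r v $$ (i, j) = const (monomial_val (v i) (monomials d ! j))"
    and "r \<le> i \<Longrightarrow> i < r + length (monomials (d - 1)) \<Longrightarrow>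
      vec_matrix d r v $$ (i, j) = iterated_deriv (monomials (d - 1) ! (i - r)) (sg (monomials d ! j) 1)"
    and "r \<le> i \<Longrightarrow> i < r + length (monomials (d - 1)) \<Longrightarrow> vec_matrix d r v $$ (i, j) \<in> forms 1"
proof -
  show "i < r \<Longrightarrow> vec_matrix d r v $$ (i, j) = const (monomial_val (v i) (monomials d ! j))"
    using assms by (simp add: vec_matrix_def)
  show e: "vec_matrix d r v $$ (i, j) = iterated_deriv (monomials (d - 1) ! (i - r)) (sg (monomials d ! j) 1)"
    if "r \<le> i" "i < r + length (monomials (d - 1))"
    using assms that by (simp add: vec_matrix_def)
  show "vec_matrix d r v $$ (i, j) \<in> forms 1" if "r \<le> i" "i < r + length (monomials (d - 1))"
    unfolding e[OF that] using assms that nth_monomials[of "i - r" "d - 1"] nth_monomials[of j d]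
    by (intro iterated_deriv_forms) auto
qed

definition form_of :: "nat \<Rightarrow> (nat \<Rightarrow> complex) \<Rightarrow> poly4" where
  "form_of d c = (\<Sum>j<length (monomials d). sg (monomials d ! j) (c j))"

lemma lk_form_of: "j < length (monomials d) \<Longrightarrow> lk (form_of d c) (monomials d ! j) = c j"
proof -
  assume j: "j < length (monomials d)"
  have "lk (form_of d c) (monomials d ! j) = (\<Sum>k<length (monomials d). if k = j then c k else 0)"
    unfolding form_of_def lookup_sum
    using j nth_eq_iff_index_eq[OF distinct_monomials] by (intro sum.cong) (auto simp: lookup_single when_def)
  then show ?thesis using j by simp
qed

lemma form_of_forms: "form_of d c \<in> forms d"
  unfolding form_of_def by (intro forms_sum forms_single) (simp add: nth_monomials)

lemma form_of_lk:
  assumes "F \<in> forms d"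
  shows "form_of d (\<lambda>j. lk F (monomials d ! j)) = F"
proof (rule poly_mapping_eqI)
  fix m
  show "lk (form_of d (\<lambda>j. lk F (monomials d ! j))) m = lk F m"
  proof (cases "mdeg m = d")
    case True
    then obtain j where j: "j < length (monomials d)" "m = monomials d ! j"
      using monomials_nth_ex by blast
    show ?thesis unfolding j(2) lk_form_of[OF j(1)] ..
  next
    case False
    then have "lk G m = 0" if "G \<in> forms d" for G using that by (auto simp: forms_def in_keys_iff)
    then show ?thesis using assms form_of_forms by simp
  qed
qed

text \<open>
  The columns of the matrix at \<open>q\<close> are indexed by the coefficients of a form of degree \<open>d\<close>; its
  kernel consists of the cones with vertex \<open>q\<close> through the given points.  The row \<open>i0\<close> of one point
  may be left out; any \<open>i0 \<ge> r\<close> leaves out none.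
\<close>

lemma kernel_iff_cone:
  assumes d: "0 < d"
  shows "(\<forall>k<r + length (monomials (d - 1)). \<not> (k = i0 \<and> k < r) \<longrightarrow>
      (\<Sum>j<length (monomials d). peval q (vec_matrix d r v $$ (k, j)) * c j) = 0)
    \<longleftrightarrow> is_cone d q (form_of d c) \<and> (\<forall>i<r. i \<noteq> i0 \<longrightarrow> peval (v i) (form_of d c) = 0)"
proof -
  let ?F = "form_of d c" and ?S = "\<lambda>k. \<Sum>j<length (monomials d). peval q (vec_matrix d r v $$ (k, j)) * c j"
  have top: "?S k = peval (v k) ?F" if "k < r" for k
    unfolding form_of_def peval_sum using that d
    by (intro sum.cong) (simp_all add: vec_matrix_entries(1))
  have bottom: "?S (r + l) = mfact (monomials (d - 1) ! l) * dcoeff q ?F (monomials (d - 1) ! l)"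
    if l: "l < length (monomials (d - 1))" for l
  proof -
    let ?m = "monomials (d - 1) ! l"
    have "?S (r + l) = (\<Sum>j<length (monomials d). lk ?F (monomials d ! j) * peval q (iterated_deriv ?m (sg (monomials d ! j) 1)))"
      using l d by (intro sum.cong) (simp_all add: vec_matrix_entries(2) lk_form_of)
    also have "\<dots> = (\<Sum>M | mdeg M = d. lk ?F M * peval q (iterated_deriv ?m (sg M 1)))"
      by (rule sum_monomials)
    also have "\<dots> = mfact ?m * dcoeff q ?F ?m"
      using nth_monomials[OF l] d by (intro derivs_eq_dcoeff) simp
    finally show ?thesis .
  qed
  have "is_cone d q ?F \<longleftrightarrow> (\<forall>l<length (monomials (d - 1)). ?S (r + l) = 0)"
    unfolding is_cone_iff_dcoeff[OF d form_of_forms]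
  proof (intro iffI allI impI)
    fix l assume "\<forall>m. mdeg m = d - 1 \<longrightarrow> dcoeff q ?F m = 0" and l: "l < length (monomials (d - 1))"
    then show "?S (r + l) = 0" unfolding bottom[OF l] using nth_monomials[OF l] by simp
  next
    fix m :: mon4 assume z: "\<forall>l<length (monomials (d - 1)). ?S (r + l) = 0" and "mdeg m = d - 1"
    then obtain l where l: "l < length (monomials (d - 1))" "m = monomials (d - 1) ! l"
      using monomials_nth_ex[of m "d - 1"] by auto
    have "?S (r + l) = 0" using z l(1) by blast
    then show "dcoeff q ?F m = 0" unfolding bottom[OF l(1)] l(2)[symmetric] using mfact_nonzero by simp
  qed
  also have "\<dots> \<longleftrightarrow> (\<forall>k<r + length (monomials (d - 1)). r \<le> k \<longrightarrow> ?S k = 0)"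
  proof (intro iffI allI impI)
    fix k assume z: "\<forall>l<length (monomials (d - 1)). ?S (r + l) = 0"
      and k: "k < r + length (monomials (d - 1))" "r \<le> k"
    have "?S (r + (k - r)) = 0" by (rule z[rule_format]) (use k in linarith)
    then show "?S k = 0" using k(2) by (simp only: le_add_diff_inverse)
  next
    fix l assume z: "\<forall>k<r + length (monomials (d - 1)). r \<le> k \<longrightarrow> ?S k = 0"
      and l: "l < length (monomials (d - 1))"
    show "?S (r + l) = 0" by (rule z[rule_format]) (use l in linarith)+
  qed
  finally have 1: "is_cone d q ?F \<longleftrightarrow> (\<forall>k<r + length (monomials (d - 1)). r \<le> k \<longrightarrow> ?S k = 0)" .
  have 2: "(\<forall>i<r. i \<noteq> i0 \<longrightarrow> peval (v i) ?F = 0) \<longleftrightarrow> (\<forall>k<r. k \<noteq> i0 \<longrightarrow> ?S k = 0)"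
    using top by simp
  define n' where "n' = length (monomials (d - 1))"
  have "(\<forall>k<r + n'. \<not> (k = i0 \<and> k < r) \<longrightarrow> Z k) \<longleftrightarrow>
      (\<forall>k<r + n'. r \<le> k \<longrightarrow> Z k) \<and> (\<forall>k<r. k \<noteq> i0 \<longrightarrow> Z k)" for Z :: "nat \<Rightarrow> bool"
  proof (intro iffI conjI allI impI)
    fix k assume "(\<forall>k<r + n'. r \<le> k \<longrightarrow> Z k) \<and> (\<forall>k<r. k \<noteq> i0 \<longrightarrow> Z k)" "k < r + n'" "\<not> (k = i0 \<and> k < r)"
    then show "Z k" by (cases "r \<le> k") auto
  qed auto
  then show ?thesis unfolding 1 2 n'_def .
qed

lemma form_of_eq_0_iff: "form_of d c = 0 \<longleftrightarrow> (\<forall>j<length (monomials d). c j = 0)"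
proof
  assume "form_of d c = 0"
  then show "\<forall>j<length (monomials d). c j = 0" using lk_form_of[of _ d c] by simp
qed (simp add: form_of_def)

definition no_cones :: "nat \<Rightarrow> nat \<Rightarrow> (nat \<Rightarrow> 4 \<Rightarrow> complex) \<Rightarrow> (4 \<Rightarrow> complex) \<Rightarrow> bool" where
  "no_cones d r v q \<longleftrightarrow> (\<forall>F. is_cone d q F \<longrightarrow> (\<forall>i<r. peval (v i) F = 0) \<longrightarrow> F = 0)"

lemma no_cones_kernel:
  assumes d: "0 < d" and nc: "no_cones d r v q"
    and z: "\<And>k. k < r + length (monomials (d - 1)) \<Longrightarrow>
      (\<Sum>j<length (monomials d). peval q (vec_matrix d r v $$ (k, j)) * y j) = 0"
    and j: "j < length (monomials d)"
  shows "y j = 0"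
proof -
  have "is_cone d q (form_of d y) \<and> (\<forall>i<r. i \<noteq> r \<longrightarrow> peval (v i) (form_of d y) = 0)"
    unfolding kernel_iff_cone[OF d, symmetric] using z by simp
  then have "form_of d y = 0" using nc unfolding no_cones_def by fastforce
  then show ?thesis using j by (simp add: form_of_eq_0_iff)
qed

text \<open>
  If all maximal minors vanish, then every adjoined column makes the determinant zero, and by
  injectivity every inhomogeneous system is solvable. So the matrix with a zero column adjoined
  has a right inverse, although its determinant is zero.
\<close>

lemma kernel_trivial_minor:
  fixes A :: "'a::field mat"
  assumes A: "A \<in> carrier_mat (Suc N) N"
    and triv: "\<And>y. (\<And>k. k < Suc N \<Longrightarrow> (\<Sum>b<N. A $$ (k, b) * y b) = 0) \<Longrightarrow> \<forall>b<N. y b = 0"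
  shows "\<exists>i<Suc N. det (row_del A i) \<noteq> 0"
proof (rule ccontr)
  assume "\<not> ?thesis"
  then have z: "det (adjoin_col v A) = 0" for v by (simp add: det_adjoin_col[OF A])
  have ad: "adjoin_col v A \<in> carrier_mat (Suc N) (Suc N)" for v using A by (simp add: adjoin_col_def)
  have surj: "\<exists>y. \<forall>k<Suc N. (\<Sum>b<N. A $$ (k, b) * y b) = v k" for v
  proof -
    obtain w where w: "w \<in> carrier_vec (Suc N)" "w \<noteq> 0\<^sub>v (Suc N)" "adjoin_col v A *\<^sub>v w = 0\<^sub>v (Suc N)"
      using z[of v] det_0_iff_vec_prod_zero[OF ad, of v] by blast
    have row: "v k * w $ 0 + (\<Sum>b<N. A $$ (k, b) * w $ Suc b) = 0" if k: "k < Suc N" for k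
    proof -
      have "(adjoin_col v A *\<^sub>v w) $ k = 0" using w(3) k by simp
      then have "(\<Sum>b<Suc N. adjoin_col v A $$ (k, b) * w $ b) = 0"
        using k A w(1) ad[of v] by (simp add: scalar_prod_def atLeast0LessThan del: sum.lessThan_Suc)
      then show ?thesis unfolding sum.lessThan_Suc_shift using k A by (simp add: adjoin_col_def)
    qed
    have w0: "w $ 0 \<noteq> 0"
    proof
      assume 0: "w $ 0 = 0"
      then have "\<forall>b<N. w $ Suc b = 0" using row by (intro triv) simp
      then have "w = 0\<^sub>v (Suc N)" using w(1) 0 by (intro eq_vecI) (auto simp: less_Suc_eq_0_disj)
      then show False using w(2) by simp
    qed
    have "(\<Sum>b<N. A $$ (k, b) * (- w $ Suc b / w $ 0)) = v k" if k: "k < Suc N" for k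
    proof -
      have "(\<Sum>b<N. A $$ (k, b) * (- w $ Suc b / w $ 0)) = - (\<Sum>b<N. A $$ (k, b) * w $ Suc b) / w $ 0"
        by (simp add: sum_negf sum_divide_distrib)
      also have "(\<Sum>b<N. A $$ (k, b) * w $ Suc b) = - (v k * w $ 0)"
        using row[OF k] by (simp add: eq_neg_iff_add_eq_0 add.commute)
      also have "- (- (v k * w $ 0)) / w $ 0 = v k" using w0 by simp
      finally show ?thesis .
    qed
    then have "\<forall>k<Suc N. (\<Sum>b<N. A $$ (k, b) * (- w $ Suc b / w $ 0)) = v k" by (intro allI impI)
    then show ?thesis by (rule exI[of _ "\<lambda>b. - w $ Suc b / w $ 0"])
  qed
  have "\<forall>l. \<exists>y. \<forall>k<Suc N. (\<Sum>b<N. A $$ (k, b) * y b) = (if k = l then 1 else 0)"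
    using surj[of "\<lambda>k. if k = l then 1 else 0" for l] by (rule allI)
  then have "\<exists>Y. \<forall>l. \<forall>k<Suc N. (\<Sum>b<N. A $$ (k, b) * Y l b) = (if k = l then 1 else 0)"
    by (rule choice)
  then obtain Y where Y: "\<forall>l. \<forall>k<Suc N. (\<Sum>b<N. A $$ (k, b) * Y l b) = (if k = l then 1 else 0)"
    by (rule exE)
  define B where "B = mat (Suc N) (Suc N) (\<lambda>(b, l). if b = 0 then 0 else Y l (b - 1))"
  have B: "B \<in> carrier_mat (Suc N) (Suc N)" by (simp add: B_def)
  have "adjoin_col (\<lambda>_. 0) A * B = 1\<^sub>m (Suc N)"
  proof (rule eq_matI)
    fix k l assume kl: "k < dim_row (1\<^sub>m (Suc N) :: 'a mat)" "l < dim_col (1\<^sub>m (Suc N) :: 'a mat)"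
    then have "(adjoin_col (\<lambda>_. 0) A * B) $$ (k, l) = (\<Sum>b<Suc N. adjoin_col (\<lambda>_. 0) A $$ (k, b) * B $$ (b, l))"
      using ad[of "\<lambda>_. 0"] B by (simp add: scalar_prod_def atLeast0LessThan del: sum.lessThan_Suc)
    also have "\<dots> = (\<Sum>b<N. A $$ (k, b) * Y l b)"
      unfolding sum.lessThan_Suc_shift using kl A by (simp add: adjoin_col_def B_def)
    also have "\<dots> = 1\<^sub>m (Suc N) $$ (k, l)" using kl Y by simp
    finally show "(adjoin_col (\<lambda>_. 0) A * B) $$ (k, l) = 1\<^sub>m (Suc N) $$ (k, l)" .
  qed (use ad B in auto)
  then have "det (adjoin_col (\<lambda>_. 0) A) * det B = 1"
    using det_mult[OF ad B, of "\<lambda>_. 0"] by simp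
  then show False using z by simp
qed

section \<open>Points that meet all cones with vertex on a line\<close>

text \<open>
  The point with parameter \<open>Some t\<close> or \<open>None\<close> runs through the projective line \<open>x\<^sub>0 = x\<^sub>1 = 0\<close>.  The
  function \<open>cone_coord\<close> is a linear form that completes \<open>x\<^sub>0\<close> and \<open>x\<^sub>1\<close> to coordinates of the
  projection from this point.
\<close>

fun vertex :: "complex option \<Rightarrow> 4 \<Rightarrow> complex" where
  "vertex (Some t) = line_pt t"
| "vertex None = (\<lambda>i. if i = 3 then 1 else 0)"

fun cone_coord :: "complex option \<Rightarrow> (4 \<Rightarrow> complex) \<Rightarrow> complex" where
  "cone_coord (Some t) p = p 3 - t * p 2"
| "cone_coord None p = p 2"

definition cone_mon :: "complex option \<Rightarrow> (4 \<Rightarrow> complex) \<Rightarrow> nat \<times> nat \<times> nat \<Rightarrow> complex" where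
  "cone_mon \<tau> p = (\<lambda>(a, b, e). p 0 ^ a * p 1 ^ b * cone_coord \<tau> p ^ e)"

definition triples :: "nat \<Rightarrow> (nat \<times> nat \<times> nat) list" where
  "triples d = (SOME xs. set xs = {(a, b, e). a + b + e = d} \<and> distinct xs)"

lemma triples_image:
  fixes d :: nat
  shows "{(a, b, e). a + b + e = d} = (\<lambda>(a, b). (a, b, d - a - b)) ` (SIGMA a:{..d}. {..d - a})" (is "?L = ?R")
proof
  show "?L \<subseteq> ?R"
  proof
    fix x assume "x \<in> ?L"
    then obtain a b e where x: "x = (a, b, e)" "a + b + e = d" by auto
    have "(a, b) \<in> (SIGMA a:{..d}. {..d - a})" "x = (a, b, d - a - b)" unfolding x(1) x(2)[symmetric] by auto
    then show "x \<in> ?R" by (intro image_eqI[of _ _ "(a, b)"]) (simp_all only: prod.case)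
  qed
qed auto

lemma triples: "set (triples d) = {(a, b, e). a + b + e = d} \<and> distinct (triples d)"
proof -
  have "finite {(a, b, e :: nat). a + b + e = d}" unfolding triples_image by auto
  then show ?thesis unfolding triples_def by (rule someI_ex[OF finite_distinct_list])
qed

lemma set_triples: "set (triples d) = {(a, b, e). a + b + e = d}"
  and distinct_triples: "distinct (triples d)"
  using triples by auto

lemma length_triples: "length (triples d) = (d + 2) choose 2"
proof -
  have "length (triples d) = card (set (triples d))" by (rule distinct_card[OF distinct_triples, symmetric])
  also have "\<dots> = card (SIGMA a:{..d}. {..d - a})"
    unfolding set_triples triples_image by (rule card_image) (auto simp: inj_on_def)
  also have "\<dots> = (\<Sum>a\<le>d. Suc (d - a))" by simp
  also have "\<dots> = (\<Sum>a\<le>d. Suc a)"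
    by (rule sum.reindex_bij_witness[of _ "\<lambda>a. d - a" "\<lambda>a. d - a"]) auto
  also have "\<dots> = (d + 2) choose 2" by (induction d) (simp_all add: numeral_2_eq_2)
  finally show ?thesis .
qed

text \<open>
  The interpolation determinant of plane curves of degree \<open>d\<close> at the projections of the points
  from the vertex.
\<close>

definition plane_det :: "nat \<Rightarrow> complex option \<Rightarrow> (4 \<Rightarrow> complex) list \<Rightarrow> complex" where
  "plane_det d \<tau> ps = det (mat (length (triples d)) (length (triples d))
     (\<lambda>(i, j). cone_mon \<tau> (ps ! i) (triples d ! j)))"

text \<open>
  Translate \<open>p\<close> along the vertex until its coordinate \<open>x\<^sub>2\<close>, or \<open>x\<^sub>3\<close> for the vertex at
  infinity, becomes zero. The remaining coordinates are the projected ones.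
\<close>

lemma cone_expansion:
  assumes c: "is_cone d (vertex \<tau>) F"
  shows "\<exists>g. \<forall>p. peval p F = (\<Sum>j<length (triples d). g j * cone_mon \<tau> p (triples d ! j))"
proof -
  have F: "F \<in> forms d" using c by (simp add: is_cone_def)
  have inv: "peval p F = peval (\<lambda>i. p i + s * vertex \<tau> i) F" for p s
    using c by (simp add: is_cone_def)
  have reindex: "(\<Sum>j<length (triples d). h (triples d ! j)) = (\<Sum>x\<in>{(a, b, e). a + b + e = d}. h x)"
    for h :: "_ \<Rightarrow> complex"
    using sum.reindex_bij_betw[OF bij_betw_nth[OF distinct_triples refl refl], of h d] by (simp add: set_triples)
  show ?thesis
  proof (cases \<tau>)
    case (Some t)
    define M where "M = {m \<in> {m :: mon4. mdeg m = d}. lk m 2 = 0}"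
    have "peval p F = (\<Sum>x\<in>{(a, b, e). a + b + e = d}. (case x of (a, b, e) \<Rightarrow> lk F (mon a b 0 e)) * cone_mon \<tau> p x)" for p
    proof -
      let ?w = "\<lambda>i. p i + (- p 2) * vertex \<tau> i"
      have "peval p F = (\<Sum>m | mdeg m = d. lk F m * monomial_val ?w m)"
        unfolding inv[of p "- p 2"] using F by (intro peval_superset finite_mdeg) (auto simp: forms_def)
      also have "\<dots> = (\<Sum>m\<in>M. lk F m * monomial_val ?w m)"
        unfolding M_def
        by (intro sum.mono_neutral_right finite_mdeg) (auto simp: Some monomial_val_4 power_0_left)
      also have "\<dots> = (\<Sum>x\<in>{(a, b, e). a + b + e = d}. (case x of (a, b, e) \<Rightarrow> lk F (mon a b 0 e)) * cone_mon \<tau> p x)"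
      proof (rule sum.reindex_bij_witness[of _ "\<lambda>(a, b, e). mon a b 0 e" "\<lambda>m. (lk m 0, lk m 1, lk m 3)"])
        fix m assume "m \<in> M"
        then have m: "lk m 2 = 0" "mdeg m = d" by (auto simp: M_def)
        have mm: "mon (lk m 0) (lk m 1) 0 (lk m 3) = m" by (rule mon_eqI) (use m in simp_all)
        then show "(case (lk m 0, lk m 1, lk m 3) of (a, b, e) \<Rightarrow> mon a b 0 e) = m" by simp
        show "(lk m 0, lk m 1, lk m 3) \<in> {(a, b, e). a + b + e = d}" using m by (simp add: mdeg_4)
        show "(case (lk m 0, lk m 1, lk m 3) of (a, b, e) \<Rightarrow> lk F (mon a b 0 e)) * cone_mon \<tau> p (lk m 0, lk m 1, lk m 3)
            = lk F m * monomial_val ?w m"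
          using m(1) by (simp add: mm cone_mon_def monomial_val_4 Some mult.commute)
      qed (auto simp: M_def)
      finally show ?thesis .
    qed
    then show ?thesis
      unfolding reindex[symmetric] by (intro exI[of _ "\<lambda>j. case triples d ! j of (a, b, e) \<Rightarrow> lk F (mon a b 0 e)"] allI)
  next
    case None
    define M where "M = {m \<in> {m :: mon4. mdeg m = d}. lk m 3 = 0}"
    have "peval p F = (\<Sum>x\<in>{(a, b, e). a + b + e = d}. (case x of (a, b, e) \<Rightarrow> lk F (mon a b e 0)) * cone_mon \<tau> p x)" for p
    proof -
      let ?w = "\<lambda>i. p i + (- p 3) * vertex \<tau> i"
      have "peval p F = (\<Sum>m | mdeg m = d. lk F m * monomial_val ?w m)"
        unfolding inv[of p "- p 3"] using F by (intro peval_superset finite_mdeg) (auto simp: forms_def)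
      also have "\<dots> = (\<Sum>m\<in>M. lk F m * monomial_val ?w m)"
        unfolding M_def
        by (intro sum.mono_neutral_right finite_mdeg) (auto simp: None monomial_val_4 power_0_left)
      also have "\<dots> = (\<Sum>x\<in>{(a, b, e). a + b + e = d}. (case x of (a, b, e) \<Rightarrow> lk F (mon a b e 0)) * cone_mon \<tau> p x)"
      proof (rule sum.reindex_bij_witness[of _ "\<lambda>(a, b, e). mon a b e 0" "\<lambda>m. (lk m 0, lk m 1, lk m 2)"])
        fix m assume "m \<in> M"
        then have m: "lk m 3 = 0" "mdeg m = d" by (auto simp: M_def)
        have mm: "mon (lk m 0) (lk m 1) (lk m 2) 0 = m" by (rule mon_eqI) (use m in simp_all)
        then show "(case (lk m 0, lk m 1, lk m 2) of (a, b, e) \<Rightarrow> mon a b e 0) = m" by simp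
        show "(lk m 0, lk m 1, lk m 2) \<in> {(a, b, e). a + b + e = d}" using m by (simp add: mdeg_4)
        show "(case (lk m 0, lk m 1, lk m 2) of (a, b, e) \<Rightarrow> lk F (mon a b e 0)) * cone_mon \<tau> p (lk m 0, lk m 1, lk m 2)
            = lk F m * monomial_val ?w m"
          using m(1) by (simp add: mm cone_mon_def monomial_val_4 None mult.commute)
      qed (auto simp: M_def)
      finally show ?thesis .
    qed
    then show ?thesis
      unfolding reindex[symmetric] by (intro exI[of _ "\<lambda>j. case triples d ! j of (a, b, e) \<Rightarrow> lk F (mon a b e 0)"] allI)
  qed
qed

text \<open>
  A cone is a plane curve in the projected coordinates, and the nonzero determinant says that no
  such curve passes through the projected points.
\<close>

lemma plane_det_no_cone:
  assumes c: "is_cone d (vertex \<tau>) F" and D: "plane_det d \<tau> ps \<noteq> 0" "length ps = length (triples d)"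
    and z: "\<And>p. p \<in> set ps \<Longrightarrow> peval p F = 0"
  shows "F = 0"
proof -
  let ?T = "length (triples d)"
  let ?M = "mat ?T ?T (\<lambda>(i, j). cone_mon \<tau> (ps ! i) (triples d ! j))"
  obtain g where g: "\<And>p. peval p F = (\<Sum>j<?T. g j * cone_mon \<tau> p (triples d ! j))"
    using cone_expansion[OF c] by blast
  have "?M *\<^sub>v vec ?T g = 0\<^sub>v ?T"
  proof (rule eq_vecI)
    fix i assume "i < dim_vec (0\<^sub>v ?T :: complex vec)"
    then have i: "i < ?T" by simp
    have "(?M *\<^sub>v vec ?T g) $ i = peval (ps ! i) F"
      using i by (simp add: g scalar_prod_def atLeast0LessThan mult.commute)
    also have "\<dots> = 0" using i D(2) by (intro z) simp
    finally show "(?M *\<^sub>v vec ?T g) $ i = 0\<^sub>v ?T $ i" using i by simp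
  qed simp
  then have "vec ?T g = 0\<^sub>v ?T"
    using D(1) det_0_iff_vec_prod_zero[OF mat_carrier, of ?T "\<lambda>(i, j). cone_mon \<tau> (ps ! i) (triples d ! j)"]
      vec_carrier[of ?T g] unfolding plane_det_def by blast
  then have "g j = 0" if "j < ?T" for j using that by (metis index_vec index_zero_vec(1))
  then have "peval p F = 0" for p by (simp add: g)
  then show ?thesis by (rule peval_eq_0_imp)
qed

text \<open>
  At the points with \<open>p\<^sub>0 = 1\<close>, \<open>p\<^sub>1 = 2\<^sup>i\<close> and last projected coordinate \<open>2\<^sup>i\<^sup>(\<^sup>d\<^sup>+\<^sup>1\<^sup>)\<close>, the
  \<open>i\<close>-th row consists of the \<open>i\<close>-th powers of the numbers \<open>2\<^sup>b\<^sup>+\<^sup>(\<^sup>d\<^sup>+\<^sup>1\<^sup>)\<^sup>e\<close>. These are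
  distinct, since \<open>b\<close> and \<open>e\<close> are the digits of the exponent in base \<open>d + 1\<close>, and the
  determinant is a Vandermonde determinant.
\<close>

lemma plane_det_nonzero_ex: "\<exists>ps. length ps = length (triples d) \<and> plane_det d \<tau> ps \<noteq> 0"
proof -
  let ?T = "length (triples d)"
  define pt :: "nat \<Rightarrow> 4 \<Rightarrow> complex" where "pt i = (\<lambda>k. if k = 0 then 1 else if k = 1 then 2 ^ i
    else if k = (if \<tau> = None then 2 else 3) then 2 ^ (i * Suc d) else 0)" for i
  define w where "w j = (case triples d ! j of (a, b, e) \<Rightarrow> (2::complex) ^ (b + Suc d * e))" for j
  have ent: "cone_mon \<tau> (pt i) (triples d ! j) = w j ^ i" for i j
  proof -
    obtain a b e where abe: "triples d ! j = (a, b, e)" by (cases "triples d ! j")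
    have "cone_coord \<tau> (pt i) = 2 ^ (i * Suc d)" by (cases \<tau>) (auto simp: pt_def)
    then show ?thesis
      by (simp only: cone_mon_def abe w_def prod.case) (simp add: pt_def power_add power_mult[symmetric] algebra_simps)
  qed
  have w_inj: "j = j'" if j: "j < ?T" "j' < ?T" and e: "w j = w j'" for j j'
  proof -
    obtain a b e where abe: "triples d ! j = (a, b, e)" by (cases "triples d ! j")
    obtain a' b' e' where abe': "triples d ! j' = (a', b', e')" by (cases "triples d ! j'")
    have s: "a + b + e = d" "a' + b' + e' = d"
      using nth_mem[OF j(1)] nth_mem[OF j(2)] abe abe' by (auto simp: set_triples)
    have "(2::complex) ^ (b + Suc d * e) = 2 ^ (b' + Suc d * e')" using e by (simp add: w_def abe abe')
    then have "of_nat (2 ^ (b + Suc d * e)) = (of_nat (2 ^ (b' + Suc d * e')) :: complex)" by simp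
    then have "(2::nat) ^ (b + Suc d * e) = 2 ^ (b' + Suc d * e')" by (simp only: of_nat_eq_iff)
    then have "b + Suc d * e = b' + Suc d * e'" by simp
    then have "b = b' \<and> e = e'" by (rule digits_unique[of b "Suc d" e b' e']) (use s in linarith)+
    then have "triples d ! j = triples d ! j'" using s abe abe' by auto
    then show ?thesis using nth_eq_iff_index_eq[OF distinct_triples j] by simp
  qed
  define M where "M = mat ?T ?T (\<lambda>(i, j). w j ^ i)"
  have M: "M \<in> carrier_mat ?T ?T" by (simp add: M_def)
  have "det M \<noteq> 0"
  proof
    assume "det M = 0"
    then have "det M\<^sup>T = 0" using det_transpose[OF M] by simp
    then obtain u where u: "u \<in> carrier_vec ?T" "u \<noteq> 0\<^sub>v ?T" "M\<^sup>T *\<^sub>v u = 0\<^sub>v ?T"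
      using det_0_iff_vec_prod_zero[of "M\<^sup>T" ?T] M by auto
    define p where "p = (\<Sum>i<?T. Polynomial.monom (u $ i) i)"
    have cp: "coeff p i = u $ i" if "i < ?T" for i
      using that by (simp add: p_def coeff_sum)
    have root: "poly p (w j) = 0" if j: "j < ?T" for j
    proof -
      have "(M\<^sup>T *\<^sub>v u) $ j = 0" using u(3) j by simp
      then have "(\<Sum>i<?T. w j ^ i * u $ i) = 0"
        using j u(1) by (simp add: M_def scalar_prod_def atLeast0LessThan)
      then show ?thesis by (simp add: p_def poly_sum poly_monom mult.commute)
    qed
    have "p \<noteq> 0"
    proof
      assume "p = 0"
      then have "u = 0\<^sub>v ?T" using cp u(1) by (intro eq_vecI) auto
      then show False using u(2) by simp
    qed
    moreover have "degree p < ?T"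
    proof -
      have "0 < ?T" using u by (cases "?T = 0") auto
      then show ?thesis unfolding p_def
        by (intro degree_sum_less) (auto intro: le_less_trans[OF degree_monom_le])
    qed
    moreover have "?T \<le> card {x. poly p x = 0}"
    proof -
      have "card (w ` {..<?T}) \<le> card {x. poly p x = 0}"
        using root poly_roots_finite[OF \<open>p \<noteq> 0\<close>] by (intro card_mono) auto
      moreover have "inj_on w {..<?T}" using w_inj by (auto simp: inj_on_def)
      ultimately show ?thesis by (simp add: card_image)
    qed
    ultimately show False using card_poly_roots_bound[of p] by simp
  qed
  moreover have "plane_det d \<tau> (map pt [0..<?T]) = det M"
    unfolding plane_det_def M_def by (intro arg_cong[of _ _ det] eq_matI) (auto simp: ent)
  ultimately show ?thesis by (intro exI[of _ "map pt [0..<?T]"]) simp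
qed

lemma line_poly_cone_mon: "line_poly (\<lambda>p. cone_mon \<tau> p x)"
  unfolding cone_mon_def
  by (cases x; cases \<tau>; simp)
     (intro line_poly_mult line_poly_power line_poly_coord line_poly_diff line_poly_const)+

lemma line_poly_plane_det: "line_poly (\<lambda>p. plane_det d \<tau> (ps @ p # es))"
  unfolding plane_det_def
proof (rule line_poly_det)
  fix i j
  show "line_poly (\<lambda>p. cone_mon \<tau> ((ps @ p # es) ! i) (triples d ! j))"
  proof (cases "i = length ps")
    case True
    then show ?thesis by (simp add: line_poly_cone_mon)
  next
    case False
    then have "(ps @ p # es) ! i = (ps @ es) ! (if i < length ps then i else i - 1)" for p
      by (auto simp: nth_append nth_Cons')
    then show ?thesis by (simp only: line_poly_const)
  qed
qed

text \<open>
  On the affine part of the line of vertices the determinant is a univariate polynomial in the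
  parameter.
\<close>

lemma plane_det_finite_zeros:
  assumes nz: "plane_det d (Some t0) ps \<noteq> 0"
  shows "finite {\<tau>. plane_det d \<tau> ps = 0}"
proof -
  have "line_poly (\<lambda>u :: unit \<Rightarrow> complex. plane_det d (Some (u ())) ps)"
    unfolding plane_det_def
  proof (rule line_poly_det)
    fix i j
    obtain a b e where abe: "triples d ! j = (a, b, e)" by (cases "triples d ! j")
    show "line_poly (\<lambda>u :: unit \<Rightarrow> complex. cone_mon (Some (u ())) (ps ! i) (triples d ! j))"
      unfolding cone_mon_def abe prod.case cone_coord.simps
      by (intro line_poly_mult line_poly_power line_poly_coord line_poly_diff line_poly_const)
  qed
  then have "\<exists>P. \<forall>s. plane_det d (Some (0 + s * 1)) ps = poly P s"
    unfolding line_poly_def by (elim allE[of _ "\<lambda>_. 0"] allE[of _ "\<lambda>_. 1"])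
  then obtain P where P: "\<And>s. plane_det d (Some (0 + s * 1)) ps = poly P s" by blast
  have "poly P t0 \<noteq> 0" using nz P[of t0] by simp
  then have "P \<noteq> 0" by auto
  then have "finite (insert None (Some ` {t. poly P t = 0}))" by (simp add: poly_roots_finite)
  moreover have "{\<tau>. plane_det d \<tau> ps = 0} \<subseteq> insert None (Some ` {t. poly P t = 0})"
  proof
    fix \<tau> assume "\<tau> \<in> {\<tau>. plane_det d \<tau> ps = 0}"
    then show "\<tau> \<in> insert None (Some ` {t. poly P t = 0})" using P by (cases \<tau>) auto
  qed
  ultimately show ?thesis by (rule rev_finite_subset)
qed

text \<open>
  Points are chosen one at a time, so that the conditions imposed on the cones are independent
  for all vertices on the line outside a finite set \<open>B\<close>, and for a vertex in \<open>B\<close> they become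
  independent after one point is omitted. Independence is expressed by an extension to a nonzero
  determinant. The new point is chosen general for one vertex outside \<open>B\<close> and for each of the
  finitely many reduced lists that belong to \<open>B\<close>; so a vertex where the full list fails loses
  only one point.
\<close>

lemma general_points_step:
  assumes "k \<le> length (triples d)"
  shows "\<exists>ps B. length ps = k \<and> finite B \<and>
    (\<forall>\<tau>. \<tau> \<notin> B \<longrightarrow> (\<exists>es. length ps + length es = length (triples d) \<and> plane_det d \<tau> (ps @ es) \<noteq> 0)) \<and>
    (\<forall>\<tau>\<in>B. \<exists>ps' es. Suc (length ps') = k \<and> set ps' \<subseteq> set ps \<and> length ps' + length es = length (triples d)
        \<and> plane_det d \<tau> (ps' @ es) \<noteq> 0)"
  using assms
proof (induction k)
  case 0
  show ?case using plane_det_nonzero_ex[of d] by (intro exI[of _ "[]"] exI[of _ "{}"]) simp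
next
  case (Suc k)
  let ?T = "length (triples d)"
  obtain ps B where IH: "length ps = k" "finite B"
    "\<And>\<tau>. \<tau> \<notin> B \<Longrightarrow> \<exists>es. length ps + length es = ?T \<and> plane_det d \<tau> (ps @ es) \<noteq> 0"
    "\<And>\<tau>. \<tau> \<in> B \<Longrightarrow> \<exists>ps' es. Suc (length ps') = k \<and> set ps' \<subseteq> set ps \<and> length ps' + length es = ?T
        \<and> plane_det d \<tau> (ps' @ es) \<noteq> 0"
    using Suc by (metis Suc_leD)
  have "finite (Some -` B)" using IH(2) by (intro finite_vimageI) auto
  then have "\<exists>t. t \<notin> Some -` B" by (rule ex_new_if_finite[OF infinite_UNIV_char_0])
  then obtain t0 where t0: "Some t0 \<notin> B" by auto
  have "\<exists>e es. length ps + length (e # es) = ?T \<and> plane_det d (Some t0) (ps @ e # es) \<noteq> 0"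
  proof -
    obtain es where es: "length ps + length es = ?T" "plane_det d (Some t0) (ps @ es) \<noteq> 0"
      using IH(3)[OF t0] by blast
    then show ?thesis using Suc.prems IH(1) by (cases es) auto
  qed
  then obtain e0 es0 where e0: "length ps + length (e0 # es0) = ?T" "plane_det d (Some t0) (ps @ e0 # es0) \<noteq> 0"
    by blast
  have "\<exists>ps' e es. Suc (length ps') = k \<and> set ps' \<subseteq> set ps \<and> length ps' + length (e # es) = ?T
        \<and> plane_det d \<tau> (ps' @ e # es) \<noteq> 0" if \<tau>: "\<tau> \<in> B" for \<tau>
  proof -
    obtain ps' es where "Suc (length ps') = k" "set ps' \<subseteq> set ps" "length ps' + length es = ?T"
        "plane_det d \<tau> (ps' @ es) \<noteq> 0" using IH(4)[OF \<tau>] by blast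
    then show ?thesis using Suc.prems by (cases es) auto
  qed
  then obtain qs e es where B: "\<And>\<tau>. \<tau> \<in> B \<Longrightarrow> Suc (length (qs \<tau>)) = k \<and> set (qs \<tau>) \<subseteq> set ps \<and>
      length (qs \<tau>) + length (e \<tau> # es \<tau>) = ?T \<and> plane_det d \<tau> (qs \<tau> @ e \<tau> # es \<tau>) \<noteq> 0"
    by metis
  define \<F> where "\<F> = insert (\<lambda>p. plane_det d (Some t0) (ps @ p # es0))
     ((\<lambda>\<tau> p. plane_det d \<tau> (qs \<tau> @ p # es \<tau>)) ` B)"
  have "\<exists>p. \<forall>f\<in>\<F>. f p \<noteq> 0"
  proof (rule common_nonzero)
    show "finite \<F>" using IH(2) by (simp add: \<F>_def)
    show "line_poly f" if "f \<in> \<F>" for f using that by (auto simp: \<F>_def line_poly_plane_det)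
    show "\<exists>p. f p \<noteq> 0" if "f \<in> \<F>" for f using that e0(2) B unfolding \<F>_def by blast
  qed
  then obtain p where p: "\<And>f. f \<in> \<F> \<Longrightarrow> f p \<noteq> 0" by blast
  have p0: "plane_det d (Some t0) (ps @ p # es0) \<noteq> 0" using p by (auto simp: \<F>_def)
  have pB: "plane_det d \<tau> (qs \<tau> @ p # es \<tau>) \<noteq> 0" if "\<tau> \<in> B" for \<tau> using p that by (auto simp: \<F>_def)
  define B' where "B' = {\<tau>. plane_det d \<tau> (ps @ p # es0) = 0}"
  have "\<exists>ps' es. Suc (length ps') = Suc k \<and> set ps' \<subseteq> set (ps @ [p]) \<and> length ps' + length es = ?T
        \<and> plane_det d \<tau> (ps' @ es) \<noteq> 0" for \<tau>
  proof (cases "\<tau> \<in> B")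
    case True
    then show ?thesis
      using B[OF True] pB[OF True] by (intro exI[of _ "qs \<tau> @ [p]"] exI[of _ "es \<tau>"]) auto
  next
    case False
    then obtain es where "length ps + length es = ?T" "plane_det d \<tau> (ps @ es) \<noteq> 0" using IH(3) by blast
    then show ?thesis using IH(1) by (intro exI[of _ ps] exI[of _ es]) auto
  qed
  moreover have "finite B'" unfolding B'_def by (rule plane_det_finite_zeros[OF p0])
  moreover have "\<exists>es. length (ps @ [p]) + length es = ?T \<and> plane_det d \<tau> ((ps @ [p]) @ es) \<noteq> 0"
    if "\<tau> \<notin> B'" for \<tau>
    using that e0(1) by (intro exI[of _ es0]) (simp add: B'_def)
  ultimately show ?case using IH(1) by (intro exI[of _ "ps @ [p]"] exI[of _ B']) simp
qed

text \<open>
  The list of \<open>(d+2 choose 2)\<close> points from the previous lemma excludes cones for all but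
  finitely many vertices, and one further general point replaces the omitted point for the
  remaining ones.
\<close>

lemma points_without_cones_on_line:
  "\<exists>v. \<forall>\<tau>. no_cones d (Suc ((d + 2) choose 2)) v (vertex \<tau>)"
proof -
  let ?T = "length (triples d)"
  obtain ps B where ps: "length ps = ?T" "finite B"
    "\<And>\<tau>. \<tau> \<notin> B \<Longrightarrow> \<exists>es. length ps + length es = ?T \<and> plane_det d \<tau> (ps @ es) \<noteq> 0"
    "\<And>\<tau>. \<tau> \<in> B \<Longrightarrow> \<exists>ps' es. Suc (length ps') = ?T \<and> set ps' \<subseteq> set ps \<and> length ps' + length es = ?T
        \<and> plane_det d \<tau> (ps' @ es) \<noteq> 0"
    using general_points_step[OF order.refl, of d] by metis
  have "\<exists>ps' e. Suc (length ps') = ?T \<and> set ps' \<subseteq> set ps \<and> plane_det d \<tau> (ps' @ e # []) \<noteq> 0"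
    if \<tau>: "\<tau> \<in> B" for \<tau>
  proof -
    obtain ps' es where 1: "Suc (length ps') = ?T" "set ps' \<subseteq> set ps" "length ps' + length es = ?T"
        "plane_det d \<tau> (ps' @ es) \<noteq> 0" using ps(4)[OF \<tau>] by blast
    then have "length es = 1" by linarith
    then obtain e where "es = [e]" by (auto simp: length_Suc_conv)
    then show ?thesis using 1 by blast
  qed
  then obtain qs e where B: "\<And>\<tau>. \<tau> \<in> B \<Longrightarrow> Suc (length (qs \<tau>)) = ?T \<and> set (qs \<tau>) \<subseteq> set ps \<and>
      plane_det d \<tau> (qs \<tau> @ e \<tau> # []) \<noteq> 0"
    by metis
  have "\<exists>p. \<forall>f\<in>(\<lambda>\<tau> p. plane_det d \<tau> (qs \<tau> @ p # [])) ` B. f p \<noteq> 0"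
  proof (rule common_nonzero)
    show "finite ((\<lambda>\<tau> p. plane_det d \<tau> (qs \<tau> @ p # [])) ` B)" using ps(2) by simp
    show "line_poly f" if "f \<in> (\<lambda>\<tau> p. plane_det d \<tau> (qs \<tau> @ p # [])) ` B" for f
      using that line_poly_plane_det by blast
    show "\<exists>p. f p \<noteq> 0" if "f \<in> (\<lambda>\<tau> p. plane_det d \<tau> (qs \<tau> @ p # [])) ` B" for f
      using that B by blast
  qed
  then obtain p where "\<forall>f\<in>(\<lambda>\<tau> p. plane_det d \<tau> (qs \<tau> @ p # [])) ` B. f p \<noteq> 0" by (rule exE)
  then have p: "\<And>\<tau>. \<tau> \<in> B \<Longrightarrow> plane_det d \<tau> (qs \<tau> @ [p]) \<noteq> 0" by simp
  have main: "\<exists>us. length us = ?T \<and> set us \<subseteq> set (ps @ [p]) \<and> plane_det d \<tau> us \<noteq> 0" for \<tau>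
  proof (cases "\<tau> \<in> B")
    case True
    then show ?thesis using B[OF True] p[OF True] by (intro exI[of _ "qs \<tau> @ [p]"]) auto
  next
    case False
    then obtain es where "length ps + length es = ?T" "plane_det d \<tau> (ps @ es) \<noteq> 0" using ps(3) by blast
    then show ?thesis using ps(1) by (intro exI[of _ ps]) auto
  qed
  have "no_cones d (Suc ((d + 2) choose 2)) (\<lambda>i. (ps @ [p]) ! i) (vertex \<tau>)" for \<tau>
    unfolding no_cones_def
  proof (intro allI impI)
    fix F assume c: "is_cone d (vertex \<tau>) F"
      and z: "\<forall>i<Suc ((d + 2) choose 2). peval ((ps @ [p]) ! i) F = 0"
    obtain us where us: "length us = ?T" "set us \<subseteq> set (ps @ [p])" "plane_det d \<tau> us \<noteq> 0"
      using main by blast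
    have "length (ps @ [p]) = Suc ((d + 2) choose 2)" using ps(1) length_triples by simp
    then have "\<forall>x\<in>set (ps @ [p]). peval x F = 0" using z by (metis in_set_conv_nth)
    then show "F = 0" using us by (intro plane_det_no_cone[OF c us(3,1)]) auto
  qed
  then show ?thesis by blast
qed

lemma points_without_cones_at_point:
  "\<exists>v. \<forall>F. is_cone d (vertex (Some 0)) F \<longrightarrow> (\<forall>i<(d + 2) choose 2. peval (v i) F = 0) \<longrightarrow> F = 0"
proof -
  obtain ps where ps: "length ps = length (triples d)" "plane_det d (Some 0) ps \<noteq> 0"
    using plane_det_nonzero_ex by blast
  have "F = 0" if "is_cone d (vertex (Some 0)) F" "\<forall>i<(d + 2) choose 2. peval (ps ! i) F = 0" for F
    using that ps by (intro plane_det_no_cone[OF _ ps(2,1)]) (auto simp: in_set_conv_nth length_triples)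
  then show ?thesis by (intro exI[of _ "\<lambda>i. ps ! i"]) blast
qed

lemma row_count:
  assumes "0 < d"
  shows "Suc ((d + 2) choose 2) + length (monomials (d - 1)) = Suc (length (monomials d))"
proof -
  have "length (monomials (d - 1)) = (d + 2) choose 3" using assms by (simp add: length_monomials)
  moreover have "(d + 3) choose 3 = ((d + 2) choose 2) + ((d + 2) choose 3)"
    by (simp add: numeral_3_eq_3 numeral_2_eq_2)
  ultimately show ?thesis by (simp add: length_monomials)
qed

lemma vec_matrix_linear_rows:
  assumes d: "0 < d"
  shows "linear_rows (vec_matrix d (Suc ((d + 2) choose 2)) v) (length (monomials d)) (length (monomials (d - 1)))"
proof
  let ?r = "Suc ((d + 2) choose 2)" and ?N = "length (monomials d)" and ?n = "length (monomials (d - 1))"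
  note rc = row_count[OF d]
  have r: "Suc ?N - ?n = ?r" using rc by linarith
  show "vec_matrix d ?r v \<in> carrier_mat (Suc ?N) ?N"
    using vec_matrix_carrier[of d ?r v] unfolding rc .
  show "0 < ?n" by (simp add: length_monomials)
  show "?n \<le> ?N" using rc by linarith
  show "vec_matrix d ?r v $$ (i, j) \<in> forms 0" if "i < Suc ?N - ?n" "j < ?N" for i j
    using that d unfolding r by (simp add: vec_matrix_entries(1) forms_const)
  show "vec_matrix d ?r v $$ (i, j) \<in> forms 1" if "Suc ?N - ?n \<le> i" "i < Suc ?N" "j < ?N" for i j
    using that r rc by (intro vec_matrix_entries(3)[OF d]) linarith+
qed

section \<open>Primitive kernel vectors of polynomial matrices\<close>

text \<open>
  A nonzero kernel vector of least degree has no common root of its components, because a common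
  root could be divided out.
\<close>

lemma primitive_kernel:
  fixes B :: "complex poly mat"
  assumes B: "B \<in> carrier_mat k k" and det: "det B = 0"
  shows "\<exists>W. (\<forall>i<k. (\<Sum>j<k. B $$ (i, j) * W j) = 0) \<and> (\<forall>t. \<exists>j<k. poly (W j) t \<noteq> 0)"
proof -
  define K where "K W \<longleftrightarrow> (\<forall>i<k. (\<Sum>j<k. B $$ (i, j) * W j) = 0) \<and> (\<exists>j<k. W j \<noteq> 0)" for W
  define \<mu> where "\<mu> W = (\<Sum>j<k. degree (W j))" for W :: "nat \<Rightarrow> complex poly"
  obtain w where w: "w \<in> carrier_vec k" "w \<noteq> 0\<^sub>v k" "B *\<^sub>v w = 0\<^sub>v k"
    using det_0_iff_vec_prod_zero[OF B] det by blast
  have "K (\<lambda>j. w $ j)"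
    unfolding K_def
  proof (intro conjI allI impI)
    fix i assume i: "i < k"
    have "(B *\<^sub>v w) $ i = 0" using w(3) i by simp
    then show "(\<Sum>j<k. B $$ (i, j) * w $ j) = 0"
      using i B w(1) by (simp add: scalar_prod_def atLeast0LessThan)
  next
    show "\<exists>j<k. w $ j \<noteq> 0"
    proof (rule ccontr)
      assume "\<not> ?thesis"
      then have "w = 0\<^sub>v k" using w(1) by (intro eq_vecI) auto
      then show False using w(2) by simp
    qed
  qed
  then obtain W where W: "K W" and min: "\<And>V. K V \<Longrightarrow> \<mu> W \<le> \<mu> V"
    using ex_has_least_nat[of K "\<lambda>j. w $ j" \<mu>] by blast
  have "\<exists>j<k. poly (W j) t \<noteq> 0" for t
  proof (rule ccontr)
    assume "\<not> ?thesis"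
    then have "\<forall>j. \<exists>V. j < k \<longrightarrow> W j = [:- t, 1:] * V" by (auto simp: poly_eq_0_iff_dvd dvd_def)
    then have "\<exists>V. \<forall>j. j < k \<longrightarrow> W j = [:- t, 1:] * V j" by (rule choice)
    then obtain V where V: "\<And>j. j < k \<Longrightarrow> W j = [:- t, 1:] * V j" by blast
    have "K V"
      unfolding K_def
    proof (intro conjI allI impI)
      fix i assume i: "i < k"
      have "[:- t, 1:] * (\<Sum>j<k. B $$ (i, j) * V j) = (\<Sum>j<k. B $$ (i, j) * W j)"
        unfolding sum_distrib_left by (intro sum.cong refl) (simp only: V lessThan_iff mult.left_commute)
      also have "\<dots> = 0" using W i by (simp add: K_def)
      finally show "(\<Sum>j<k. B $$ (i, j) * V j) = 0" by (simp only: mult_eq_0_iff) simp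
    next
      show "\<exists>j<k. V j \<noteq> 0" using W V unfolding K_def by fastforce
    qed
    then have "\<mu> W \<le> \<mu> V" by (rule min)
    moreover have "\<mu> V < \<mu> W"
      unfolding \<mu>_def
    proof (rule sum_strict_mono_ex1)
      have deg: "W j = 0 \<and> V j = 0 \<or> degree (W j) = Suc (degree (V j))" if "j < k" for j
      proof (cases "V j = 0")
        case False
        then have "degree ([:- t, 1:] * V j) = Suc (degree (V j))" by (subst degree_mult_eq) auto
        then show ?thesis using V[OF that] by simp
      qed (use V[OF that] in simp)
      then show "\<forall>j\<in>{..<k}. degree (V j) \<le> degree (W j)" by fastforce
      obtain j where "j < k" "W j \<noteq> 0" using W by (auto simp: K_def)
      then show "\<exists>j\<in>{..<k}. degree (V j) < degree (W j)" using deg[of j] by (intro bexI[of _ j]) auto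
    qed simp
    ultimately show False by simp
  qed
  then show ?thesis using W unfolding K_def by blast
qed

lemma sum_lessThan_add: "(\<Sum>k<r + n. h k) = (\<Sum>k<r. h k) + (\<Sum>i<n. h (r + i :: nat) :: 'a::comm_monoid_add)"
  by (induction n) (simp_all add: add.assoc)

lemma linear_form_on_line:
  assumes l: "l \<in> forms 1"
  shows "peval (line_pt t) l = peval (line_pt 0) l + t * peval (vertex None) l"
proof -
  have mv: "monomial_val (line_pt t) m = monomial_val (line_pt 0) m + t * monomial_val (vertex None) m"
    if "m \<in> ks l" for m
  proof -
    have "mdeg m = Suc (mdeg (0 :: mon4))" using l that by (simp add: forms_def)
    then obtain i where "m = 0 + sg i 1" using monomial_one_more[of m 0] by auto
    then have "m = sg i 1" by simp
    then show ?thesis by (simp add: line_pt_def)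
  qed
  show ?thesis
    unfolding peval_def sum_distrib_left sum.distrib[symmetric]
    by (intro sum.cong refl) (simp add: mv algebra_simps)
qed

section \<open>Independence of the minors on the line\<close>

text \<open>
  A relation with coefficients \<open>c\<close> between the minors on the line says that, with \<open>c\<close> as an
  adjoined column, the pencil of matrices has determinant zero. Take a primitive solution of
  \<open>c p(t) + \<Lambda>(t) Y(t) = 0\<close>. Since \<open>\<Lambda>(t)\<close> is injective for every \<open>t\<close>, a root of \<open>p\<close> would be a
  root of \<open>Y\<close>; so \<open>p\<close> is a nonzero constant. The top coefficient of \<open>Y\<close> is then killed by the
  matrix at the point at infinity of the line, so that \<open>Y\<close> and hence \<open>c\<close> are zero.
\<close>

lemma line_minors_independent:
  assumes d: "0 < d"
  defines "r \<equiv> Suc ((d + 2) choose 2)" and "n \<equiv> length (monomials (d - 1))"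
  assumes nc: "\<And>\<tau>. no_cones d r v (vertex \<tau>)"
  shows "det (mat n n (\<lambda>(i, k). peval (line_pt (of_nat k)) (det (row_del (vec_matrix d r v) (r + i))))) \<noteq> 0"
proof
  define N where "N = length (monomials d)"
  define \<Lambda> where "\<Lambda> = vec_matrix d r v"
  interpret L: linear_rows \<Lambda> N n
    using vec_matrix_linear_rows[OF d, of v] by (simp only: \<Lambda>_def N_def n_def r_def)
  have rn: "r + n = Suc N" using row_count[OF d] by (simp only: r_def n_def N_def)
  have Lr: "L.r = r" using rn by simp
  have ker: "y b = 0" if z: "\<And>k. k < Suc N \<Longrightarrow> (\<Sum>b<N. peval (vertex \<tau>) (\<Lambda> $$ (k, b)) * y b) = 0"
    and b: "b < N" for \<tau> y b
    by (rule no_cones_kernel[OF d nc[of \<tau>]]) (use z b rn in \<open>simp_all add: \<Lambda>_def N_def n_def\<close>)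
  define M where "M = mat n n (\<lambda>(i, k). peval (line_pt (of_nat k)) (det (row_del \<Lambda> (r + i))))"
  have M: "M \<in> carrier_mat n n" by (simp add: M_def)
  assume "det (mat n n (\<lambda>(i, k). peval (line_pt (of_nat k)) (det (row_del (vec_matrix d r v) (r + i))))) = 0"
  then have "det M = 0" by (simp only: M_def \<Lambda>_def)
  then have "det M\<^sup>T = 0" using det_transpose[OF M] by simp
  then obtain c where c: "c \<in> carrier_vec n" "c \<noteq> 0\<^sub>v n" "M\<^sup>T *\<^sub>v c = 0\<^sub>v n"
    using det_0_iff_vec_prod_zero[of "M\<^sup>T" n] M by auto
  define g where "g = (\<Sum>i<n. const (c $ i) * det (row_del \<Lambda> (r + i)))"
  have fi: "det (row_del \<Lambda> (r + i)) \<in> forms (n - 1)" if "i < n" for i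
  proof -
    have "r + i < Suc N" using that rn by linarith
    moreover have "L.mdegree (r + i) = n - 1" unfolding L.mdegree_def L.rdeg_def Lr by simp
    ultimately show ?thesis using L.det_row_del_forms[of "r + i"] by (simp only:)
  qed
  have g: "g \<in> forms (n - 1)" unfolding g_def using fi by (intro forms_sum forms_const_mult) simp
  have gz: "peval (line_pt (of_nat k)) g = 0" if "k \<le> n - 1" for k
  proof -
    have k: "k < n" using that L.n(1) by linarith
    have "(M\<^sup>T *\<^sub>v c) $ k = 0" using c(3) k by simp
    then have "(\<Sum>i<n. M $$ (i, k) * c $ i) = 0"
      using k M c(1) by (simp add: scalar_prod_def atLeast0LessThan)
    then show ?thesis using k by (simp add: g_def peval_sum peval_mult M_def mult.commute)
  qed
  have gline: "peval (line_pt t) g = 0" for t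
    unfolding peval_def
  proof (rule sum.neutral, rule ballI)
    fix m assume m: "m \<in> ks g"
    have "lk m 0 + lk m 1 > 0" by (rule form_zero_on_line[OF g _ m]) (rule gz)
    then show "lk g m * monomial_val (line_pt t) m = 0" by (auto simp: monomial_val_line_pt)
  qed
  \<comment> \<open>The matrix on the line as a matrix of polynomials in the parameter: the linear rows are
    pencils between the points with parameters \<open>0\<close> and infinity.\<close>
  define EP where "EP = mat (Suc N) N (\<lambda>(k, j). [:peval (line_pt 0) (\<Lambda> $$ (k, j)),
      (if k < r then 0 else peval (vertex None) (\<Lambda> $$ (k, j))):])"
  have EP: "EP \<in> carrier_mat (Suc N) N" by (simp add: EP_def)
  have top: "peval q (\<Lambda> $$ (k, j)) = monomial_val (v k) (monomials d ! j)" if "k < r" "j < N" for q k j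
    using that d by (simp add: \<Lambda>_def N_def vec_matrix_entries(1))
  have EPt: "poly (EP $$ (k, j)) t = peval (line_pt t) (\<Lambda> $$ (k, j))" if "k < Suc N" "j < N" for k j t
  proof (cases "k < r")
    case True
    then show ?thesis using that by (simp add: EP_def top)
  next
    case False
    then have "\<Lambda> $$ (k, j) \<in> forms 1" using L.linear_rows[of k j] that unfolding Lr by simp
    then have "peval (line_pt t) (\<Lambda> $$ (k, j))
        = peval (line_pt 0) (\<Lambda> $$ (k, j)) + t * peval (vertex None) (\<Lambda> $$ (k, j))"
      by (rule linear_form_on_line)
    then show ?thesis using that False by (simp add: EP_def)
  qed
  have detEP: "poly (det (row_del EP k)) t = peval (line_pt t) (det (row_del \<Lambda> k))" if "k < Suc N" for k t
  proof -
    interpret ev: comm_ring_hom "\<lambda>p :: complex poly. poly p t" by unfold_locales simp_all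
    have "map_mat (\<lambda>p. poly p t) (row_del EP k) = map_mat (peval (line_pt t)) (row_del \<Lambda> k)"
      by (rule eq_matI) (use EP L.A EPt insert_index_lt in \<open>auto simp: row_del_def\<close>)
    then have "det (map_mat (\<lambda>p. poly p t) (row_del EP k)) = det (map_mat (peval (line_pt t)) (row_del \<Lambda> k))"
      by (rule arg_cong)
    then show ?thesis by (simp only: ev.hom_det peval_det)
  qed
  \<comment> \<open>The relation concerns the minors that omit a linear row; the signs match those of the
    expansion along the adjoined column.\<close>
  define c' where "c' k = (if k < r then 0 else (-1) ^ k * c $ (k - r))" for k
  have "det (adjoin_col (\<lambda>k. [:c' k:]) EP) = 0"
  proof -
    have "poly (det (adjoin_col (\<lambda>k. [:c' k:]) EP)) t = 0" for t
    proof -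
      have "poly (det (adjoin_col (\<lambda>k. [:c' k:]) EP)) t
          = (\<Sum>k<Suc N. c' k * ((-1) ^ k * peval (line_pt t) (det (row_del \<Lambda> k))))"
        unfolding det_adjoin_col[OF EP] poly_sum by (intro sum.cong refl) (simp add: detEP poly_power)
      also have "\<dots> = (\<Sum>i<n. c $ i * peval (line_pt t) (det (row_del \<Lambda> (r + i))))"
        unfolding rn[symmetric] sum_lessThan_add
        by (simp add: c'_def power_add[symmetric] mult.assoc[symmetric])
          (intro sum.cong refl, simp add: mult.commute[of _ "c $ _"] mult.assoc power_add[symmetric])
      also have "\<dots> = peval (line_pt t) g" by (simp add: g_def peval_sum peval_mult)
      finally show ?thesis using gline by simp
    qed
    then show ?thesis using poly_all_0_iff_0 by blast
  qed
  moreover have "adjoin_col (\<lambda>k. [:c' k:]) EP \<in> carrier_mat (Suc N) (Suc N)"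
    using EP by (simp add: adjoin_col_def)
  ultimately obtain W where W: "\<And>k. k < Suc N \<Longrightarrow> (\<Sum>j<Suc N. adjoin_col (\<lambda>k. [:c' k:]) EP $$ (k, j) * W j) = 0"
    and prim: "\<And>t. \<exists>j<Suc N. poly (W j) t \<noteq> 0"
    using primitive_kernel by blast
  have rel: "[:c' k:] * W 0 + (\<Sum>b<N. EP $$ (k, b) * W (Suc b)) = 0" if "k < Suc N" for k
    using W[OF that] EP that unfolding sum.lessThan_Suc_shift by (simp add: adjoin_col_def)
  have p_nz: "poly (W 0) t \<noteq> 0" for t
  proof
    assume p0: "poly (W 0) t = 0"
    have "poly (W (Suc b)) t = 0" if b: "b < N" for b
    proof (rule ker[of "Some t" "\<lambda>b. poly (W (Suc b)) t", OF _ b])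
      fix k assume k: "k < Suc N"
      have "poly ([:c' k:] * W 0 + (\<Sum>b<N. EP $$ (k, b) * W (Suc b))) t = 0" using rel[OF k] by simp
      then show "(\<Sum>b<N. peval (vertex (Some t)) (\<Lambda> $$ (k, b)) * poly (W (Suc b)) t) = 0"
        using p0 k by (simp add: poly_sum EPt)
    qed
    then have "poly (W j) t = 0" if "j < Suc N" for j using that p0 by (cases j) auto
    then show False using prim by blast
  qed
  have "degree (W 0) = 0"
  proof (rule ccontr)
    assume "degree (W 0) \<noteq> 0"
    then have "\<exists>t. poly (W 0) t = 0"
      using fundamental_theorem_of_algebra[of "W 0"] by (simp add: constant_degree)
    then show False using p_nz by blast
  qed
  then obtain p0 where p0: "W 0 = [:p0:]" by (rule degree_eq_zeroE)
  have p0nz: "p0 \<noteq> 0" using p_nz[of 0] p0 by simp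
  define S where "S = {b. b < N \<and> W (Suc b) \<noteq> 0}"
  have "S \<noteq> {}"
  proof
    assume "S = {}"
    then have z: "W (Suc b) = 0" if "b < N" for b using that by (auto simp: S_def)
    have cz: "c' k = 0" if "k < Suc N" for k
      using rel[OF that] z p0nz unfolding p0 by simp
    have "c $ i = 0" if "i < n" for i
    proof -
      have "c' (r + i) = 0" using that rn by (intro cz) linarith
      then show ?thesis by (simp add: c'_def)
    qed
    then have "c = 0\<^sub>v n" using c(1) by (intro eq_vecI) auto
    then show False using c(2) by simp
  qed
  moreover have fS: "finite S" by (simp add: S_def)
  ultimately have "Max ((\<lambda>b. degree (W (Suc b))) ` S) \<in> (\<lambda>b. degree (W (Suc b))) ` S" by (intro Max_in) auto
  then obtain b0 where b0: "b0 \<in> S" "Max ((\<lambda>b. degree (W (Suc b))) ` S) = degree (W (Suc b0))" by blast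
  define D where "D = degree (W (Suc b0))"
  have degD: "degree (W (Suc b)) \<le> D" if "b < N" for b
  proof (cases "b \<in> S")
    case True
    then show ?thesis unfolding D_def b0(2)[symmetric] using fS by (intro Max_ge) auto
  next
    case False
    then show ?thesis using that by (simp add: S_def)
  qed
  \<comment> \<open>The constant rows give the relation at infinity in degree \<open>D\<close>, where \<open>c'\<close> is zero on them,
    and the linear rows give it in degree \<open>D + 1\<close>, which exceeds the degree of the constant
    \<open>p0\<close>.\<close>
  have "coeff (W (Suc b0)) D = 0"
  proof (rule ker[of None "\<lambda>b. coeff (W (Suc b)) D"])
    show "b0 < N" using b0(1) by (simp add: S_def)
    fix k assume k: "k < Suc N"
    show "(\<Sum>b<N. peval (vertex None) (\<Lambda> $$ (k, b)) * coeff (W (Suc b)) D) = 0"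
    proof (cases "k < r")
      case True
      have "coeff ([:c' k:] * W 0 + (\<Sum>b<N. EP $$ (k, b) * W (Suc b))) D = 0" using rel[OF k] by simp
      then show ?thesis using True k by (simp add: c'_def coeff_sum EP_def top)
    next
      case False
      have "coeff ([:c' k:] * W 0 + (\<Sum>b<N. EP $$ (k, b) * W (Suc b))) (Suc D) = 0" using rel[OF k] by simp
      moreover have "coeff (EP $$ (k, b) * W (Suc b)) (Suc D)
          = peval (vertex None) (\<Lambda> $$ (k, b)) * coeff (W (Suc b)) D" if "b < N" for b
        using k False that degD[OF that] by (simp add: EP_def coeff_eq_0)
      ultimately show ?thesis by (simp add: p0 coeff_sum)
    qed
  qed
  then show False using b0(1) by (simp add: D_def S_def)
qed

section \<open>Multihomogeneous polynomials in the coordinates of the points\<close>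

type_synonym config_poly = "(nat \<times> 4) mpoly"

definition wt :: "nat \<Rightarrow> (nat \<times> 4) monomial \<Rightarrow> nat" where
  "wt i m = (\<Sum>k\<in>UNIV. lk m (i, k))"

lemma additive_wt: "additive (wt i)"
  by (simp add: additive_def wt_def lookup_add sum.distrib)

text \<open>
  Homogeneous in the coordinates of each point separately. Quantifying over all \<open>i\<close>, with degree
  zero from \<open>r\<close> on, also expresses that only the first \<open>r\<close> points occur.
\<close>

definition mhom :: "nat \<Rightarrow> config_poly \<Rightarrow> bool" where
  "mhom r f \<longleftrightarrow> (\<exists>e. (\<forall>i. homog (wt i) (e i) f) \<and> (\<forall>i\<ge>r. e i = 0))"

lemma mhom_mult: "mhom r f \<Longrightarrow> mhom r g \<Longrightarrow> mhom r (f * g)"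
proof -
  assume "mhom r f" "mhom r g"
  then obtain e e' where "\<forall>i. homog (wt i) (e i) f" "\<forall>i\<ge>r. e i = 0"
      "\<forall>i. homog (wt i) (e' i) g" "\<forall>i\<ge>r. e' i = 0"
    by (auto simp: mhom_def)
  then show ?thesis
    unfolding mhom_def by (intro exI[of _ "\<lambda>i. e i + e' i"]) (simp add: homog_mult additive_wt)
qed

lemma mhom_1: "mhom r 1"
  unfolding mhom_def by (intro exI[of _ "\<lambda>_. 0"]) (simp add: homog_1 additive_wt)

lemma mhom_prod: "(\<And>x. x \<in> S \<Longrightarrow> mhom r (f x)) \<Longrightarrow> mhom r (prod f S)"
  by (induction S rule: infinite_finite_induct) (auto intro: mhom_1 mhom_mult)

lemma wt_zero_keys:
  assumes "\<forall>i\<ge>r. wt i m = 0"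
  shows "fst ` ks m \<subseteq> {..<r}"
proof clarify
  fix i k assume "(i, k) \<in> ks m"
  then have "wt i m \<noteq> 0" by (auto simp: wt_def in_keys_iff)
  then show "fst (i, k) < r" using assms by (cases "r \<le> i") auto
qed

lemma mhom_multihomogeneous:
  assumes "mhom r f"
  shows "multihomogeneous r f"
proof -
  obtain e where e: "\<forall>i. homog (wt i) (e i) f" "\<forall>i\<ge>r. e i = 0" using assms by (auto simp: mhom_def)
  have "fst ` ks m \<subseteq> {..<r} \<and> (\<forall>i<r. (\<Sum>j\<in>UNIV. lk m (i, j)) = e i)" if "m \<in> ks f" for m
  proof -
    have w: "wt i m = e i" for i using e(1) that by (simp add: homog_def)
    then have "fst ` ks m \<subseteq> {..<r}" using e(2) by (intro wt_zero_keys) simp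
    then show ?thesis using w by (simp add: wt_def)
  qed
  then show ?thesis unfolding multihomogeneous_def by blast
qed

text \<open>
  Rescaling the representatives multiplies the value by \<open>\<Prod>i<r. c\<^sub>i\<^sup>e\<^sup>i\<close>, where \<open>e i\<close> are the
  degrees.
\<close>

lemma mhom_rescale:
  assumes f: "mhom r f" and c: "\<And>i. i < r \<Longrightarrow> c i \<noteq> 0"
    and v: "\<And>i k. i < r \<Longrightarrow> w (i, k) = c i * v (i, k)" and nz: "peval v f \<noteq> 0"
  shows "peval w f \<noteq> 0"
proof -
  obtain e where e: "\<forall>i. homog (wt i) (e i) f" "\<forall>i\<ge>r. e i = 0" using f by (auto simp: mhom_def)
  have "monomial_val w m = (\<Prod>i<r. c i ^ e i) * monomial_val v m" if "m \<in> ks f" for m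
  proof -
    have w: "wt i m = e i" for i using e(1) that by (simp add: homog_def)
    then have "fst ` ks m \<subseteq> {..<r}" using e(2) by (intro wt_zero_keys) simp
    then have sub: "ks m \<subseteq> {..<r} \<times> UNIV" by fastforce
    have "monomial_val w m = (\<Prod>i<r. \<Prod>k\<in>UNIV. w (i, k) ^ lk m (i, k))"
      using monomial_val_superset[OF _ sub] by (simp add: prod.cartesian_product')
    also have "\<dots> = (\<Prod>i<r. c i ^ wt i m * (\<Prod>k\<in>UNIV. v (i, k) ^ lk m (i, k)))"
    proof (rule prod.cong[OF refl])
      fix i assume "i \<in> {..<r}"
      then have "(\<Prod>k\<in>UNIV. w (i, k) ^ lk m (i, k)) = (\<Prod>k\<in>UNIV. c i ^ lk m (i, k) * v (i, k) ^ lk m (i, k))"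
        by (intro prod.cong) (simp_all add: v power_mult_distrib)
      also have "\<dots> = c i ^ wt i m * (\<Prod>k\<in>UNIV. v (i, k) ^ lk m (i, k))"
        by (simp add: prod.distrib wt_def power_sum)
      finally show "(\<Prod>k\<in>UNIV. w (i, k) ^ lk m (i, k)) = c i ^ wt i m * (\<Prod>k\<in>UNIV. v (i, k) ^ lk m (i, k))" .
    qed
    also have "\<dots> = (\<Prod>i<r. c i ^ e i) * monomial_val v m"
      using monomial_val_superset[OF _ sub] w by (simp add: prod.cartesian_product' prod.distrib)
    finally show ?thesis .
  qed
  then have "peval w f = (\<Prod>i<r. c i ^ e i) * peval v f"
    by (simp add: peval_def sum_distrib_left ac_simps)
  then show ?thesis using nz c by (simp add: prod_zero_iff)
qed

definition ren :: "nat \<Rightarrow> mon4 \<Rightarrow> (nat \<times> 4) monomial" where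
  "ren i m = (\<Sum>k\<in>UNIV. sg (i, k) (lk m k))"

text \<open>The polynomial \<open>f\<close> in the coordinates of the \<open>i\<close>-th point.\<close>

definition emb :: "nat \<Rightarrow> poly4 \<Rightarrow> config_poly" where
  "emb i f = (\<Sum>m\<in>ks f. sg (ren i m) (lk f m))"

lemma monomial_val_sum: "finite S \<Longrightarrow> monomial_val v (sum f S) = (\<Prod>x\<in>S. monomial_val v (f x))"
  by (induction S rule: finite_induct) (simp_all add: monomial_val_add)

lemma peval_emb: "peval v (emb i f) = peval (\<lambda>k. v (i, k)) f"
proof -
  have "monomial_val v (ren i m) = monomial_val (\<lambda>k. v (i, k)) m" for m
    unfolding ren_def by (subst monomial_val_sum) (simp_all add: monomial_val_superset[of UNIV])
  then show ?thesis by (simp add: emb_def peval_sum peval_def[of _ f])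
qed

lemma wt_ren: "wt j (ren i m) = (if j = i then mdeg m else 0)"
proof -
  have "lk (ren i m) (j, k) = (if j = i then lk m k else 0)" for k
  proof -
    have "lk (ren i m) (j, k) = (\<Sum>k'\<in>UNIV. if k' = k then (if j = i then lk m k else 0) else 0)"
      unfolding ren_def lookup_sum by (intro sum.cong) (auto simp: lookup_single when_def)
    then show ?thesis by simp
  qed
  then show ?thesis by (simp add: wt_def mdeg_superset[of UNIV])
qed

lemma homog_emb:
  assumes "f \<in> forms t"
  shows "homog (wt j) (if j = i then t else 0) (emb i f)"
  unfolding emb_def by (intro homog_sum homog_single) (use assms in \<open>simp add: wt_ren forms_def\<close>)

text \<open>
  The interpolation matrix with indeterminate points; \<open>\<beta>\<close> is the substitution of a vertex into
  the linear entries. The vertex is a constant point of the line in one certificate and an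
  indeterminate point in the other one.
\<close>

definition config_matrix :: "nat \<Rightarrow> nat \<Rightarrow> (poly4 \<Rightarrow> config_poly) \<Rightarrow> config_poly mat" where
  "config_matrix d r \<beta> = mat (r + length (monomials (d - 1))) (length (monomials d))
     (\<lambda>(k, j). if k < r then emb k (sg (monomials d ! j) 1)
        else \<beta> (vec_matrix d r (\<lambda>_ _. 0) $$ (k, j)))"

lemma peval_config_matrix:
  assumes \<beta>: "\<And>f. peval u (\<beta> f) = peval q f"
  shows "map_mat (peval u) (config_matrix d r \<beta>) = map_mat (peval q) (vec_matrix d r (\<lambda>i k. u (i, k)))"
proof (rule eq_matI)
  fix k j assume kj: "k < dim_row (map_mat (peval q) (vec_matrix d r (\<lambda>i k. u (i, k))))"
    "j < dim_col (map_mat (peval q) (vec_matrix d r (\<lambda>i k. u (i, k))))"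
  then have k: "k < r + length (monomials (d - 1))" and j: "j < length (monomials d)"
    by (simp_all add: vec_matrix_def)
  show "map_mat (peval u) (config_matrix d r \<beta>) $$ (k, j)
      = map_mat (peval q) (vec_matrix d r (\<lambda>i k. u (i, k))) $$ (k, j)"
    using k j by (simp add: config_matrix_def vec_matrix_def peval_emb \<beta>)
qed (simp_all add: config_matrix_def vec_matrix_def)

lemma map_row_del:
  assumes "A \<in> carrier_mat (Suc N) N" "i < Suc N"
  shows "row_del (map_mat h A) i = map_mat h (row_del A i)"
  by (rule eq_matI) (use assms insert_index_lt in \<open>auto simp: row_del_def\<close>)

lemma mhom_row_del:
  assumes C: "C \<in> carrier_mat (Suc N) N" and i: "i < Suc N"
    and h: "\<And>k j x. k < Suc N \<Longrightarrow> j < N \<Longrightarrow> homog (wt x) (e k x) (C $$ (k, j))"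
    and e: "\<And>k x. k < Suc N \<Longrightarrow> r \<le> x \<Longrightarrow> e k x = 0"
  shows "homog (wt x) (\<Sum>a<N. e (insert_index i a) x) (det (row_del C i))"
    and "r \<le> x \<Longrightarrow> (\<Sum>a<N. e (insert_index i a) x) = 0"
proof -
  show "homog (wt x) (\<Sum>a<N. e (insert_index i a) x) (det (row_del C i))"
    by (rule homog_det[OF additive_wt]) (use C h insert_index_lt in \<open>auto simp: row_del_def\<close>)
  show "r \<le> x \<Longrightarrow> (\<Sum>a<N. e (insert_index i a) x) = 0"
    using e insert_index_lt by simp
qed

section \<open>The certificate of generality\<close>

text \<open>
  Nonzero if and only if the minors that omit a linear row are independent on the line.
\<close>

definition line_cert :: "nat \<Rightarrow> nat \<Rightarrow> config_poly" where
  "line_cert d r = (let n = length (monomials (d - 1)) in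
     det (mat n n (\<lambda>(i, k). det (row_del (config_matrix d r (\<lambda>f. const (peval (line_pt (of_nat k)) f))) (r + i)))))"

text \<open>
  The minor that omits the row of the \<open>i\<close>-th point, evaluated at this point. It expresses that
  this point is not the vertex of a cone of degree \<open>d\<close> through the other ones.
\<close>

definition vertex_cert :: "nat \<Rightarrow> nat \<Rightarrow> nat \<Rightarrow> config_poly" where
  "vertex_cert d r i = det (row_del (config_matrix d r (emb i)) i)"

text \<open>Nonvanishing also implies that both coordinate vectors are nonzero.\<close>

definition distinct_cert :: "nat \<times> nat \<Rightarrow> config_poly" where
  "distinct_cert = (\<lambda>(i, j). emb i (var 0) * emb j (var 1) - emb i (var 1) * emb j (var 0))"

context
  fixes d r n N :: nat
  assumes d: "0 < d"
  defines "r \<equiv> Suc ((d + 2) choose 2)" and "n \<equiv> length (monomials (d - 1))" and "N \<equiv> length (monomials d)"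
begin

lemma rn: "r + n = Suc N"
  using row_count[OF d] by (simp only: r_def n_def N_def)

lemma config_carrier: "config_matrix d r \<beta> \<in> carrier_mat (Suc N) N"
  using rn by (simp add: config_matrix_def n_def N_def)

lemma vec_carrier: "vec_matrix d r v \<in> carrier_mat (Suc N) N"
  using rn by (simp add: vec_matrix_def n_def N_def)

lemma peval_det_config:
  assumes "\<And>f. peval u (\<beta> f) = peval q f" "i < Suc N"
  shows "peval u (det (row_del (config_matrix d r \<beta>) i)) = peval q (det (row_del (vec_matrix d r (\<lambda>i k. u (i, k))) i))"
proof -
  have "row_del (map_mat (peval u) (config_matrix d r \<beta>)) i
      = row_del (map_mat (peval q) (vec_matrix d r (\<lambda>i k. u (i, k)))) i"
    using peval_config_matrix[OF assms(1)] by (rule arg_cong)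
  then show ?thesis
    unfolding map_row_del[OF config_carrier assms(2)] map_row_del[OF vec_carrier assms(2)]
    by (metis peval_det)
qed

lemma config_homog:
  assumes \<beta>: "\<And>f x. f \<in> forms 1 \<Longrightarrow> homog (wt x) (b x) (\<beta> f)" and k: "k < Suc N" "j < N"
  shows "homog (wt x) (if k < r then if x = k then d else 0 else b x) (config_matrix d r \<beta> $$ (k, j))"
proof (cases "k < r")
  case True
  have "sg (monomials d ! j) 1 \<in> forms d" using k(2) by (intro forms_single nth_monomials) (simp add: N_def)
  then show ?thesis
    using homog_emb[of "sg (monomials d ! j) 1" d x k] True k rn by (simp add: config_matrix_def n_def N_def)
next
  case False
  have "vec_matrix d r (\<lambda>_ _. 0) $$ (k, j) \<in> forms 1"
    using vec_matrix_entries(3)[OF d, of j r k] False k rn by (simp add: n_def N_def)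
  then show ?thesis
    using \<beta>[of "vec_matrix d r (\<lambda>_ _. 0) $$ (k, j)" x] False k rn by (simp add: config_matrix_def n_def N_def)
qed

lemma mhom_line_cert: "mhom r (line_cert d r)"
proof -
  define e :: "nat \<Rightarrow> nat \<Rightarrow> nat" where "e k x = (if k < r then if x = k then d else 0 else 0)" for k x
  define E where "E i x = (\<Sum>a<N. e (insert_index (r + i) a) x)" for i x
  have h: "homog (wt x) (e k x) (config_matrix d r (\<lambda>f. const (peval q f)) $$ (k, j))"
    if "k < Suc N" "j < N" for q k j x
    unfolding e_def by (rule config_homog[of "\<lambda>_. 0"]) (use that in \<open>simp_all add: homog_const additive_wt\<close>)
  have e0: "e k x = 0" if "r \<le> x" for k x using that by (simp add: e_def)
  have "homog (wt x) (\<Sum>i<n. E i x) (line_cert d r)" for x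
    unfolding line_cert_def Let_def n_def[symmetric]
  proof (rule homog_det[OF additive_wt])
    fix i k assume ik: "i < n" "k < n"
    have "r + i < Suc N" using ik rn by linarith
    then show "homog (wt x) (E i x) (mat n n (\<lambda>(i, k). det (row_del (config_matrix d r
        (\<lambda>f. const (peval (line_pt (of_nat k)) f))) (r + i))) $$ (i, k))"
      unfolding E_def using mhom_row_del(1)[OF config_carrier _ h e0] ik by simp
  qed simp
  moreover have "(\<Sum>i<n. E i x) = 0" if "r \<le> x" for x
    unfolding E_def using e0[OF that] by simp
  ultimately show ?thesis unfolding mhom_def by (intro exI[of _ "\<lambda>x. \<Sum>i<n. E i x"]) simp
qed

lemma mhom_vertex_cert:
  assumes i: "i < r"
  shows "mhom r (vertex_cert d r i)"
proof -
  define e :: "nat \<Rightarrow> nat \<Rightarrow> nat" where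
    "e k x = (if k < r then if x = k then d else 0 else if x = i then 1 else 0)" for k x
  have h: "homog (wt x) (e k x) (config_matrix d r (emb i) $$ (k, j))" if "k < Suc N" "j < N" for k j x
    unfolding e_def by (rule config_homog[of "\<lambda>x. if x = i then 1 else 0"]) (use that homog_emb in auto)
  have e0: "e k x = 0" if "r \<le> x" for k x using that i by (simp add: e_def)
  have iN: "i < Suc N" using i rn by linarith
  show ?thesis
    unfolding mhom_def vertex_cert_def
    using mhom_row_del[OF config_carrier iN h e0] by (intro exI[of _ "\<lambda>x. \<Sum>a<N. e (insert_index i a) x"]) simp
qed

lemma mhom_distinct_cert:
  assumes "i < r" "j < r"
  shows "mhom r (distinct_cert (i, j))"
proof -
  have "homog (wt x) ((if x = i then 1 else 0) + (if x = j then 1 else 0)) (emb i (var k) * emb j (var l))" for x k l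
    by (intro homog_mult[OF additive_wt] homog_emb forms_single) simp_all
  then have "homog (wt x) ((if x = i then 1 else 0) + (if x = j then 1 else 0)) (distinct_cert (i, j))" for x
    unfolding distinct_cert_def prod.case by (intro homog_diff)
  then show ?thesis
    unfolding mhom_def using assms
    by (intro exI[of _ "\<lambda>x. (if x = i then 1 else 0) + (if x = j then 1 else 0)"]) auto
qed

lemma peval_line_cert:
  "peval u (line_cert d r) = det (mat n n (\<lambda>(i, k). peval (line_pt (of_nat k))
     (det (row_del (vec_matrix d r (\<lambda>i k. u (i, k))) (r + i)))))"
proof -
  have "map_mat (peval u) (mat n n (\<lambda>(i, k). det (row_del (config_matrix d r
      (\<lambda>f. const (peval (line_pt (of_nat k)) f))) (r + i))))
    = mat n n (\<lambda>(i, k). peval (line_pt (of_nat k)) (det (row_del (vec_matrix d r (\<lambda>i k. u (i, k))) (r + i))))"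
  proof (rule eq_matI)
    fix i k assume "i < dim_row (mat n n (\<lambda>(i, k). peval (line_pt (of_nat k)) (det (row_del (vec_matrix d r (\<lambda>i k. u (i, k))) (r + i)))))"
      "k < dim_col (mat n n (\<lambda>(i, k). peval (line_pt (of_nat k)) (det (row_del (vec_matrix d r (\<lambda>i k. u (i, k))) (r + i)))))"
    then have ik: "i < n" "k < n" by simp_all
    have "r + i < Suc N" using ik rn by linarith
    then show "map_mat (peval u) (mat n n (\<lambda>(i, k). det (row_del (config_matrix d r
        (\<lambda>f. const (peval (line_pt (of_nat k)) f))) (r + i)))) $$ (i, k)
      = mat n n (\<lambda>(i, k). peval (line_pt (of_nat k)) (det (row_del (vec_matrix d r (\<lambda>i k. u (i, k))) (r + i)))) $$ (i, k)"
      using ik peval_det_config[of u "\<lambda>f. const (peval (line_pt (of_nat k)) f)" "line_pt (of_nat k)" "r + i"]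
      by simp
  qed simp_all
  then show ?thesis unfolding line_cert_def Let_def n_def[symmetric] by (metis peval_det)
qed

lemma peval_vertex_cert:
  assumes "i < r"
  shows "peval u (vertex_cert d r i) = peval (\<lambda>k. u (i, k)) (det (row_del (vec_matrix d r (\<lambda>i k. u (i, k))) i))"
proof -
  have "i < Suc N" using assms rn by linarith
  then show ?thesis unfolding vertex_cert_def by (intro peval_det_config peval_emb)
qed

lemma peval_distinct_cert: "peval u (distinct_cert (i, j)) = u (i, 0) * u (j, 1) - u (i, 1) * u (j, 0)"
  unfolding distinct_cert_def prod.case peval_diff peval_mult peval_emb peval_var ..

lemma line_cert_nonzero: "\<exists>u. peval u (line_cert d r) \<noteq> 0"
proof -
  obtain v where "\<forall>\<tau>. no_cones d r v (vertex \<tau>)"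
    using points_without_cones_on_line[of d] by (auto simp: r_def)
  then have "det (mat n n (\<lambda>(i, k). peval (line_pt (of_nat k)) (det (row_del (vec_matrix d r v) (r + i))))) \<noteq> 0"
    using line_minors_independent[OF d, of v] by (simp add: r_def n_def)
  then have "peval (\<lambda>(i, k). v i k) (line_cert d r) \<noteq> 0" unfolding peval_line_cert by simp
  then show ?thesis by blast
qed

text \<open>
  Put the \<open>i\<close>-th point at the vertex and the other ones at points that lie on no common cone
  with this vertex; then the square matrix without the \<open>i\<close>-th row is injective.
\<close>

lemma vertex_cert_nonzero:
  assumes i: "i < r"
  shows "\<exists>u. peval u (vertex_cert d r i) \<noteq> 0"
proof -
  obtain w where w: "\<And>F. is_cone d (vertex (Some 0)) F \<Longrightarrow> (\<forall>i<(d + 2) choose 2. peval (w i) F = 0) \<Longrightarrow> F = 0"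
    using points_without_cones_at_point by blast
  define v where "v j = (if j = i then vertex (Some 0) else w (if j < i then j else j - 1))" for j
  let ?u = "\<lambda>(i, k). v i k"
  let ?A = "map_mat (peval (vertex (Some 0))) (row_del (vec_matrix d r v) i)"
  have A: "?A \<in> carrier_mat N N" using vec_carrier[of v] by (auto simp: row_del_def)
  have iN: "i < Suc N" using i rn by linarith
  have "det ?A \<noteq> 0"
  proof
    assume "det ?A = 0"
    then obtain y where y: "y \<in> carrier_vec N" "y \<noteq> 0\<^sub>v N" "?A *\<^sub>v y = 0\<^sub>v N"
      using det_0_iff_vec_prod_zero[OF A] by blast
    have row: "(\<Sum>b<N. peval (vertex (Some 0)) (vec_matrix d r v $$ (k, b)) * y $ b) = 0"
      if k: "k < Suc N" "k \<noteq> i" for k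
    proof -
      obtain a where a: "a < N" "k = insert_index i a"
        using bij_betw_imp_surj_on[OF bij_insert_index[OF iN]] k by blast
      have "(?A *\<^sub>v y) $ a = 0" using y(3) a(1) by simp
      then show ?thesis
        using a y(1) A vec_carrier[of v] by (simp add: scalar_prod_def row_del_def atLeast0LessThan)
    qed
    have "is_cone d (vertex (Some 0)) (form_of d (\<lambda>b. y $ b)) \<and>
        (\<forall>j<r. j \<noteq> i \<longrightarrow> peval (v j) (form_of d (\<lambda>b. y $ b)) = 0)"
      unfolding kernel_iff_cone[OF d, symmetric]
    proof (intro allI impI)
      fix k assume "k < r + length (monomials (d - 1))" "\<not> (k = i \<and> k < r)"
      then show "(\<Sum>j<length (monomials d). peval (vertex (Some 0)) (vec_matrix d r v $$ (k, j)) * y $ j) = 0"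
        using row[of k] i rn by (auto simp: n_def N_def)
    qed
    moreover have "\<forall>l<(d + 2) choose 2. \<exists>j<r. j \<noteq> i \<and> v j = w l"
    proof (intro allI impI)
      fix l assume "l < (d + 2) choose 2"
      then show "\<exists>j<r. j \<noteq> i \<and> v j = w l"
        by (intro exI[of _ "if l < i then l else Suc l"]) (auto simp: v_def r_def)
    qed
    ultimately have "form_of d (\<lambda>b. y $ b) = 0" using w by metis
    then have "y = 0\<^sub>v N" using y(1) by (intro eq_vecI) (auto simp: form_of_eq_0_iff N_def)
    then show False using y(2) by simp
  qed
  then have "peval (vertex (Some 0)) (det (row_del (vec_matrix d r v) i)) \<noteq> 0" by (metis peval_det)
  moreover have "(\<lambda>k. v i k) = vertex (Some 0)" by (simp add: v_def)
  ultimately have "peval ?u (vertex_cert d r i) \<noteq> 0" unfolding peval_vertex_cert[OF i] by simp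
  then show ?thesis by blast
qed

lemma distinct_cert_nonzero:
  assumes "i \<noteq> j"
  shows "\<exists>u. peval u (distinct_cert (i, j)) \<noteq> 0"
  by (rule exI[of _ "\<lambda>x. if x = (i, 0) \<or> x = (j, 1) then 1 else 0"])
     (use assms in \<open>simp add: peval_distinct_cert\<close>)

definition pairs :: "(nat \<times> nat) set" where "pairs = {(i, j). i < j \<and> j < r}"

lemma finite_pairs: "finite pairs"
  by (rule finite_subset[of _ "{..<r} \<times> {..<r}"]) (auto simp: pairs_def)

definition cert :: config_poly where
  "cert = line_cert d r * (\<Prod>i<r. vertex_cert d r i) * (\<Prod>x\<in>pairs. distinct_cert x)"

lemma mhom_cert: "mhom r cert"
  unfolding cert_def
  by (intro mhom_mult mhom_prod mhom_line_cert mhom_vertex_cert) (auto simp: pairs_def intro!: mhom_distinct_cert)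

lemma peval_prod: "peval v (prod f S) = (\<Prod>x\<in>S. peval v (f x))"
  by (induction S rule: infinite_finite_induct) (simp_all add: peval_mult)

lemma peval_cert: "peval u cert \<noteq> 0 \<longleftrightarrow> peval u (line_cert d r) \<noteq> 0 \<and>
    (\<forall>i<r. peval u (vertex_cert d r i) \<noteq> 0) \<and> (\<forall>x\<in>pairs. peval u (distinct_cert x) \<noteq> 0)"
  using finite_pairs by (auto simp: cert_def peval_mult peval_prod prod_zero_iff)

lemma cert_nonzero: "\<exists>u. peval u cert \<noteq> 0"
proof -
  define \<F> where "\<F> = (\<lambda>f u. peval u f) ` (insert (line_cert d r) (vertex_cert d r ` {..<r} \<union> distinct_cert ` pairs))"
  have "\<exists>u. \<forall>f\<in>\<F>. f u \<noteq> 0"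
  proof (rule common_nonzero)
    show "finite \<F>" using finite_pairs by (simp add: \<F>_def)
    show "line_poly f" if "f \<in> \<F>" for f using that by (auto simp: \<F>_def line_poly_peval)
    show "\<exists>u. f u \<noteq> 0" if "f \<in> \<F>" for f
      using that line_cert_nonzero vertex_cert_nonzero distinct_cert_nonzero
      by (auto simp: \<F>_def pairs_def)
  qed
  then obtain u where "\<forall>f\<in>\<F>. f u \<noteq> 0" by blast
  then have "peval u cert \<noteq> 0" unfolding peval_cert by (auto simp: \<F>_def)
  then show ?thesis by blast
qed

end

lemma rep_abs_proj3:
  assumes "v \<noteq> (\<lambda>_. 0)"
  shows "\<exists>c. c \<noteq> 0 \<and> rep_proj3 (abs_proj3 v) = (\<lambda>i. c * v i)"
proof -
  have "proportional v v" using assms unfolding proportional_def by (auto intro!: exI[of _ 1])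
  then have p: "proportional v (rep_proj3 (abs_proj3 v))" by (rule rep_abs_rsp[OF Quotient3_proj3])
  then obtain c where c: "rep_proj3 (abs_proj3 v) = (\<lambda>i. c * v i)" by (auto simp: proportional_def)
  have "c \<noteq> 0" using p c by (auto simp: proportional_def)
  then show ?thesis using c by blast
qed

text \<open>
  A nonzero of the certificate has nonzero coordinate vectors, because every index occurs in a
  pair of distinct points; so it defines a configuration in projective space, and the
  certificate is insensitive to the choice of representatives.
\<close>

lemma cert_point:
  assumes d: "0 < d"
  shows "\<exists>Ps. length Ps = Suc ((d + 2) choose 2) \<and> peval (\<lambda>(i, j). rep_proj3 (Ps ! i) j) (cert d) \<noteq> 0"
proof -
  let ?r = "Suc ((d + 2) choose 2)"
  obtain u where u: "peval u (cert d) \<noteq> 0" using cert_nonzero[OF d] by blast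
  have nz: "(\<lambda>k. u (i, k)) \<noteq> (\<lambda>_. 0)" if i: "i < ?r" for i
  proof
    assume z: "(\<lambda>k. u (i, k)) = (\<lambda>_. 0)"
    then have z: "u (i, k) = 0" for k by (simp add: fun_eq_iff)
    have r2: "1 < ?r" by (simp add: zero_less_binomial)
    obtain x where x: "x \<in> pairs d" "fst x = i \<or> snd x = i"
    proof (cases "i = 0")
      case True
      then show ?thesis using that[of "(0, 1)"] r2 by (simp add: pairs_def[OF d])
    next
      case False
      then show ?thesis using that[of "(0, i)"] i by (simp add: pairs_def[OF d])
    qed
    have "peval u (distinct_cert x) = 0"
      using x(2) z by (cases x) (auto simp: peval_distinct_cert[OF d])
    then show False using u x(1) unfolding peval_cert[OF d] by blast
  qed
  define Ps where "Ps = map (\<lambda>i. abs_proj3 (\<lambda>k. u (i, k))) [0..<?r]"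
  have "\<forall>i. \<exists>c. i < ?r \<longrightarrow> c \<noteq> 0 \<and> rep_proj3 (abs_proj3 (\<lambda>k. u (i, k))) = (\<lambda>k. c * u (i, k))"
    using rep_abs_proj3[OF nz] by blast
  then obtain c where c: "\<And>i. i < ?r \<Longrightarrow> c i \<noteq> 0"
      "\<And>i. i < ?r \<Longrightarrow> rep_proj3 (abs_proj3 (\<lambda>k. u (i, k))) = (\<lambda>k. c i * u (i, k))"
    by metis
  have "peval (\<lambda>(i, j). rep_proj3 (Ps ! i) j) (cert d) \<noteq> 0"
    by (rule mhom_rescale[OF mhom_cert[OF d] c(1) _ u]) (auto simp: Ps_def c(2) simp del: upt_Suc)
  then show ?thesis by (intro exI[of _ Ps]) (simp add: Ps_def)
qed

section \<open>The Weddle scheme of a general set of points\<close>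

lemma Idl_signed_minors:
  assumes "finite S"
  shows "genideal PR ((\<lambda>i. det (row_del A i)) ` S) = {f. \<exists>h. f = (\<Sum>i\<in>S. h i * ((-1) ^ i * det (row_del A i)))}"
  unfolding Idl_eq[OF assms]
proof (intro Collect_cong iffI)
  fix f assume "\<exists>h. f = (\<Sum>i\<in>S. h i * det (row_del A i))"
  then obtain h where "f = (\<Sum>i\<in>S. h i * det (row_del A i))" by blast
  also have "\<dots> = (\<Sum>i\<in>S. (h i * (-1) ^ i) * ((-1) ^ i * det (row_del A i)))"
    by (intro sum.cong refl) (simp add: mult.assoc power_add[symmetric] flip: mult.assoc[of "(-1) ^ _" "(-1) ^ _"])
  finally show "\<exists>h. f = (\<Sum>i\<in>S. h i * ((-1) ^ i * det (row_del A i)))"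
    by (rule exI[of _ "\<lambda>i. h i * (-1) ^ i"])
next
  fix f assume "\<exists>h. f = (\<Sum>i\<in>S. h i * ((-1) ^ i * det (row_del A i)))"
  then obtain h where "f = (\<Sum>i\<in>S. h i * ((-1) ^ i * det (row_del A i)))" by blast
  also have "\<dots> = (\<Sum>i\<in>S. (h i * (-1) ^ i) * det (row_del A i))"
    by (simp add: mult.assoc)
  finally show "\<exists>h. f = (\<Sum>i\<in>S. h i * det (row_del A i))"
    by (rule exI[of _ "\<lambda>i. h i * (-1) ^ i"])
qed

lemma pick_lessThan: "b < N \<Longrightarrow> pick {..<N} b = b"
  using pick_card_in_set[of b "{..<N}"] by (simp add: Collect_conj_eq lessThan_def[symmetric] Int_absorb1 lessThan_subset_iff)

lemma pick_remove:
  assumes a: "a < N" and i: "i < Suc N"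
  shows "pick ({..<Suc N} - {i}) a = insert_index i a"
proof -
  let ?S = "{..<Suc N} - {i}"
  have mem: "insert_index i a \<in> ?S" using a i by (auto simp: insert_index_def)
  have "card {x \<in> ?S. x < insert_index i a} = a"
  proof (cases "a < i")
    case True
    then have "{x \<in> ?S. x < insert_index i a} = {..<a}" using a by (auto simp: insert_index_def)
    then show ?thesis by simp
  next
    case False
    then have "{x \<in> ?S. x < insert_index i a} = {..<Suc a} - {i}" using a by (auto simp: insert_index_def)
    then show ?thesis using False by simp
  qed
  then show ?thesis using pick_card_in_set[OF mem] by simp
qed

lemma submatrix_row_del:
  assumes A: "A \<in> carrier_mat (Suc N) N" and i: "i < Suc N"
  shows "submatrix A ({..<Suc N} - {i}) {..<N} = row_del A i"
proof -
  have "{k. k < dim_row A \<and> k \<in> {..<Suc N} - {i}} = {..<Suc N} - {i}" using A by auto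
  then have c1: "card {k. k < dim_row A \<and> k \<in> {..<Suc N} - {i}} = N" using i by simp
  have "{k. k < dim_col A \<and> k \<in> {..<N}} = {..<N}" using A by auto
  then have c2: "card {k. k < dim_col A \<and> k \<in> {..<N}} = N" by simp
  show ?thesis
    by (rule eq_matI) (use A i c1 c2 in \<open>simp_all add: submatrix_def row_del_def pick_lessThan pick_remove\<close>)
qed

text \<open>With one row more than columns, a maximal minor is given by the row that it omits.\<close>

lemma maximal_minors:
  fixes A :: "poly4 mat"
  assumes A: "A \<in> carrier_mat (Suc N) N"
  shows "minors N A = (\<lambda>i. det (row_del A i)) ` {..<Suc N}"
proof
  show "minors N A \<subseteq> (\<lambda>i. det (row_del A i)) ` {..<Suc N}"
  proof
    fix f assume "f \<in> minors N A"
    then obtain I K where IK: "f = det (submatrix A I K)" "I \<subseteq> {..<Suc N}" "K \<subseteq> {..<N}" "card I = N" "card K = N"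
      using A unfolding minors_def by auto
    have K: "K = {..<N}" using IK by (intro card_subset_eq) auto
    have "card ({..<Suc N} - I) = 1" using IK by (subst card_Diff_subset) (auto intro: finite_subset)
    then obtain i where i: "{..<Suc N} - I = {i}" by (auto simp: card_1_singleton_iff)
    then have "I = {..<Suc N} - {i}" "i < Suc N" using IK(2) by auto
    then show "f \<in> (\<lambda>i. det (row_del A i)) ` {..<Suc N}" using IK(1) K submatrix_row_del[OF A] by auto
  qed
  show "(\<lambda>i. det (row_del A i)) ` {..<Suc N} \<subseteq> minors N A"
  proof (rule image_subsetI)
    fix i assume i: "i \<in> {..<Suc N}"
    then have "card ({..<Suc N} - {i}) = N" by simp
    then show "det (row_del A i) \<in> minors N A"
      using A i submatrix_row_del[OF A, of i, symmetric] unfolding minors_def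
      by (intro CollectI exI[of _ "{..<Suc N} - {i}"] exI[of _ "{..<N}"]) auto
  qed
qed

lemma peval_nonzero_point:
  assumes f: "f \<in> forms t" "0 < t" and v: "peval v f \<noteq> 0"
  shows "\<exists>P c. c \<noteq> 0 \<and> rep_proj3 P = (\<lambda>i. c * v i)"
proof -
  have "v \<noteq> (\<lambda>_. 0)"
  proof
    assume "v = (\<lambda>_. 0)"
    then have "peval v f = 0" using peval_forms_scale[OF f(1), of 0 v] f(2) by (simp add: zero_power)
    then show False using v by simp
  qed
  then show ?thesis using rep_abs_proj3 by blast
qed

lemma real_choose_two: "real (m choose 2) = real m * (real m - 1) / 2"
proof (induction m)
  case (Suc m)
  have "Suc m choose 2 = m + (m choose 2)" by (simp add: numeral_2_eq_2)
  then show ?case using Suc by (simp add: field_simps)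
qed simp

text \<open>Two polynomials that agree at all large integers are equal.\<close>

lemma hilbert_polynomial_eqI:
  assumes "\<forall>\<^sub>F t in sequentially. real (hilbert_function I t) = poly p (real t)"
  shows "hilbert_polynomial I = p"
  unfolding hilbert_polynomial_def
proof (rule the_equality)
  show "\<forall>\<^sub>F t in sequentially. real (hilbert_function I t) = poly p (real t)" by (rule assms)
next
  fix q assume "\<forall>\<^sub>F t in sequentially. real (hilbert_function I t) = poly q (real t)"
  then have "\<forall>\<^sub>F t in sequentially. poly (q - p) (real t) = 0" using assms
    by eventually_elim simp
  then obtain T where T: "\<And>t. t \<ge> T \<Longrightarrow> poly (q - p) (real t) = 0" by (auto simp: eventually_sequentially)
  have "q - p = 0"
  proof (rule ccontr)
    assume "q - p \<noteq> 0"
    then have "finite {x. poly (q - p) x = 0}" by (rule poly_roots_finite)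
    moreover have "real ` {T..} \<subseteq> {x. poly (q - p) x = 0}" using T by auto
    ultimately have "finite (real ` {T..})" by (rule rev_finite_subset)
    then have "finite {T..}" by (rule finite_imageD) (simp add: inj_on_def)
    then show False using infinite_Ici by blast
  qed
  then show "q = p" by simp
qed

locale general_points =
  fixes d :: nat and Ps :: "proj3 list"
  assumes d2: "2 \<le> d" and len: "length Ps = Suc ((d + 2) choose 2)"
    and cert: "peval (\<lambda>(i, j). rep_proj3 (Ps ! i) j) (cert d) \<noteq> 0"
begin

abbreviation num :: nat where "num \<equiv> Suc ((d + 2) choose 2)"

definition N :: nat where "N = length (monomials d)"

definition n :: nat where "n = length (monomials (d - 1))"

definition \<Lambda> :: "poly4 mat" where "\<Lambda> = interpolation_matrix d Ps"

lemma d0: "0 < d" using d2 by simp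

lemma rN: "num + n = Suc N"
  using row_count[OF d0] by (simp only: n_def N_def)

lemma \<Lambda>_vec: "\<Lambda> = vec_matrix d num (\<lambda>i. rep_proj3 (Ps ! i))"
  unfolding \<Lambda>_def interpolation_matrix_vec len ..

lemma certs:
  "det (mat n n (\<lambda>(i, k). peval (line_pt (of_nat k)) (det (row_del \<Lambda> (num + i))))) \<noteq> 0"
  "i < num \<Longrightarrow> peval (rep_proj3 (Ps ! i)) (det (row_del \<Lambda> i)) \<noteq> 0"
  "i < j \<Longrightarrow> j < num \<Longrightarrow> Ps ! i \<noteq> Ps ! j"
proof -
  let ?u = "\<lambda>(i, j). rep_proj3 (Ps ! i) j"
  have c: "peval ?u (line_cert d num) \<noteq> 0" "\<And>i. i < num \<Longrightarrow> peval ?u (vertex_cert d num i) \<noteq> 0"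
    "\<And>x. x \<in> pairs d \<Longrightarrow> peval ?u (distinct_cert x) \<noteq> 0"
    using cert unfolding peval_cert[OF d0] by auto
  have eta: "(\<lambda>i k. ?u (i, k)) = (\<lambda>i. rep_proj3 (Ps ! i))" by (simp add: fun_eq_iff)
  show "det (mat n n (\<lambda>(i, k). peval (line_pt (of_nat k)) (det (row_del \<Lambda> (num + i))))) \<noteq> 0"
    using c(1) unfolding peval_line_cert[OF d0] eta \<Lambda>_vec n_def .
  show "peval (rep_proj3 (Ps ! i)) (det (row_del \<Lambda> i)) \<noteq> 0" if "i < num"
    using c(2)[OF that] unfolding peval_vertex_cert[OF d0 that] eta \<Lambda>_vec by simp
  show "Ps ! i \<noteq> Ps ! j" if "i < j" "j < num"
  proof
    assume e: "Ps ! i = Ps ! j"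
    have "(i, j) \<in> pairs d" using that by (simp add: pairs_def[OF d0])
    then have "peval ?u (distinct_cert (i, j)) \<noteq> 0" by (rule c(3))
    then show False using e by (simp add: peval_distinct_cert[OF d0])
  qed
qed

lemma distinct_Ps: "distinct Ps"
  unfolding distinct_conv_nth len by (metis certs(3) linorder_neqE_nat)

sublocale linear_hilbert_burch \<Lambda> N n
proof -
  have "linear_rows \<Lambda> N n"
    using vec_matrix_linear_rows[OF d0] unfolding \<Lambda>_vec N_def n_def .
  moreover have "Suc N - n = num" using rN by linarith
  ultimately show "linear_hilbert_burch \<Lambda> N n"
    using certs(1) by (simp add: linear_hilbert_burch_def linear_hilbert_burch_axioms_def)
qed

lemma n_eq: "n = (d + 2) choose 3"
  using d0 by (simp add: n_def length_monomials)

lemma n_ge: "4 \<le> n"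
proof -
  obtain k where "d = Suc (Suc k)" using d2 by (metis add_2_eq_Suc le_Suc_ex)
  then show ?thesis unfolding n_eq by (simp add: numeral_3_eq_3)
qed

lemma rank_N:
  assumes "i < Suc N" "peval (rep_proj3 P) (det (row_del \<Lambda> i)) \<noteq> 0"
  shows "rank_at \<Lambda> P = N"
proof -
  let ?B = "map_mat (peval (rep_proj3 P)) \<Lambda>"
  have B: "?B \<in> carrier_mat (Suc N) N" using A by simp
  have "det (submatrix ?B ({..<Suc N} - {i}) {..<N}) \<noteq> 0"
    unfolding submatrix_row_del[OF B assms(1)] map_row_del[OF A assms(1)] peval_det by (rule assms(2))
  then have "card {j. j < N \<and> j \<in> {..<N}} \<le> vec_space.rank (Suc N) ?B"
    by (rule vec_space.rank_gt_minor[OF B])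
  moreover have "{j. j < N \<and> j \<in> {..<N}} = {..<N}" by auto
  ultimately show ?thesis
    using vec_space.rank_le_nc[OF B] A unfolding rank_at_def by (metis antisym card_lessThan carrier_matD(1))
qed

text \<open>
  The rank is \<open>N\<close> where a nonzero minor does not vanish, and any other nonempty open set meets
  this one, since two nonzero polynomials have a common nonzero.
\<close>

lemma generic_rank_N: "generic_rank \<Lambda> = N"
proof -
  obtain i where i: "i < n" "det (row_del \<Lambda> (Suc N - n + i)) \<noteq> 0" using some_minor_nonzero by blast
  define k where "k = Suc N - n + i"
  have k: "k < Suc N" using i(1) n(2) by (simp add: k_def)
  define f where "f = det (row_del \<Lambda> k)"
  have f: "f \<in> forms (mdegree k)" unfolding f_def by (rule det_row_del_forms[OF k])
  have t: "0 < mdegree k" using n_ge by (simp add: mdegree_def rdeg_def)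
  have "f \<noteq> 0" using i(2) by (simp add: f_def k_def)
  then obtain v0 where v0: "peval v0 f \<noteq> 0" using peval_eq_0_imp by blast
  define U where "U = {P. peval (rep_proj3 P) f \<noteq> 0}"
  have "zariski_open U"
    unfolding zariski_open_def zariski_closed_def
    using f by (intro exI[of _ "{f}"]) (auto simp: U_def zero_locus_def homogeneous_def)
  moreover have "U \<noteq> {}"
  proof -
    obtain P c where P: "c \<noteq> 0" "rep_proj3 P = (\<lambda>i. c * v0 i)" using peval_nonzero_point[OF f t v0] by blast
    then have "P \<in> U" using v0 by (simp add: U_def peval_forms_scale[OF f])
    then show ?thesis by blast
  qed
  moreover have U: "\<forall>P\<in>U. rank_at \<Lambda> P = N" using rank_N[OF k] by (simp add: U_def f_def)
  ultimately have ex: "\<exists>U. zariski_open U \<and> U \<noteq> {} \<and> (\<forall>P\<in>U. rank_at \<Lambda> P = N)" by blast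
  show ?thesis
    unfolding generic_rank_def
  proof (rule the_equality)
    show "\<exists>U. zariski_open U \<and> U \<noteq> {} \<and> (\<forall>P\<in>U. rank_at \<Lambda> P = N)" by (rule ex)
  next
    fix \<rho> assume "\<exists>U. zariski_open U \<and> U \<noteq> {} \<and> (\<forall>P\<in>U. rank_at \<Lambda> P = \<rho>)"
    then obtain U' where U': "zariski_open U'" "U' \<noteq> {}" "\<forall>P\<in>U'. rank_at \<Lambda> P = \<rho>" by blast
    obtain F where F: "\<forall>g\<in>F. homogeneous g" "- U' = zero_locus F"
      using U'(1) unfolding zariski_open_def zariski_closed_def by blast
    obtain P' where P': "P' \<in> U'" using U'(2) by blast
    then have "P' \<notin> zero_locus F" using F(2) by blast
    then obtain g where g: "g \<in> F" "peval (rep_proj3 P') g \<noteq> 0" by (auto simp: zero_locus_def)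
    obtain s where s: "g \<in> forms s" using F(1) g(1) by (auto simp: homogeneous_def)
    have "\<exists>v. \<forall>h\<in>{\<lambda>v. peval v f, \<lambda>v. peval v g}. h v \<noteq> 0"
      by (rule common_nonzero) (use v0 g(2) line_poly_peval in auto)
    then obtain v where v: "peval v f \<noteq> 0" "peval v g \<noteq> 0" by auto
    obtain P c where P: "c \<noteq> 0" "rep_proj3 P = (\<lambda>i. c * v i)" using peval_nonzero_point[OF f t v(1)] by blast
    have "P \<in> U" using P v by (simp add: U_def peval_forms_scale[OF f])
    moreover have "P \<notin> zero_locus F" 
      using P v g(1) by (auto simp: zero_locus_def peval_forms_scale[OF s] intro!: bexI[of _ g])
    then have "P \<in> U'" using F(2) by blast
    ultimately show "\<rho> = N" using U U'(3) by auto
  qed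
qed

text \<open>
  A power of \<open>x\<^sub>0\<close> lies in the given power of the irrelevant ideal and is regular modulo \<open>J\<close>.
\<close>

lemma saturation_J: "saturation J = J"
proof
  show "J \<subseteq> saturation J"
    unfolding saturation_def using isidealD(3)[OF isideal_J] by blast
  show "saturation J \<subseteq> J"
  proof
    fix f assume "f \<in> saturation J"
    then obtain k where k: "\<And>g. g \<in> ideal_power irrelevant_ideal k \<Longrightarrow> g * f \<in> J" by (auto simp: saturation_def)
    have "var 0 \<in> irrelevant_ideal"
      unfolding irrelevant_ideal_def using ring.genideal_self[OF PR_ring, of "{var i | i. True}"] by auto
    then have "1 * var 0 ^ k \<in> ideal_power irrelevant_ideal (0 + k)"
      by (intro ideal_power_mult_power) (simp add: ideal_power_0)
    then have "var 0 ^ k * f \<in> J" using k by simp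
    then show "f \<in> J"
    proof (induction k)
      case (Suc k)
      have "(var 0 - const 0) * (var 0 ^ k * f) \<in> J" using Suc.prems by (simp add: mult.assoc)
      then have "var 0 ^ k * f \<in> J" by (rule regular_0)
      then show ?case by (rule Suc.IH)
    qed simp
  qed
qed

lemma Idl_minors: "genideal PR (minors N \<Lambda>) = J"
  unfolding maximal_minors[OF A] Idl_signed_minors[OF finite_lessThan] J_def minr_def ..

lemma weddle_scheme_J: "weddle_scheme d Ps = J"
  unfolding weddle_scheme_def Let_def \<Lambda>_def[symmetric] generic_rank_N Idl_minors by (rule saturation_J)

text \<open>
  The number of reduced monomials of degree \<open>t\<close> is eventually a linear polynomial in \<open>t\<close>, whose
  leading coefficient is the number \<open>n choose 2\<close> of monomials \<open>x\<^sub>2\<^sup>a x\<^sub>3\<^sup>b\<close> with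
  \<open>a + b < n - 1\<close>.
\<close>

lemma scheme_degree_J: "scheme_degree J = real (n choose 2)"
proof -
  define p where "p = n - 1"
  have rp: "real p = real n - 1" using n(1) by (simp add: p_def)
  define a b where "a = real p * (real p + 1) / 2" and "b = a - (real p - 1) * real p * (real p + 1) / 3"
  have "\<forall>\<^sub>F t in sequentially. real (hilbert_function J t) = poly [:b, a:] (real t)"
    unfolding eventually_sequentially
  proof (intro exI[of _ n] allI impI)
    fix t assume t: "n \<le> t"
    show "real (hilbert_function J t) = poly [:b, a:] (real t)"
      unfolding hilbert_function_J[OF t] p_def[symmetric] using t
      by (subst real_card_red_mons) (simp_all add: p_def[symmetric] a_def b_def algebra_simps, simp add: p_def)
  qed
  then have h: "hilbert_polynomial J = [:b, a:]" by (rule hilbert_polynomial_eqI)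
  have "a \<noteq> 0" using n_ge by (simp add: a_def p_def)
  then have "scheme_degree J = a" unfolding scheme_degree_def Let_def h by simp
  also have "a = real (n choose 2)" unfolding a_def rp real_choose_two by (simp add: mult.commute)
  finally show ?thesis .
qed

text \<open>
  All maximal minors vanish at a point if and only if the matrix has a kernel there, and the
  kernel consists of cones.
\<close>

lemma zero_locus_cone:
  "P \<in> zero_locus J \<longleftrightarrow>
    (\<exists>F. F \<noteq> 0 \<and> is_cone d (rep_proj3 P) F \<and> (\<forall>P'\<in>set Ps. peval (rep_proj3 P') F = 0))"
proof -
  let ?q = "rep_proj3 P" and ?v = "\<lambda>i. rep_proj3 (Ps ! i)"
  let ?B = "map_mat (peval ?q) \<Lambda>"
  have B: "?B \<in> carrier_mat (Suc N) N" using A by simp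
  have mem: "P \<in> zero_locus J \<longleftrightarrow> (\<forall>i<Suc N. det (row_del ?B i) = 0)"
  proof -
    have e: "det (row_del ?B i) = peval ?q (det (row_del \<Lambda> i))" if "i < Suc N" for i
      unfolding map_row_del[OF A that] by (rule peval_det)
    show ?thesis
    proof
      assume "P \<in> zero_locus J"
      then show "\<forall>i<Suc N. det (row_del ?B i) = 0" using det_row_del_in_J by (simp add: zero_locus_def e)
    next
      assume z: "\<forall>i<Suc N. det (row_del ?B i) = 0"
      have "peval ?q f = 0" if "f \<in> J" for f
      proof -
        obtain h where h: "f = (\<Sum>i<Suc N. h i * minr i)" using \<open>f \<in> J\<close> by (auto simp: J_def)
        show ?thesis unfolding h peval_sum
        proof (rule sum.neutral, rule ballI)
          fix i assume "i \<in> {..<Suc N}"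
          then show "peval ?q (h i * minr i) = 0" using z e[of i] by (simp add: minr_def peval_mult)
        qed
      qed
      then show "P \<in> zero_locus J" by (simp add: zero_locus_def)
    qed
  qed
  have all: "(\<forall>P'\<in>set Ps. peval (rep_proj3 P') F = 0) \<longleftrightarrow> (\<forall>i<num. i \<noteq> num \<longrightarrow> peval (?v i) F = 0)" for F
    unfolding all_set_conv_all_nth len by auto
  have ker: "(\<forall>k<Suc N. (\<Sum>b<N. ?B $$ (k, b) * y b) = 0) \<longleftrightarrow>
      is_cone d ?q (form_of d y) \<and> (\<forall>P'\<in>set Ps. peval (rep_proj3 P') (form_of d y) = 0)" for y
  proof -
    have "(\<forall>k<Suc N. (\<Sum>b<N. ?B $$ (k, b) * y b) = 0) \<longleftrightarrow>
      (\<forall>k<num + length (monomials (d - 1)). \<not> (k = num \<and> k < num) \<longrightarrow>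
        (\<Sum>j<length (monomials d). peval ?q (vec_matrix d num ?v $$ (k, j)) * y j) = 0)"
      unfolding n_def[symmetric] N_def[symmetric] rN \<Lambda>_vec[symmetric] using A
      by (intro all_cong) simp
    then show ?thesis unfolding kernel_iff_cone[OF d0] all .
  qed
  show ?thesis
  proof
    assume P: "P \<in> zero_locus J"
    have "\<not> (\<forall>y. (\<forall>k<Suc N. (\<Sum>b<N. ?B $$ (k, b) * y b) = 0) \<longrightarrow> (\<forall>b<N. y b = 0))"
      using kernel_trivial_minor[OF B] P unfolding mem by blast
    then obtain y where y: "\<forall>k<Suc N. (\<Sum>b<N. ?B $$ (k, b) * y b) = 0" "\<not> (\<forall>b<N. y b = 0)" by blast
    have "form_of d y \<noteq> 0" using y(2) by (simp add: form_of_eq_0_iff N_def)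
    then show "\<exists>F. F \<noteq> 0 \<and> is_cone d ?q F \<and> (\<forall>P'\<in>set Ps. peval (rep_proj3 P') F = 0)"
      using y(1) unfolding ker by blast
  next
    assume "\<exists>F. F \<noteq> 0 \<and> is_cone d ?q F \<and> (\<forall>P'\<in>set Ps. peval (rep_proj3 P') F = 0)"
    then obtain F where F: "F \<noteq> 0" "is_cone d ?q F" "\<forall>P'\<in>set Ps. peval (rep_proj3 P') F = 0" by blast
    define y where "y j = lk F (monomials d ! j)" for j
    have Fy: "form_of d y = F" unfolding y_def using F(2) by (intro form_of_lk) (simp add: is_cone_def)
    have "\<forall>k<Suc N. (\<Sum>b<N. ?B $$ (k, b) * y b) = 0" unfolding ker Fy using F(2,3) by blast
    then have "y b = 0" if "det (row_del ?B i) \<noteq> 0" "i < Suc N" "b < N" for i b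
      using inj_row_del[OF B that(2,1) _ that(3), of y] by blast
    moreover obtain b where "b < N" "y b \<noteq> 0" using F(1) Fy form_of_eq_0_iff[of d y] by (auto simp: N_def)
    ultimately show "P \<in> zero_locus J" unfolding mem by blast
  qed
qed

text \<open>
  The generic dimension of the space of cones is zero. Hence the jump locus consists of the
  zeros of \<open>J\<close> outside the given points, and these points are no zeros of \<open>J\<close> by the second part
  of the certificate. It is closed already.
\<close>

lemma zero_locus_weddle: "zero_locus J = weddle_locus d (set Ps)"
proof -
  have pos: "cone_dim d (set Ps) P > 0 \<longleftrightarrow> P \<in> zero_locus J" for P
    unfolding zero_locus_cone cone_dim_pos_iff ..
  have off: "P \<notin> set Ps" if P: "P \<in> zero_locus J" for P
  proof
    assume "P \<in> set Ps"
    then obtain i where i: "i < num" "P = Ps ! i" by (auto simp: in_set_conv_nth len)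
    have "i < Suc N" using i(1) rN by linarith
    then have "peval (rep_proj3 P) (det (row_del \<Lambda> i)) = 0"
      using P det_row_del_in_J by (simp add: zero_locus_def)
    then show False using certs(2)[OF i(1)] i(2) by simp
  qed
  \<comment> \<open>Some minor is nonzero on the line, so it is nonzero at a point of the line outside the given
    ones.\<close>
  have inf: "(INF Q\<in>- set Ps. cone_dim d (set Ps) Q) = 0"
  proof -
    obtain i where i: "i < n" "\<exists>k. peval (line_pt (of_nat k)) (det (row_del \<Lambda> (Suc N - n + i))) \<noteq> 0"
    proof (rule ccontr)
      assume "\<not> thesis"
      then have "\<And>i k. i < n \<Longrightarrow> peval (line_pt (of_nat k)) (det (row_del \<Lambda> (Suc N - n + i))) = 0"
        using that by blast
      then have "mat n n (\<lambda>(i, k). peval (line_pt (of_nat k)) (det (row_del \<Lambda> (Suc N - n + i)))) = 0\<^sub>m n n"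
        by (intro eq_matI) auto
      then show False using line n(1) by simp
    qed
    define f where "f = det (row_del \<Lambda> (Suc N - n + i))"
    have k: "Suc N - n + i < Suc N" using i(1) n(2) by simp
    have fJ: "f \<in> J" unfolding f_def by (rule det_row_del_in_J[OF k])
    have f: "f \<in> forms (mdegree (Suc N - n + i))" unfolding f_def by (rule det_row_del_forms[OF k])
    have nz: "line_restr f \<noteq> 0" using i(2) by (auto simp: f_def simp flip: poly_line_restr)
    define pt where "pt s = abs_proj3 (line_pt s)" for s
    have pt: "\<exists>c. c \<noteq> 0 \<and> rep_proj3 (pt s) = (\<lambda>i. c * line_pt s i)" for s
      unfolding pt_def by (rule rep_abs_proj3) (auto simp: fun_eq_iff intro!: exI[of _ 2])
    have inj: "inj pt"
    proof (rule injI)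
      fix s t assume e: "pt s = pt t"
      obtain a where a: "a \<noteq> 0" "rep_proj3 (pt s) = (\<lambda>i. a * line_pt s i)" using pt by blast
      obtain b where b: "b \<noteq> 0" "rep_proj3 (pt t) = (\<lambda>i. b * line_pt t i)" using pt by blast
      have "a * line_pt s i = b * line_pt t i" for i using a(2) b(2) e by (metis (no_types))
      from this[of 2] this[of 3] show "s = t" using a(1) by simp
    qed
    have "finite ({s. poly (line_restr f) s = 0} \<union> pt -` set Ps)"
      using poly_roots_finite[OF nz] inj by (simp add: finite_vimageI)
    then obtain s where s: "s \<notin> {s. poly (line_restr f) s = 0} \<union> pt -` set Ps"
      using ex_new_if_finite[OF infinite_UNIV_char_0] by blast
    obtain c where c: "c \<noteq> 0" "rep_proj3 (pt s) = (\<lambda>i. c * line_pt s i)" using pt by blast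
    have "peval (rep_proj3 (pt s)) f \<noteq> 0"
      unfolding c(2) peval_forms_scale[OF f] using s c(1) by (simp add: poly_line_restr)
    then have "pt s \<notin> zero_locus J" using fJ by (auto simp: zero_locus_def)
    then have "cone_dim d (set Ps) (pt s) = 0" using pos by blast
    moreover have "pt s \<in> - set Ps" using s by simp
    ultimately show ?thesis by (metis (no_types, lifting) bdd_below_bot cINF_lower le_zero_eq)
  qed
  have "{P. P \<notin> set Ps \<and> cone_dim d (set Ps) P > (INF Q\<in>- set Ps. cone_dim d (set Ps) Q)} = zero_locus J"
    unfolding inf using pos off by blast
  then have W: "weddle_locus d (set Ps) = zariski_closure (zero_locus J)" by (simp add: weddle_locus_def)
  have "zariski_closed (zero_locus J)"
  proof -
    let ?F = "(\<lambda>i. det (row_del \<Lambda> i)) ` {..<Suc N}"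
    have "zero_locus J = zero_locus ?F"
    proof
      show "zero_locus J \<subseteq> zero_locus ?F" using det_row_del_in_J by (auto simp: zero_locus_def simp del: lessThan_Suc)
      show "zero_locus ?F \<subseteq> zero_locus J"
      proof
        fix P assume P: "P \<in> zero_locus ?F"
        have "peval (rep_proj3 P) f = 0" if fJ: "f \<in> J" for f
        proof -
          obtain h where h: "f = (\<Sum>i<Suc N. h i * minr i)" using fJ by (auto simp: J_def)
          show ?thesis unfolding h peval_sum
          proof (rule sum.neutral, rule ballI)
            fix i assume "i \<in> {..<Suc N}"
            then show "peval (rep_proj3 P) (h i * minr i) = 0"
              using P by (simp add: minr_def peval_mult zero_locus_def del: lessThan_Suc)
          qed
        qed
        then show "P \<in> zero_locus J" by (simp add: zero_locus_def)
      qed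
    qed
    moreover have "\<forall>f\<in>?F. homogeneous f"
      using det_row_del_forms by (auto simp: homogeneous_def simp del: lessThan_Suc)
    ultimately show ?thesis unfolding zariski_closed_def by (intro exI[of _ ?F]) simp
  qed
  then have "zariski_closure (zero_locus J) = zero_locus J" unfolding zariski_closure_def by blast
  then show ?thesis using W by simp
qed

lemma weddle_properties:
  "zero_locus (weddle_scheme d Ps) = weddle_locus d (set Ps) \<and>
   is_curve (weddle_scheme d Ps) \<and> arithmetically_CM (weddle_scheme d Ps) \<and>
   scheme_degree (weddle_scheme d Ps) = real (((d + 2) choose 3) choose 2)"
  unfolding weddle_scheme_J is_curve_def arithmetically_CM_def
  using zero_locus_weddle krull_dim_Q cohen_macaulay_Q scheme_degree_J n_ge n_eq by simp

end

lemma degree_formula: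
  "real (((d + 2) choose 3) choose 2) =
     1/72 * real d ^ 6 + 1/12 * real d ^ 5 + 13/72 * real d ^ 4 + 1/12 * real d ^ 3
     - 7/36 * real d ^ 2 - 1/6 * real d"
proof (cases d)
  case (Suc k)
  let ?n = "real ((d + 2) choose 3)"
  have "6 * ?n = real d * (real d + 1) * (real d + 2)"
    using real_choose_3[of k] Suc by (simp add: numeral_3_eq_3 add.commute)
  then have n: "?n = real d * (real d + 1) * (real d + 2) / 6" by simp
  have "real (((d + 2) choose 3) choose 2) = ?n * (?n - 1) / 2" by (rule real_choose_two)
  then show ?thesis unfolding n by (simp add: field_simps power_numeral_reduce)
qed (simp add: numeral_3_eq_3 numeral_2_eq_2)

theorem proposition5p2:
  fixes d :: nat
  assumes "d \<ge> 2"
  shows "for_general_points (((d + 2) choose 2) + 1) (\<lambda>Ps.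
           zero_locus (weddle_scheme d Ps) = weddle_locus d (set Ps) \<and>
           is_curve (weddle_scheme d Ps) \<and>
           arithmetically_CM (weddle_scheme d Ps) \<and>
           scheme_degree (weddle_scheme d Ps) = real (((d + 2) choose 3) choose 2))
         \<and> real (((d + 2) choose 3) choose 2) =
             1/72 * real d ^ 6 + 1/12 * real d ^ 5 + 13/72 * real d ^ 4 + 1/12 * real d ^ 3
             - 7/36 * real d ^ 2 - 1/6 * real d"
proof
  have d: "0 < d" using assms by simp
  let ?r = "((d + 2) choose 2) + 1"
  define U where "U = {Ps. length Ps = ?r \<and> (\<exists>f\<in>{cert d}. peval (\<lambda>(i, j). rep_proj3 (Ps ! i) j) f \<noteq> 0)}"
  have "multihomogeneous ?r (cert d)"
    using mhom_multihomogeneous[OF mhom_cert[OF d]] by simp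
  then have open_U: "zariski_open_tuples ?r U"
    unfolding zariski_open_tuples_def by (intro exI[of _ "{cert d}"]) (simp add: U_def)
  have ne: "U \<noteq> {}" using cert_point[OF d] by (auto simp: U_def)
  have gen: "general_points d Ps" if "Ps \<in> U" for Ps
    using that assms by (simp add: U_def general_points_def)
  show "for_general_points ?r (\<lambda>Ps.
           zero_locus (weddle_scheme d Ps) = weddle_locus d (set Ps) \<and>
           is_curve (weddle_scheme d Ps) \<and>
           arithmetically_CM (weddle_scheme d Ps) \<and>
           scheme_degree (weddle_scheme d Ps) = real (((d + 2) choose 3) choose 2))"
    unfolding for_general_points_def
    using open_U ne general_points.weddle_properties[OF gen] general_points.distinct_Ps[OF gen] by blast
qed (rule degree_formula)

end
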